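(* Let $\varphi_p:\operatorname{Int}(\mathcal{M}_k(\mathbb{R}))\to(0_p,I_p)^k$ be the bijection mapping a moment vector $(S_1,\dots,S_k)^T$ to its vector of symmetric canonical moments $(U_1,\dots,U_k)^T$. Then $\varphi_p^{-1}:(0_p,I_p)^k\to\operatorname{Int}(\mathcal{M}_k(\mathbb{R}))$ is matrix differentiable at $\mathbf{U^0}=\tfrac12(I_p,\dots,I_p)^T$ with $$\frac{\partial\varphi_p^{-1}}{\partial\mathbf{U}}(\mathbf{U^0})=A\otimes I_p,$$ where $A$ is the $k\times k$ lower triangular matrix with $a_{i,j}=2^{-2i+2}\binom{2i}{i-j}$ for $j\le i$ and $a_{i,j}=0$ for $j>i$.
   Context: $\mathcal{S}_p(\mathbb{R})$: real symmetric $p\times p$ matrices; $(0_p,I_p)=\{X\in\mathcal{S}_p(\mathbb{R}):0_p<X<I_p\}$ (Loewner order). A real matrix measure on $[0,1]$: $p\times p$ matrix of signed Borel measures with $\mu(B)$ symmetric nonnegative definite, $\mu([0,1])=I_p$; $S_j=\int_0^1x^jd\mu$, $S_0=I_p$; $\mathcal{M}_k(\mathbb{R})$ is the set of moment vectors $(S_1,\dots,S_k)^T$. With block Hankel matrices $\underline H_{2m}=(S_{i+j})_{i,j=0}^m$, $\overline H_{2m}=(S_{i+j+1}-S_{i+j+2})_{i,j=0}^{m-1}$, $\underline H_{2m+1}=(S_{i+j+1})_{i,j=0}^m$, $\overline H_{2m+1}=(S_{i+j}-S_{i+j+1})_{i,j=0}^m$ and block vectors $\underline h_{2m}=(S_{m+1},\dots,S_{2m})^T$,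 $\underline h_{2m-1}=(S_m,\dots,S_{2m-1})^T$, $\bar h_{2m}=(S_m-S_{m+1},\dots,S_{2m-1}-S_{2m})^T$, $\bar h_{2m-1}=(S_m-S_{m+1},\dots,S_{2m-2}-S_{2m-1})^T$, set $S_1^-=0_p$, $S_1^+=I_p$, $S_2^+=S_1$, $S^-_{n+1}=\underline h_n^T\underline H_{n-1}^{-1}\underline h_n$, $S^+_{n+1}=S_n-\bar h_n^T\overline H_{n-1}^{-1}\bar h_n$. On $\operatorname{Int}(\mathcal{M}_k(\mathbb{R}))=\{S_j^-<S_j<S_j^+\ \forall j\le k\}$ the symmetric canonical moments are $U_j=(S_j^+-S_j^-)^{-1/2}(S_j-S_j^-)(S_j^+-S_j^-)^{-1/2}$, and $\varphi_p$ is a bijection onto $(0_p,I_p)^k$. Matrix differentiability: for an open $\mathcal{S}\subset(\mathcal{S}_p(\mathbb{R}))^n$, elements of which are regarded as $np\times p$ block columns, a map $\Phi:\mathcal{S}\to(\mathbb{R}^{p\times p})^m$ is matrix differentiable at $\mathbf{M^0}\in\mathcal{S}$ if there is a real matrix $\mathbf{L}\in\mathbb{R}^{mp\times np}$ such that $\Phi(\mathbf{M^0}+\mathbf{H})-\Phi(\mathbf{M^0})=\mathbf{L}\mathbf{H}+o(\|\mathbf{H}\|)$ as $\mathbf{H}\to0$ in $(\mathcal{S}_p(\mathbb{R}))^n$; then $\frac{\partial\Phi}{\partial\mathbf{M}}(\mathbf{M^0}):=\mathbf{L}$. $\otimes$ is the Kronecker product. *)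

theory Defs
  imports "Jordan_Normal_Form.Matrix"
begin

definition sym_mat :: "nat \<Rightarrow> real mat \<Rightarrow> bool" where
  "sym_mat p X \<longleftrightarrow> X \<in> carrier_mat p p \<and> transpose_mat X = X"

definition posdef :: "nat \<Rightarrow> real mat \<Rightarrow> bool" where
  "posdef p X \<longleftrightarrow> sym_mat p X \<and>
     (\<forall>v \<in> carrier_vec p. v \<noteq> 0\<^sub>v p \<longrightarrow> v \<bullet> (X *\<^sub>v v) > 0)"

definition loew_less :: "nat \<Rightarrow> real mat \<Rightarrow> real mat \<Rightarrow> bool" where
  "loew_less p X Y \<longleftrightarrow> sym_mat p X \<and> sym_mat p Y \<and> posdef p (Y - X)"

definition minv :: "nat \<Rightarrow> real mat \<Rightarrow> real mat" where
  "minv n X = (SOME B. B \<in> carrier_mat n n \<and> X * B = 1\<^sub>m n \<and> B * X = 1\<^sub>m n)"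

definition msqrt :: "nat \<Rightarrow> real mat \<Rightarrow> real mat" where
  "msqrt p X = (THE B. posdef p B \<and> B * B = X)"

definition blockmat :: "nat \<Rightarrow> nat \<Rightarrow> nat \<Rightarrow> (nat \<Rightarrow> nat \<Rightarrow> real mat) \<Rightarrow> real mat" where
  "blockmat p r c F = mat (r * p) (c * p) (\<lambda>(i, j). F (i div p) (j div p) $$ (i mod p, j mod p))"

definition blk :: "nat \<Rightarrow> real mat \<Rightarrow> nat \<Rightarrow> real mat" where
  "blk p V j = mat p p (\<lambda>(a, b). V $$ ((j - 1) * p + a, b))"

definition mseq :: "nat \<Rightarrow> real mat \<Rightarrow> nat \<Rightarrow> real mat" where
  "mseq p V j = (if j = 0 then 1\<^sub>m p else blk p V j)"

definition Hlow :: "nat \<Rightarrow> (nat \<Rightarrow> real mat) \<Rightarrow> nat \<Rightarrow> real mat" where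
  "Hlow p S n = (let m = n div 2 in
     if even n then blockmat p (m+1) (m+1) (\<lambda>i j. S (i+j))
     else blockmat p (m+1) (m+1) (\<lambda>i j. S (i+j+1)))"

definition Hup :: "nat \<Rightarrow> (nat \<Rightarrow> real mat) \<Rightarrow> nat \<Rightarrow> real mat" where
  "Hup p S n = (let m = n div 2 in
     if even n then blockmat p m m (\<lambda>i j. S (i+j+1) - S (i+j+2))
     else blockmat p (m+1) (m+1) (\<lambda>i j. S (i+j) - S (i+j+1)))"

definition hlow :: "nat \<Rightarrow> (nat \<Rightarrow> real mat) \<Rightarrow> nat \<Rightarrow> real mat" where
  "hlow p S n =
     (if even n then (let m = n div 2 in blockmat p m 1 (\<lambda>i _. S (m+1+i)))
      else (let m = (n+1) div 2 in blockmat p m 1 (\<lambda>i _. S (m+i))))"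

definition hup :: "nat \<Rightarrow> (nat \<Rightarrow> real mat) \<Rightarrow> nat \<Rightarrow> real mat" where
  "hup p S n =
     (if even n then (let m = n div 2 in blockmat p m 1 (\<lambda>i _. S (m+i) - S (m+i+1)))
      else (let m = (n+1) div 2 in blockmat p (m-1) 1 (\<lambda>i _. S (m+i) - S (m+i+1))))"

text \<open>Lower and upper bounds S_j^- and S_j^+ (meaningful for j \<ge> 1).\<close>
definition Smin :: "nat \<Rightarrow> (nat \<Rightarrow> real mat) \<Rightarrow> nat \<Rightarrow> real mat" where
  "Smin p S j = (if j \<le> 1 then 0\<^sub>m p p
     else let n = j - 1 in
       transpose_mat (hlow p S n) * minv (dim_row (Hlow p S (n-1))) (Hlow p S (n-1)) * hlow p S n)"

definition Splus :: "nat \<Rightarrow> (nat \<Rightarrow> real mat) \<Rightarrow> nat \<Rightarrow> real mat" where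
  "Splus p S j = (if j \<le> 1 then 1\<^sub>m p
     else if j = 2 then S 1
     else let n = j - 1 in
       S n - transpose_mat (hup p S n) * minv (dim_row (Hup p S (n-1))) (Hup p S (n-1)) * hup p S n)"

text \<open>Elements of (S_p(R))^n as np x p block columns with symmetric blocks.\<close>
definition symcols :: "nat \<Rightarrow> nat \<Rightarrow> real mat set" where
  "symcols p n = {V \<in> carrier_mat (n*p) p. \<forall>j \<in> {1..n}. sym_mat p (blk p V j)}"

definition IntM :: "nat \<Rightarrow> nat \<Rightarrow> real mat set" where
  "IntM p k = {V \<in> symcols p k. \<forall>j \<in> {1..k}.
      loew_less p (Smin p (mseq p V) j) (mseq p V j) \<and>
      loew_less p (mseq p V j) (Splus p (mseq p V) j)}"

definition unitbox :: "nat \<Rightarrow> nat \<Rightarrow> real mat set" where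
  "unitbox p k = {U \<in> symcols p k. \<forall>j \<in> {1..k}.
      loew_less p (0\<^sub>m p p) (blk p U j) \<and> loew_less p (blk p U j) (1\<^sub>m p)}"

definition canmom :: "nat \<Rightarrow> real mat \<Rightarrow> nat \<Rightarrow> real mat" where
  "canmom p V j = (let S = mseq p V; R = minv p (msqrt p (Splus p S j - Smin p S j))
                   in R * (S j - Smin p S j) * R)"

definition phi :: "nat \<Rightarrow> nat \<Rightarrow> real mat \<Rightarrow> real mat" where
  "phi p k V = blockmat p k 1 (\<lambda>i _. canmom p V (i+1))"

definition phi_inv :: "nat \<Rightarrow> nat \<Rightarrow> real mat \<Rightarrow> real mat" where
  "phi_inv p k = the_inv_into (IntM p k) (phi p k)"

definition frob :: "real mat \<Rightarrow> real" where
  "frob M = sqrt (\<Sum>i<dim_row M. \<Sum>j<dim_col M. (M $$ (i,j))\<^sup>2)"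

definition matrix_diff_at ::
  "nat \<Rightarrow> nat \<Rightarrow> nat \<Rightarrow> real mat set \<Rightarrow> (real mat \<Rightarrow> real mat) \<Rightarrow> real mat \<Rightarrow> real mat \<Rightarrow> bool" where
  "matrix_diff_at p n m Dom Phi M0 L \<longleftrightarrow>
     M0 \<in> Dom \<and> L \<in> carrier_mat (m*p) (n*p) \<and>
     (\<forall>\<epsilon>>0. \<exists>\<delta>>0. \<forall>H \<in> symcols p n. frob H < \<delta> \<longrightarrow> M0 + H \<in> Dom \<longrightarrow>
        frob (Phi (M0 + H) - Phi M0 - L * H) \<le> \<epsilon> * frob H)"

definition kron :: "real mat \<Rightarrow> real mat \<Rightarrow> real mat" where
  "kron A B = mat (dim_row A * dim_row B) (dim_col A * dim_col B)
     (\<lambda>(i, j). A $$ (i div dim_row B, j div dim_col B) * B $$ (i mod dim_row B, j mod dim_col B))"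

text \<open>a_{i,j} = 2^{-2i+2} binom(2i, i-j) for j \<le> i (1-indexed); here 0-indexed.\<close>
definition Amat :: "nat \<Rightarrow> real mat" where
  "Amat k = mat k k (\<lambda>(i, j). if j \<le> i
       then 2 powr (- 2 * real (i+1) + 2) * real ((2 * (i+1)) choose (i - j)) else 0)"

end

theory Submission
  imports Defs "Jordan_Normal_Form.Determinant" "HOL-Library.Landau_Symbols" "HOL-Analysis.L2_Norm"
begin

text \<open>
  A bound \<open>h\<^sup>T H\<^sup>-\<^sup>1 h\<close> is a quadratic minimum, so for a monic polynomial \<open>P\<close> with scalar
  coefficients it equals a linear functional of the moments up to an error quadratic in the residual
  of \<open>P\<close>. The matrix \<open>U\<^sup>0\<close> corresponds to the scalar moments of the arcsine law, where the optimal
  \<open>P\<close> are Chebyshev polynomials of the four kinds. With \<open>T\<^sub>j\<close> the shifted Chebyshev polynomial and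
  \<open>\<ell>\<close> the moment functional, this gives, up to quadratic errors,
  \<open>S\<^sub>j - S\<^sub>j\<^sup>- = 2 \<cdot> 4\<^sup>-\<^sup>j \<ell>(1 + T\<^sub>j)\<close> and \<open>S\<^sub>j\<^sup>+ - S\<^sub>j = 2 \<cdot> 4\<^sup>-\<^sup>j \<ell>(1 - T\<^sub>j)\<close>. The range
  \<open>S\<^sub>j\<^sup>+ - S\<^sub>j\<^sup>-\<close> is therefore the scalar \<open>4 \<cdot> 4\<^sup>-\<^sup>j\<close> to first order, so that its noncommuting square
  roots do not matter and \<open>U\<^sub>j - 1/2 = \<ell>(T\<^sub>j)/2\<close> to first order. Expanding \<open>x\<^sup>i\<close> in
  Chebyshev polynomials inverts this relation and yields the coefficients \<open>a\<^sub>i\<^sub>j\<close>.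
\<close>

section \<open>Moment functionals and Chebyshev polynomials\<close>

text \<open>The obstacle is that \<open>phi_inv\<close> is a definite description and that the
  bounds contain inverses and square roots which are arbitrary where they do not exist. So the
  inverse is built by a total recursion (\<open>moments\<close>), and its properties are proved only
  eventually, along a filter on which a size \<eta> tends to 0. At index j only the moments below j
  are under control. This suffices: 2 * 4^-j (1 + T_j) is monic of degree j and 2 * 4^-j (1 - T_j)
  has leading coefficient -1, so S_j cancels from the approximations of both bounds. The quadratic
  error has a single source. Shifting h by the image under H of a block column changes h^T H^-1 h by
  terms free of H^-1; the inverse survives only between two residuals, and these vanish at the
  centre by orthogonality. Since the coefficients of P are scalars, each matrix position (a,b)
  follows the scalar theory on its own, which is why the derivative is a Kronecker product with the
  identity. No measure appears: the arcsine law enters only as a linear functional on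
  polynomials.\<close>

definition lin :: "(nat \<Rightarrow> real) \<Rightarrow> real poly \<Rightarrow> real" where
  "lin s f = (\<Sum>i\<le>degree f. coeff f i * s i)"

lemma lin_upto: "degree f \<le> N \<Longrightarrow> lin s f = (\<Sum>i\<le>N. coeff f i * s i)"
  unfolding lin_def by (rule sum.mono_neutral_left) (auto simp: coeff_eq_0)

lemma lin_add: "lin s (f + g) = lin s f + lin s g"
proof -
  define N where "N = max (degree f) (degree g)"
  have "degree (f + g) \<le> N" "degree f \<le> N" "degree g \<le> N"
    by (auto simp: N_def degree_add_le)
  then show ?thesis by (simp add: lin_upto[of _ N] sum.distrib algebra_simps)
qed

lemma lin_smult: "lin s (smult c f) = c * lin s f"
  by (simp add: lin_upto[OF degree_smult_le] lin_def sum_distrib_left mult.assoc)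

lemma lin_diff: "lin s (f - g) = lin s f - lin s g"
  using lin_add[of s f "smult (-1) g"] lin_smult[of s "-1" g] by simp

lemma lin_0 [simp]: "lin s 0 = 0"
  by (simp add: lin_def)

lemma lin_sum: "lin s (\<Sum>i\<in>A. f i) = (\<Sum>i\<in>A. lin s (f i))"
  by (induction A rule: infinite_finite_induct) (auto simp: lin_add)

lemma lin_monom: "lin s (monom c n) = c * s n"
proof -
  have "lin s (monom c n) = (\<Sum>i\<le>n. coeff (monom c n) i * s i)"
    by (rule lin_upto) (rule degree_monom_le)
  also have "\<dots> = (\<Sum>i\<le>n. if i = n then c * s n else 0)"
    by (rule sum.cong) auto
  finally show ?thesis by simp
qed

lemma lin_const: "lin s [:c:] = c * s 0"
  using lin_monom[of s c 0] by (simp add: monom_0)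

text \<open>Reading moments through a weight w gives again a moment sequence. The shifts and
  differences in the block Hankel matrices are thereby the weights x, 1 - x and x (1 - x), and one
  theory of Hankel matrices covers all four families.\<close>

lemma lin_seq_mult: "lin (\<lambda>i. lin s (w * monom 1 i)) f = lin s (w * f)"
proof -
  have "w * f = (\<Sum>i\<le>degree f. smult (coeff f i) (w * monom 1 i))"
    by (subst (1) poly_as_sum_of_monoms[of f, symmetric])
      (simp add: sum_distrib_left mult_smult_right[symmetric] smult_monom del: mult_smult_right)
  then show ?thesis by (simp add: lin_sum lin_smult lin_def[of _ f])
qed

section \<open>Shifted Chebyshev polynomials of the four kinds\<close>

fun cheb_T :: "nat \<Rightarrow> real poly" where
  "cheb_T 0 = 1"
| "cheb_T (Suc 0) = [:-1, 2:]"
| "cheb_T (Suc (Suc n)) = [:-2, 4:] * cheb_T (Suc n) - cheb_T n"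

text \<open>On [0,1] the recurrence factor is 2 (2x - 1) = 4x - 2. The second, third and fourth
  kinds share it together with the start 1, and differ only in the constant term in degree one: a =
  -2, -3 and -1 respectively.\<close>

fun cheb :: "real \<Rightarrow> nat \<Rightarrow> real poly" where
  "cheb a 0 = 1"
| "cheb a (Suc 0) = [:a, 4:]"
| "cheb a (Suc (Suc n)) = [:-2, 4:] * cheb a (Suc n) - cheb a n"

lemma three_term:
  assumes "degree f = Suc n" "degree g = n" "lead_coeff f = c"
  shows "degree ([:-2, 4:] * f - g) = Suc (Suc n) \<and> lead_coeff ([:-2, 4:] * f - g) = 4 * (c :: real)"
proof -
  have f0: "f \<noteq> 0" using assms by auto
  have d: "degree ([:-2, 4:] * f) = Suc (Suc n)"
    by (subst degree_mult_eq) (use f0 assms in auto)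
  have l: "lead_coeff ([:-2, 4:] * f) = 4 * c"
    by (subst lead_coeff_mult) (use assms in auto)
  have "degree ([:-2, 4:] * f - g) = degree ([:-2, 4:] * f)"
    using degree_add_eq_left[of "-g" "[:-2, 4:] * f"] d assms by simp
  then show ?thesis using d l assms by (simp add: coeff_eq_0)
qed

lemma cheb_degree: "degree (cheb a n) = n \<and> lead_coeff (cheb a n) = 4 ^ n"
proof (induction n rule: induct_nat_012)
  case (ge2 n)
  have "degree ([:-2, 4:] * cheb a (Suc n) - cheb a n) = Suc (Suc n) \<and>
      lead_coeff ([:-2, 4:] * cheb a (Suc n) - cheb a n) = 4 * 4 ^ Suc n"
    by (rule three_term) (use ge2 in auto)
  then show ?case by (metis cheb.simps(3) power_Suc)
qed auto

lemma cheb_T_degree_Suc: "degree (cheb_T (Suc n)) = Suc n \<and> lead_coeff (cheb_T (Suc n)) = 2 * 4 ^ n"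
proof (induction n rule: less_induct)
  case (less n)
  show ?case
  proof (cases n)
    case (Suc m)
    have "degree (cheb_T m) = m" using less[of "m - 1"] Suc by (cases m) auto
    then have "degree ([:-2, 4:] * cheb_T (Suc m) - cheb_T m) = Suc (Suc m) \<and>
      lead_coeff ([:-2, 4:] * cheb_T (Suc m) - cheb_T m) = 4 * (2 * 4 ^ m)"
      by (intro three_term) (use less[of m] Suc in auto)
    then show ?thesis by (metis Suc cheb_T.simps(3) power_Suc mult.left_commute)
  qed simp
qed

text \<open>At the point cos^2 x the recurrence factor equals 2 cos 2x, so one step of the
  recurrence raises the angle by 2x.\<close>

lemma cos_sin_step:
  fixes x y :: real
  shows "(4 * (cos x)\<^sup>2 - 2) * cos y - cos (y - 2 * x) = cos (y + 2 * x)"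
    and "(4 * (cos x)\<^sup>2 - 2) * sin y - sin (y - 2 * x) = sin (y + 2 * x)"
proof -
  have c: "4 * (cos x)\<^sup>2 - 2 = 2 * cos (2 * x)" by (simp add: cos_double_cos)
  show "(4 * (cos x)\<^sup>2 - 2) * cos y - cos (y - 2 * x) = cos (y + 2 * x)"
    and "(4 * (cos x)\<^sup>2 - 2) * sin y - sin (y - 2 * x) = sin (y + 2 * x)"
    unfolding c cos_add cos_diff sin_add sin_diff by simp_all
qed

text \<open>The factor u (1, cos x, sin x or sin 2x) is the denominator of the trigonometric
  quotient for each kind. Keeping it multiplied in avoids excluding the points where it
  vanishes.\<close>

lemma three_term_eval:
  fixes u y :: real
  assumes "u * poly g y = a" "u * poly f y = b" "(4 * y - 2) * b - a = c"
  shows "u * poly ([:-2, 4:] * f - g) y = c"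
  unfolding assms(3)[symmetric] assms(1,2)[symmetric] by (simp add: algebra_simps)

lemma poly_T: "poly (cheb_T n) ((cos x)\<^sup>2) = cos (2 * real n * x)"
proof -
  have "1 * poly (cheb_T n) ((cos x)\<^sup>2) = cos (2 * real n * x)"
  proof (induction n rule: induct_nat_012)
    case 1
    show ?case using cos_double_cos[of x] by simp
  next
    case (ge2 n)
    show ?case unfolding cheb_T.simps
      by (rule three_term_eval[OF ge2])
        (use cos_sin_step(1)[of x "2 * real (Suc n) * x"] in \<open>simp add: distrib_left distrib_right add_ac\<close>)
  qed simp
  then show ?thesis by simp
qed

lemma poly_cheb_U: "sin (2 * x) * poly (cheb (-2) n) ((cos x)\<^sup>2) = sin (2 * (real n + 1) * x)"
proof (induction n rule: induct_nat_012)
  case 1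
  show ?case using cos_sin_step(2)[of x "2 * x"] by (simp add: mult.commute)
next
  case (ge2 n)
  show ?case unfolding cheb.simps
    by (rule three_term_eval[OF ge2])
      (use cos_sin_step(2)[of x "2 * (real (Suc n) + 1) * x"] in \<open>simp add: distrib_left distrib_right add_ac\<close>)
qed simp

lemma poly_cheb_V: "cos x * poly (cheb (-3) n) ((cos x)\<^sup>2) = cos ((2 * real n + 1) * x)"
proof (induction n rule: induct_nat_012)
  case 1
  show ?case using cos_sin_step(1)[of x x] by (simp add: algebra_simps)
next
  case (ge2 n)
  show ?case unfolding cheb.simps
    by (rule three_term_eval[OF ge2])
      (use cos_sin_step(1)[of x "(2 * real (Suc n) + 1) * x"] in \<open>simp add: distrib_left distrib_right add_ac\<close>)
qed simp

lemma poly_cheb_W: "sin x * poly (cheb (-1) n) ((cos x)\<^sup>2) = sin ((2 * real n + 1) * x)"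
proof (induction n rule: induct_nat_012)
  case 1
  show ?case using cos_sin_step(2)[of x x] by (simp add: algebra_simps)
next
  case (ge2 n)
  show ?case unfolding cheb.simps
    by (rule three_term_eval[OF ge2])
      (use cos_sin_step(2)[of x "(2 * real (Suc n) + 1) * x"] in \<open>simp add: distrib_left distrib_right add_ac\<close>)
qed simp

text \<open>The values cos^2 x fill the infinite set [0,1], so the Chebyshev identities below can be
  checked as trigonometric ones.\<close>

lemma poly_eq_cosI:
  fixes f g :: "real poly"
  assumes "\<And>x. poly f ((cos x)\<^sup>2) = poly g ((cos x)\<^sup>2)"
  shows "f = g"
proof (rule ccontr)
  assume "f \<noteq> g"
  then have "finite {y. poly (f - g) y = 0}" by (intro poly_roots_finite) simp
  moreover have "{0..1} \<subseteq> {y. poly (f - g) y = 0}"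
  proof
    fix y :: real assume y: "y \<in> {0..1}"
    then have "(cos (arccos (sqrt y)))\<^sup>2 = y"
      by (subst cos_arccos) (auto simp: order_trans[OF _ real_sqrt_ge_zero])
    with assms[of "arccos (sqrt y)"] show "y \<in> {y. poly (f - g) y = 0}" by simp
  qed
  ultimately have "finite {0..1::real}" by (rule rev_finite_subset)
  then show False using infinite_Icc[of "0::real" 1] by simp
qed

text \<open>The i-th moment of the arcsine law on [0,1], whose density is 1 / (pi sqrt (x (1 - x))).
  Taking the closed form as the definition keeps integration out of the argument.\<close>

definition arcsine_moment :: "nat \<Rightarrow> real" where
  "arcsine_moment i = real ((2 * i) choose i) / 4 ^ i"

text \<open>Expand the power of 2 cos x = cis x + cis (-x) binomially and take real parts.\<close>

lemma cos_power_expansion: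
  "4 ^ i * (cos x) ^ (2 * i) = (\<Sum>r\<le>2*i. real ((2 * i) choose r) * cos (2 * (real r - real i) * x))"
proof -
  have "complex_of_real (2 * cos x) ^ (2 * i) = (cis x + cis (-x)) ^ (2 * i)"
    by (simp add: complex_eq_iff cis.sel)
  also have "\<dots> = (\<Sum>r\<le>2*i. of_nat ((2 * i) choose r) * cis x ^ r * cis (-x) ^ (2 * i - r))"
    by (rule binomial_ring)
  also have "\<dots> = (\<Sum>r\<le>2*i. of_real (real ((2 * i) choose r)) * cis (2 * (real r - real i) * x))"
  proof (rule sum.cong)
    fix r assume "r \<in> {..2 * i}"
    then have "cis x ^ r * cis (-x) ^ (2 * i - r) = cis (2 * (real r - real i) * x)"
      by (simp add: Complex.DeMoivre cis_mult of_nat_diff algebra_simps)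
    then show "of_nat ((2 * i) choose r) * cis x ^ r * cis (-x) ^ (2 * i - r)
        = of_real (real ((2 * i) choose r)) * cis (2 * (real r - real i) * x)"
      by (simp add: mult.assoc)
  qed simp
  finally have "Re (complex_of_real (2 * cos x) ^ (2 * i)) =
      (\<Sum>r\<le>2*i. real ((2 * i) choose r) * cos (2 * (real r - real i) * x))"
    by (simp add: Re_sum)
  moreover have "Re (complex_of_real (2 * cos x) ^ (2 * i)) = 4 ^ i * (cos x) ^ (2 * i)"
    by (simp only: of_real_power[symmetric] Re_complex_of_real power_mult_distrib power_mult) simp
  ultimately show ?thesis by simp
qed

lemma sum_fold_centre:
  fixes f :: "nat \<Rightarrow> real"
  assumes "\<And>l. l \<le> i \<Longrightarrow> f (i - l) = g l" "\<And>l. l \<le> i \<Longrightarrow> f (i + l) = g l"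
  shows "(\<Sum>r\<le>2*i. f r) = g 0 + 2 * (\<Sum>l=1..i. g l)"
proof -
  have "{..2*i} = {..<i} \<union> {i..2*i}" by auto
  then have "(\<Sum>r\<le>2*i. f r) = (\<Sum>r<i. f r) + (\<Sum>r=i..2*i. f r)"
    by (simp add: sum.union_disjoint ivl_disj_int)
  then have "(\<Sum>r\<le>2*i. f r) = (\<Sum>r<i. f r) + (f i + (\<Sum>r=i+1..2*i. f r))"
    by (simp add: sum.atLeast_Suc_atMost)
  moreover have "(\<Sum>r<i. f r) = (\<Sum>l=1..i. g l)"
    by (rule sum.reindex_bij_witness[of _ "\<lambda>l. i - l" "\<lambda>r. i - r"]) (auto simp: assms(1)[symmetric])
  moreover have "(\<Sum>r=i+1..2*i. f r) = (\<Sum>l=1..i. g l)"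
    by (rule sum.reindex_bij_witness[of _ "\<lambda>l. i + l" "\<lambda>r. r - i"]) (auto simp: assms(2)[symmetric])
  moreover have "f i = g 0" using assms(1)[of 0] by simp
  ultimately show ?thesis by simp
qed

text \<open>The expansion of cos^(2i) is symmetric about its middle term. Folding it leaves the
  middle binomial as constant term, which is 4^i times the arcsine moment, and the T_l with the
  binomials that make up A.\<close>

lemma monom_chebyshev:
  "smult (4 ^ i) (monom 1 i) =
     [:real ((2 * i) choose i):] + smult 2 (\<Sum>l=1..i. smult (real ((2 * i) choose (i - l))) (cheb_T l))"
proof (rule poly_eq_cosI)
  fix x :: real
  have sym: "(2 * i) choose (i + l) = (2 * i) choose (i - l)" if "l \<le> i" for l
    using that binomial_symmetric[of "i + l" "2 * i"] by simp
  have "4 ^ i * (cos x) ^ (2 * i) = real ((2 * i) choose (i - 0)) * cos (2 * real 0 * x)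
      + 2 * (\<Sum>l=1..i. real ((2 * i) choose (i - l)) * cos (2 * real l * x))"
    unfolding cos_power_expansion
  proof (rule sum_fold_centre)
    fix l assume "l \<le> i"
    then have "2 * (real (i - l) - real i) * x = - (2 * real l * x)"
      by (simp add: of_nat_diff algebra_simps)
    then show "real (2 * i choose (i - l)) * cos (2 * (real (i - l) - real i) * x) =
         real (2 * i choose (i - l)) * cos (2 * real l * x)"
      by (simp only: cos_minus)
  qed (simp add: sym)
  then show "poly (smult (4 ^ i) (monom 1 i)) ((cos x)\<^sup>2) =
    poly ([:real ((2 * i) choose i):] + smult 2 (\<Sum>l=1..i. smult (real ((2 * i) choose (i - l))) (cheb_T l))) ((cos x)\<^sup>2)"
    by (simp add: poly_monom poly_sum poly_T power_mult)
qed

text \<open>Apply the functional to \<open>monom_chebyshev\<close>: the constant term already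
  accounts for the moment of x^n, and by induction the lower T_l contribute nothing, which leaves
  T_n with a nonzero coefficient.\<close>

lemma arcsine_T: "n \<ge> 1 \<Longrightarrow> lin arcsine_moment (cheb_T n) = 0"
proof (induction n rule: less_induct)
  case (less n)
  have "lin arcsine_moment (smult (4 ^ n) (monom 1 n)) =
      real ((2 * n) choose n) + 2 * (\<Sum>l=1..n. real ((2 * n) choose (n - l)) * lin arcsine_moment (cheb_T l))"
    unfolding monom_chebyshev
    by (simp add: lin_add lin_smult lin_sum lin_const arcsine_moment_def[of 0])
  moreover have "lin arcsine_moment (smult (4 ^ n) (monom 1 n)) = real ((2 * n) choose n)"
    by (simp add: lin_smult lin_monom arcsine_moment_def)
  ultimately have "(\<Sum>l=1..n. real ((2 * n) choose (n - l)) * lin arcsine_moment (cheb_T l)) = 0"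
    by simp
  also have "(\<Sum>l=1..n. real ((2 * n) choose (n - l)) * lin arcsine_moment (cheb_T l)) =
      (\<Sum>l\<in>{n}. real ((2 * n) choose (n - l)) * lin arcsine_moment (cheb_T l))"
    by (rule sum.mono_neutral_right) (use less in auto)
  finally show ?case by simp
qed

text \<open>The recurrence read as 4x T_n = T_(n+1) + 2 T_n + T_(n-1) trades one power of x for
  neighbouring indices, each of which still exceeds the remaining power.\<close>

lemma arcsine_T_orth: "i < n \<Longrightarrow> lin arcsine_moment (cheb_T n * monom 1 i) = 0"
proof (induction i arbitrary: n)
  case 0
  then show ?case by (simp add: arcsine_T monom_0)
next
  case (Suc i)
  then obtain m where n: "n = Suc m" and m: "i < m" by (cases n) auto
  have "smult 4 (cheb_T n * monom 1 (Suc i)) =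
      cheb_T (Suc (Suc m)) * monom 1 i + smult 2 (cheb_T (Suc m) * monom 1 i) + cheb_T m * monom 1 i"
    unfolding n by (simp add: monom_Suc algebra_simps smult_add_right)
  then have "4 * lin arcsine_moment (cheb_T n * monom 1 (Suc i)) = 0"
    using Suc.IH[of "Suc (Suc m)"] Suc.IH[of "Suc m"] Suc.IH[of m] m
    by (metis (no_types, lifting) lin_add lin_smult add_0 less_SucI mult_zero_right)
  then show ?case by simp
qed

text \<open>Product-to-sum formulas: multiplied by their weights, the other three kinds are
  combinations of two T's. Their orthogonality for the weighted functional is thus reduced to
  \<open>arcsine_T_orth\<close>.\<close>

lemma cheb_weight:
  "[:0, 1:] * cheb (-3) m = smult (1/2) (cheb_T m + cheb_T (m + 1))"
  "[:0, 1, -1:] * cheb (-2) m = smult (1/8) (cheb_T m - cheb_T (m + 2))"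
  "[:1, -1:] * cheb (-1) m = smult (1/2) (cheb_T m - cheb_T (m + 1))"
proof -
  show "[:0, 1:] * cheb (-3) m = smult (1/2) (cheb_T m + cheb_T (m + 1))"
  proof (rule poly_eq_cosI)
    fix x :: real
    define y where "y = (2 * real m + 1) * x"
    have a: "2 * real m * x = y - x" "2 * real (m + 1) * x = y + x" by (simp_all add: y_def algebra_simps)
    have "poly ([:0, 1:] * cheb (-3) m) ((cos x)\<^sup>2) = cos x * cos y"
      using poly_cheb_V[of x m] unfolding y_def by (simp add: power2_eq_square)
    then show "poly ([:0, 1:] * cheb (-3) m) ((cos x)\<^sup>2) = poly (smult (1/2) (cheb_T m + cheb_T (m + 1))) ((cos x)\<^sup>2)"
      unfolding poly_smult poly_add poly_T a cos_add cos_diff by simp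
  qed
  show "[:0, 1, -1:] * cheb (-2) m = smult (1/8) (cheb_T m - cheb_T (m + 2))"
  proof (rule poly_eq_cosI)
    fix x :: real
    define y where "y = 2 * (real m + 1) * x"
    have a: "2 * real m * x = y - 2 * x" "2 * real (m + 2) * x = y + 2 * x" by (simp_all add: y_def algebra_simps)
    have "poly ([:0, 1, -1:] * cheb (-2) m) ((cos x)\<^sup>2) = (cos x)\<^sup>2 * (sin x)\<^sup>2 * poly (cheb (-2) m) ((cos x)\<^sup>2)"
      by (simp add: sin_squared_eq algebra_simps)
    also have "\<dots> = sin (2 * x) * (sin (2 * x) * poly (cheb (-2) m) ((cos x)\<^sup>2)) / 4"
      by (simp add: sin_double power2_eq_square)
    also have "\<dots> = sin (2 * x) * sin y / 4"
      unfolding poly_cheb_U y_def by simp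
    finally show "poly ([:0, 1, -1:] * cheb (-2) m) ((cos x)\<^sup>2) = poly (smult (1/8) (cheb_T m - cheb_T (m + 2))) ((cos x)\<^sup>2)"
      unfolding poly_smult poly_diff poly_T a cos_add cos_diff by simp
  qed
  show "[:1, -1:] * cheb (-1) m = smult (1/2) (cheb_T m - cheb_T (m + 1))"
  proof (rule poly_eq_cosI)
    fix x :: real
    define y where "y = (2 * real m + 1) * x"
    have a: "2 * real m * x = y - x" "2 * real (m + 1) * x = y + x" by (simp_all add: y_def algebra_simps)
    have "poly ([:1, -1:] * cheb (-1) m) ((cos x)\<^sup>2) = (sin x)\<^sup>2 * poly (cheb (-1) m) ((cos x)\<^sup>2)"
      by (simp add: sin_squared_eq algebra_simps)
    also have "\<dots> = sin x * sin y"
      using poly_cheb_W[of x m] unfolding y_def by (simp add: power2_eq_square)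
    finally show "poly ([:1, -1:] * cheb (-1) m) ((cos x)\<^sup>2) = poly (smult (1/2) (cheb_T m - cheb_T (m + 1))) ((cos x)\<^sup>2)"
      unfolding poly_smult poly_diff poly_T a cos_add cos_diff by simp
  qed
qed

text \<open>
  For each \<open>j\<close>, the weight and the monic orthogonal polynomial for which \<open>S\<^sub>j - S\<^sub>j\<^sup>-\<close>
  (\<open>low\<close>) and \<open>S\<^sub>j\<^sup>+ - S\<^sub>j\<close> (\<open>up\<close>) are quadratic minima.
\<close>

definition low_wt :: "nat \<Rightarrow> real poly" where
  "low_wt j = (if even j then 1 else [:0, 1:])"

definition up_wt :: "nat \<Rightarrow> real poly" where
  "up_wt j = (if even j then [:0, 1, -1:] else [:1, -1:])"

text \<open>The prefactors make the polynomials monic. T_m has leading coefficient 4^m / 2 for m > 0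
  but 1 for m = 0, hence the separate case, which supplies the polynomial of degree 0 for the weight
  1.\<close>

definition low_poly :: "nat \<Rightarrow> real poly" where
  "low_poly j = (if j = 0 then 1 else if even j then smult (2 / 4 ^ (j div 2)) (cheb_T (j div 2))
     else smult (1 / 4 ^ (j div 2)) (cheb (-3) (j div 2)))"

definition up_poly :: "nat \<Rightarrow> real poly" where
  "up_poly j = smult (1 / 4 ^ ((j - 1) div 2)) (cheb (if even j then -2 else -1) ((j - 1) div 2))"

lemma low_poly_monic: "degree (low_poly j) = j div 2 \<and> lead_coeff (low_poly j) = 1"
proof (cases "even j \<and> j \<noteq> 0")
  case True
  then obtain m where "j div 2 = Suc m" by (cases "j div 2") auto
  moreover have "degree (cheb_T (Suc m)) = Suc m" "coeff (cheb_T (Suc m)) (Suc m) = 2 * 4 ^ m"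
    using cheb_T_degree_Suc[of m] by metis+
  ultimately show ?thesis using True by (simp add: low_poly_def del: cheb_T.simps)
next
  case False
  then show ?thesis using cheb_degree[of "-3" "j div 2"] by (auto simp: low_poly_def)
qed

lemma up_poly_monic: "degree (up_poly j) = (j - 1) div 2 \<and> lead_coeff (up_poly j) = 1"
  using cheb_degree[of "-2" "(j - 1) div 2"] cheb_degree[of "-1" "(j - 1) div 2"]
  by (auto simp: up_poly_def)

lemma low_poly_orth:
  assumes "i < j div 2"
  shows "lin arcsine_moment (low_wt j * low_poly j * monom 1 i) = 0"
proof (cases "even j")
  case True
  then show ?thesis using assms arcsine_T_orth[of i "j div 2"]
    by (auto simp: low_wt_def low_poly_def lin_smult)
next
  case False
  then have "low_wt j * low_poly j = smult (1 / 4 ^ (j div 2) * (1/2)) (cheb_T (j div 2) + cheb_T (j div 2 + 1))"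
    unfolding smult_smult[symmetric] cheb_weight(1)[symmetric]
    by (auto simp: low_wt_def low_poly_def odd_pos)
  then show ?thesis using assms arcsine_T_orth[of i "j div 2"] arcsine_T_orth[of i "j div 2 + 1"]
    by (simp add: lin_smult lin_add distrib_right del: cheb_T.simps)
qed

lemma up_poly_orth:
  assumes "i < (j - 1) div 2"
  shows "lin arcsine_moment (up_wt j * up_poly j * monom 1 i) = 0"
proof -
  define m where "m = (j - 1) div 2"
  have "\<exists>c n. n > m \<and> up_wt j * up_poly j = smult c (cheb_T m - cheb_T n)"
  proof (cases "even j")
    case True
    have "up_wt j * up_poly j = smult (1 / 4 ^ m * (1/8)) (cheb_T m - cheb_T (m + 2))"
      unfolding smult_smult[symmetric] cheb_weight(2)[symmetric]
      by (simp only: up_wt_def up_poly_def True if_True mult_smult_right m_def)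
    then show ?thesis by (intro exI[of _ "1 / 4 ^ m * (1/8)"] exI[of _ "m + 2"]) simp
  next
    case False
    have "up_wt j * up_poly j = smult (1 / 4 ^ m * (1/2)) (cheb_T m - cheb_T (m + 1))"
      unfolding smult_smult[symmetric] cheb_weight(3)[symmetric]
      by (simp only: up_wt_def up_poly_def False if_False mult_smult_right m_def)
    then show ?thesis by (intro exI[of _ "1 / 4 ^ m * (1/2)"] exI[of _ "m + 1"]) simp
  qed
  then show ?thesis using assms arcsine_T_orth[of i]
    by (auto simp: m_def lin_smult lin_diff left_diff_distrib)
qed

text \<open>At cos^2 x both parities reduce to a multiple of cos^2 (j x) = (1 + cos (2 j x)) / 2,
  and the monic normalisation gives the same multiple in both. This is the source of the uniform
  formula for S_j - S_j^-.\<close>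

lemma low_poly_square:
  assumes "j \<ge> 1"
  shows "low_wt j * (low_poly j * low_poly j) = smult (2 / 4 ^ j) (1 + cheb_T j)"
proof (rule poly_eq_cosI)
  fix x :: real
  define y where "y = real j * x"
  have r: "poly (smult (2 / 4 ^ j) (1 + cheb_T j)) ((cos x)\<^sup>2) = 4 / 4 ^ j * (cos y)\<^sup>2"
    using cos_double_cos[of y] by (simp add: poly_T y_def mult.assoc)
  show "poly (low_wt j * (low_poly j * low_poly j)) ((cos x)\<^sup>2) = poly (smult (2 / 4 ^ j) (1 + cheb_T j)) ((cos x)\<^sup>2)"
  proof (cases "even j")
    case True
    then obtain m where m: "j = 2 * m" by blast
    have e: "(4::real) ^ j = 4 ^ m * 4 ^ m" unfolding m mult_2 by (simp add: power_add)
    from m have "poly (low_poly j) ((cos x)\<^sup>2) = 2 / 4 ^ m * cos y"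
      using assms by (simp add: low_poly_def poly_T y_def)
    then have "poly (low_wt j * (low_poly j * low_poly j)) ((cos x)\<^sup>2) = (2 / 4 ^ m * cos y) * (2 / 4 ^ m * cos y)"
      using True by (simp add: low_wt_def)
    then show ?thesis unfolding r unfolding e by (simp add: power2_eq_square)
  next
    case False
    then obtain m where m: "j = 2 * m + 1" using oddE by blast
    have e: "(4::real) ^ j = 4 * 4 ^ m * 4 ^ m" unfolding m mult_2 by (simp add: power_add)
    define u where "u = poly (cheb (-3) m) ((cos x)\<^sup>2)"
    have "cos x * u = cos y" by (simp add: poly_cheb_V y_def m u_def add.commute)
    then have "(cos y)\<^sup>2 = (cos x)\<^sup>2 * u\<^sup>2"
      by (simp flip: power_mult_distrib)
    moreover have "poly (low_poly j) ((cos x)\<^sup>2) = u / 4 ^ m"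
      using False by (simp add: low_poly_def m u_def)
    then have "poly (low_wt j * (low_poly j * low_poly j)) ((cos x)\<^sup>2) = (cos x)\<^sup>2 * (u / 4 ^ m) * (u / 4 ^ m)"
      using False by (simp add: low_wt_def)
    ultimately show ?thesis unfolding r unfolding e by (simp add: power2_eq_square)
  qed
qed

text \<open>Here both parities reduce to the same multiple of sin^2 (j x) = (1 - cos (2 j x)) /
  2.\<close>

lemma up_poly_square:
  assumes "j \<ge> 1"
  shows "up_wt j * (up_poly j * up_poly j) = smult (2 / 4 ^ j) (1 - cheb_T j)"
proof (rule poly_eq_cosI)
  fix x :: real
  define y where "y = real j * x"
  have r: "poly (smult (2 / 4 ^ j) (1 - cheb_T j)) ((cos x)\<^sup>2) = 4 / 4 ^ j * (sin y)\<^sup>2"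
    using cos_double_sin[of y] by (simp add: poly_T y_def mult.assoc)
  show "poly (up_wt j * (up_poly j * up_poly j)) ((cos x)\<^sup>2) = poly (smult (2 / 4 ^ j) (1 - cheb_T j)) ((cos x)\<^sup>2)"
  proof (cases "even j")
    case True
    then obtain m' where "j = 2 * m'" by blast
    with assms obtain m where m: "j = 2 * m + 2" by (cases m') auto
    have e: "(4::real) ^ j = 16 * 4 ^ m * 4 ^ m" unfolding m mult_2 by (simp add: power_add)
    define u where "u = poly (cheb (-2) m) ((cos x)\<^sup>2)"
    have "sin (2 * x) * u = sin y" using poly_cheb_U[of x m] by (simp add: y_def m u_def algebra_simps)
    then have "sin y = 2 * sin x * cos x * u" by (simp add: sin_double)
    then have "(sin y)\<^sup>2 = 4 * (cos x)\<^sup>2 * (1 - (cos x)\<^sup>2) * u\<^sup>2"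
      by (simp add: power_mult_distrib sin_squared_eq)
    moreover have "poly (up_poly j) ((cos x)\<^sup>2) = u / 4 ^ m"
      using True by (simp add: up_poly_def m u_def)
    then have "poly (up_wt j * (up_poly j * up_poly j)) ((cos x)\<^sup>2) =
        (cos x)\<^sup>2 * (1 - (cos x)\<^sup>2) * (u / 4 ^ m) * (u / 4 ^ m)"
      using True by (simp add: up_wt_def algebra_simps)
    ultimately show ?thesis unfolding r unfolding e by (simp add: power2_eq_square)
  next
    case False
    then obtain m where m: "j = 2 * m + 1" using oddE by blast
    have e: "(4::real) ^ j = 4 * 4 ^ m * 4 ^ m" unfolding m mult_2 by (simp add: power_add)
    define u where "u = poly (cheb (-1) m) ((cos x)\<^sup>2)"
    have w: "poly (up_wt j) ((cos x)\<^sup>2) = 1 - (cos x)\<^sup>2" using False by (simp add: up_wt_def)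
    have "sin x * u = sin y" by (simp add: poly_cheb_W y_def m u_def add.commute)
    then have "(sin y)\<^sup>2 = (sin x * u)\<^sup>2" by simp
    then have "(sin y)\<^sup>2 = (1 - (cos x)\<^sup>2) * u\<^sup>2"
      by (simp add: power_mult_distrib sin_squared_eq)
    moreover have "poly (up_poly j) ((cos x)\<^sup>2) = u / 4 ^ m"
      using False by (simp add: up_poly_def m u_def)
    then have "poly (up_wt j * (up_poly j * up_poly j)) ((cos x)\<^sup>2) = (1 - (cos x)\<^sup>2) * (u / 4 ^ m) * (u / 4 ^ m)"
      using w by (simp only: poly_mult mult.assoc)
    ultimately show ?thesis unfolding r unfolding e by (simp add: power2_eq_square)
  qed
qed

text \<open>By the square formula the norm is 2 / 4^j for j > 0, since the functional annihilates
  T_j, and it is 1 for j = 0. Nonzero norms will make the scalar Hankel matrices invertible.\<close>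

lemma low_poly_norm: "lin arcsine_moment (low_wt j * (low_poly j * low_poly j)) \<noteq> 0"
proof (cases "j = 0")
  case True
  then show ?thesis
    using lin_const[of arcsine_moment 1] by (simp add: low_wt_def low_poly_def arcsine_moment_def one_pCons)
next
  case False
  then show ?thesis using lin_const[of arcsine_moment 1]
    by (simp add: low_poly_square lin_smult lin_add arcsine_T arcsine_moment_def one_pCons)
qed

lemma up_poly_norm: "j \<ge> 1 \<Longrightarrow> lin arcsine_moment (up_wt j * (up_poly j * up_poly j)) \<noteq> 0"
  using lin_const[of arcsine_moment 1]
  by (simp add: up_poly_square lin_smult lin_diff arcsine_T arcsine_moment_def one_pCons)

section \<open>Frobenius norm and matrix inverses\<close>

lemma frob_L2: "frob M = L2_set (\<lambda>(i,j). M $$ (i,j)) ({..<dim_row M} \<times> {..<dim_col M})"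
  unfolding frob_def L2_set_def by (simp add: sum.cartesian_product split_def)

lemma frob_nonneg [simp]: "0 \<le> frob M"
  by (simp add: frob_L2)

lemma frob_power2: "(frob M)\<^sup>2 = (\<Sum>i<dim_row M. \<Sum>j<dim_col M. (M $$ (i,j))\<^sup>2)"
  unfolding frob_def by (intro real_sqrt_pow2 sum_nonneg) simp

lemma frob_zero [simp]: "frob (0\<^sub>m r c) = 0"
  by (simp add: frob_def)

lemma frob_entry:
  assumes "i < dim_row M" "j < dim_col M"
  shows "\<bar>M $$ (i,j)\<bar> \<le> frob M"
proof -
  have "L2_set (\<lambda>(i,j). M $$ (i,j)) ({..<dim_row M} \<times> {..<dim_col M})
    = L2_set (\<lambda>(i,j). \<bar>M $$ (i,j)\<bar>) ({..<dim_row M} \<times> {..<dim_col M})"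
    by (simp add: L2_set_def split_def)
  then show ?thesis using assms
    member_le_L2_set[of "{..<dim_row M} \<times> {..<dim_col M}" "(i,j)" "\<lambda>(i,j). \<bar>M $$ (i,j)\<bar>"]
    by (simp add: frob_L2)
qed

lemma frob_le_sum: "frob M \<le> (\<Sum>i<dim_row M. \<Sum>j<dim_col M. \<bar>M $$ (i,j)\<bar>)"
  unfolding frob_L2 by (rule order_trans[OF L2_set_le_sum_abs]) (simp add: sum.cartesian_product split_def)

lemma frob_eq_0: "M \<in> carrier_mat r c \<Longrightarrow> frob M = 0 \<Longrightarrow> M = 0\<^sub>m r c"
  by (rule eq_matI) (use frob_entry[of _ M] in auto)

lemma frob_add:
  assumes "A \<in> carrier_mat r c" "B \<in> carrier_mat r c"
  shows "frob (A + B) \<le> frob A + frob B"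
proof -
  have "frob (A + B) = L2_set (\<lambda>x. (case x of (i,j) \<Rightarrow> A $$ (i,j)) + (case x of (i,j) \<Rightarrow> B $$ (i,j))) ({..<r} \<times> {..<c})"
    using assms unfolding frob_L2 by (intro L2_set_cong) auto
  also have "\<dots> \<le> frob A + frob B"
    using assms L2_set_triangle_ineq by (auto simp: frob_L2)
  finally show ?thesis .
qed

lemma frob_smult: "frob (a \<cdot>\<^sub>m A) = \<bar>a\<bar> * frob A"
proof -
  have "(\<Sum>i<dim_row A. \<Sum>j<dim_col A. ((a \<cdot>\<^sub>m A) $$ (i,j))\<^sup>2) =
    a\<^sup>2 * (\<Sum>i<dim_row A. \<Sum>j<dim_col A. (A $$ (i,j))\<^sup>2)"
    by (simp add: power_mult_distrib sum_distrib_left)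
  then show ?thesis unfolding frob_def by (simp add: real_sqrt_mult)
qed

lemma frob_transpose: "frob (transpose_mat A) = frob A"
  unfolding frob_def by (simp, subst sum.swap, simp)

lemma frob_diff:
  assumes "A \<in> carrier_mat r c" "B \<in> carrier_mat r c"
  shows "frob (A - B) \<le> frob A + frob B"
proof -
  have "A - B = A + (-1) \<cdot>\<^sub>m B" using assms by (intro eq_matI) auto
  then show ?thesis using frob_add[of A r c "(-1) \<cdot>\<^sub>m B"] assms by (simp add: frob_smult)
qed

lemma cauchy_schwarz_sum:
  fixes f g :: "'a \<Rightarrow> real"
  shows "(\<Sum>k\<in>A. f k * g k)\<^sup>2 \<le> (\<Sum>k\<in>A. (f k)\<^sup>2) * (\<Sum>k\<in>A. (g k)\<^sup>2)"
proof -
  have "\<bar>\<Sum>k\<in>A. f k * g k\<bar> \<le> (\<Sum>k\<in>A. \<bar>f k\<bar> * \<bar>g k\<bar>)"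
    by (rule order_trans[OF sum_abs]) (simp add: abs_mult)
  also have "\<dots> \<le> L2_set f A * L2_set g A" by (rule L2_set_mult_ineq)
  finally have "\<bar>\<Sum>k\<in>A. f k * g k\<bar>\<^sup>2 \<le> (L2_set f A * L2_set g A)\<^sup>2"
    by (rule power_mono) simp
  then show ?thesis by (simp add: power_mult_distrib L2_set_def sum_nonneg)
qed

lemma mult_entry:
  assumes "A \<in> carrier_mat r n" "B \<in> carrier_mat n c" "i < r" "j < c"
  shows "(A * B) $$ (i,j) = (\<Sum>k<n. A $$ (i,k) * B $$ (k,j))"
  using assms by (simp add: scalar_prod_def lessThan_atLeast0)

lemma frob_mult:
  assumes "A \<in> carrier_mat r n" "B \<in> carrier_mat n c"
  shows "frob (A * B) \<le> frob A * frob B"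
proof (rule power2_le_imp_le)
  have "(frob (A * B))\<^sup>2 = (\<Sum>i<r. \<Sum>j<c. (\<Sum>k<n. A $$ (i,k) * B $$ (k,j))\<^sup>2)"
    unfolding frob_power2 using assms by (intro sum.cong) (auto simp: mult_entry[OF assms] simp del: index_mult_mat(1))
  also have "\<dots> \<le> (\<Sum>i<r. \<Sum>j<c. (\<Sum>k<n. (A $$ (i,k))\<^sup>2) * (\<Sum>k<n. (B $$ (k,j))\<^sup>2))"
    by (intro sum_mono cauchy_schwarz_sum)
  also have "\<dots> = (\<Sum>i<r. \<Sum>k<n. (A $$ (i,k))\<^sup>2) * (\<Sum>j<c. \<Sum>k<n. (B $$ (k,j))\<^sup>2)"
    by (simp add: sum_product)
  also have "(\<Sum>j<c. \<Sum>k<n. (B $$ (k,j))\<^sup>2) = (\<Sum>k<n. \<Sum>j<c. (B $$ (k,j))\<^sup>2)"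
    by (rule sum.swap)
  also have "(\<Sum>i<r. \<Sum>k<n. (A $$ (i,k))\<^sup>2) * (\<Sum>k<n. \<Sum>j<c. (B $$ (k,j))\<^sup>2) = (frob A * frob B)\<^sup>2"
    unfolding power_mult_distrib frob_power2 using assms by simp
  finally show "(frob (A * B))\<^sup>2 \<le> (frob A * frob B)\<^sup>2" .
qed simp

section \<open>Matrix inverses under perturbation\<close>

definition is_inv :: "nat \<Rightarrow> real mat \<Rightarrow> real mat \<Rightarrow> bool" where
  "is_inv n X B \<longleftrightarrow> B \<in> carrier_mat n n \<and> X * B = 1\<^sub>m n \<and> B * X = 1\<^sub>m n"

lemma is_inv_unique:
  assumes "X \<in> carrier_mat n n" "is_inv n X B" "is_inv n X C"
  shows "B = C"
proof -
  have "(B * X) * C = B * (X * C)"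
    using assms by (intro assoc_mult_mat[of _ n n _ n _ n]) (auto simp: is_inv_def)
  then show ?thesis
    using assms left_mult_one_mat[of C n n] right_mult_one_mat[of B n n] by (simp add: is_inv_def)
qed

lemma minv_eq: "X \<in> carrier_mat n n \<Longrightarrow> is_inv n X B \<Longrightarrow> minv n X = B"
  unfolding minv_def is_inv_def[symmetric] by (metis is_inv_unique someI)

lemma is_inv_transpose:
  assumes "X \<in> carrier_mat n n" "is_inv n X B"
  shows "is_inv n (transpose_mat X) (transpose_mat B)"
  using assms unfolding is_inv_def by (metis transpose_carrier_mat transpose_mult transpose_one)

lemma is_inv_sym:
  assumes "X \<in> carrier_mat n n" "transpose_mat X = X" "is_inv n X B"
  shows "transpose_mat B = B"
  using is_inv_transpose[OF assms(1,3)] is_inv_unique[OF assms(1)] assms by metis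

lemma inv_existsI:
  assumes "X \<in> carrier_mat n n" "\<And>v. v \<in> carrier_vec n \<Longrightarrow> X *\<^sub>v v = 0\<^sub>v n \<Longrightarrow> v = 0\<^sub>v n"
  shows "\<exists>B. is_inv n X B"
proof -
  have "det X \<noteq> 0" using det_0_iff_vec_prod_zero[OF assms(1)] assms(2) by blast
  then show ?thesis using det_non_zero_imp_unit[OF assms(1)] unfolding is_inv_def Units_def ring_mat_def by auto
qed

text \<open>If G is nearly a left inverse of X, then V = (1 - G X) V + G X V bounds V by twice G X
  V. With X V = 0 this makes X injective; with V the inverse it bounds the inverse by 2
  \<open>frob G\<close>, uniformly in X.\<close>

lemma inv_perturb:
  assumes X: "X \<in> carrier_mat n n" and G: "G \<in> carrier_mat n n" and d: "frob (1\<^sub>m n - G * X) \<le> 1/2"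
  shows "\<exists>B. is_inv n X B \<and> frob B \<le> 2 * frob G"
proof -
  have fix_bound: "frob V \<le> 2 * frob W"
    if V: "V \<in> carrier_mat n c" and W: "W \<in> carrier_mat n c" and e: "G * X * V = W" for V W c
  proof -
    have "V = (1\<^sub>m n - G * X) * V + W"
      using X G V W unfolding e[symmetric]
      by (subst minus_mult_distrib_mat[of _ n n]) auto
    then have "frob V \<le> frob ((1\<^sub>m n - G * X) * V) + frob W"
      by (metis G V W X frob_add minus_carrier_mat mult_carrier_mat)
    also have "frob ((1\<^sub>m n - G * X) * V) \<le> frob (1\<^sub>m n - G * X) * frob V"
      by (rule frob_mult[of _ n n]) (use X G V in auto)
    also have "\<dots> \<le> 1/2 * frob V" using d by (intro mult_right_mono) auto
    finally show ?thesis by simp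
  qed
  have "\<exists>B. is_inv n X B"
  proof (rule inv_existsI[OF X])
    fix v assume v: "v \<in> carrier_vec n" "X *\<^sub>v v = 0\<^sub>v n"
    define V where "V = mat_of_cols n [v]"
    have V: "V \<in> carrier_mat n 1" "\<And>i. i < n \<Longrightarrow> V $$ (i,0) = v $ i"
      by (auto simp: V_def mat_of_cols_def)
    have "X * V = 0\<^sub>m n 1"
    proof (rule eq_matI)
      fix i j assume ij: "i < dim_row (0\<^sub>m n 1 :: real mat)" "j < dim_col (0\<^sub>m n 1 :: real mat)"
      then have "(X * V) $$ (i,j) = (X *\<^sub>v v) $ i"
        using X V v(1) by (auto simp: scalar_prod_def)
      then show "(X * V) $$ (i,j) = 0\<^sub>m n 1 $$ (i,j)" using v ij by simp
    qed (use X V in auto)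
    then have "G * X * V = 0\<^sub>m n 1" using X G V by (simp add: assoc_mult_mat[of G n n X n V 1])
    from fix_bound[OF V(1) _ this] have "V = 0\<^sub>m n 1"
      by (intro frob_eq_0[OF V(1)]) (simp add: order_antisym)
    then show "v = 0\<^sub>v n" using V(2) v(1) by (intro eq_vecI) auto
  qed
  then obtain B where B: "is_inv n X B" by blast
  then have "G * X * B = G"
    using X G by (simp add: is_inv_def assoc_mult_mat[of G n n X n B n])
  then show ?thesis using fix_bound[of B n G] B G by (auto simp: is_inv_def)
qed

text \<open>Cauchy-Schwarz over the n^2 index pairs: the squares of the products v_i v_j sum to (v .
  v)^2.\<close>

lemma quad_bound:
  assumes Y: "Y \<in> carrier_mat n n" and v: "v \<in> carrier_vec n"
  shows "\<bar>v \<bullet> (Y *\<^sub>v v)\<bar> \<le> frob Y * (v \<bullet> v)"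
proof -
  have "v \<bullet> (Y *\<^sub>v v) = (\<Sum>i<n. \<Sum>j<n. Y $$ (i,j) * (v $ i * v $ j))"
    using assms by (simp add: scalar_prod_def lessThan_atLeast0 sum_distrib_left mult_ac)
  also have "\<dots> = (\<Sum>x\<in>{..<n}\<times>{..<n}. Y $$ x * (v $ fst x * v $ snd x))"
    by (simp add: sum.cartesian_product split_def)
  finally have "(v \<bullet> (Y *\<^sub>v v))\<^sup>2 \<le> (\<Sum>x\<in>{..<n}\<times>{..<n}. (Y $$ x)\<^sup>2) * (\<Sum>x\<in>{..<n}\<times>{..<n}. (v $ fst x * v $ snd x)\<^sup>2)"
    using cauchy_schwarz_sum[of "\<lambda>x. Y $$ x" "\<lambda>x. v $ fst x * v $ snd x" "{..<n}\<times>{..<n}"] by simp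
  also have "(\<Sum>x\<in>{..<n}\<times>{..<n}. (Y $$ x)\<^sup>2) = (frob Y)\<^sup>2"
    using Y by (simp add: frob_power2 sum.cartesian_product)
  also have "(\<Sum>x\<in>{..<n}\<times>{..<n}. (v $ fst x * v $ snd x)\<^sup>2) = (v \<bullet> v)\<^sup>2"
    using v by (simp add: scalar_prod_def lessThan_atLeast0 power2_eq_square sum_product sum.cartesian_product mult_ac split_def)
  finally have "\<bar>v \<bullet> (Y *\<^sub>v v)\<bar>\<^sup>2 \<le> (frob Y * (v \<bullet> v))\<^sup>2" by (simp add: power_mult_distrib)
  moreover have "0 \<le> v \<bullet> v" by (simp add: scalar_prod_def sum_nonneg)
  ultimately show ?thesis by (simp add: power2_le_iff_abs_le abs_mult)
qed

lemma scalar_prod_self_pos: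
  fixes v :: "real vec"
  assumes "v \<in> carrier_vec n" "v \<noteq> 0\<^sub>v n"
  shows "0 < v \<bullet> v"
proof -
  obtain i where i: "i < n" "v $ i \<noteq> 0" using assms by (metis carrier_vecD eq_vecI index_zero_vec)
  have "0 < (\<Sum>i<n. v $ i * v $ i)"
    by (rule sum_pos2[of _ i]) (use i in \<open>auto simp: zero_less_mult_iff\<close>)
  then show ?thesis using assms by (simp add: scalar_prod_def lessThan_atLeast0)
qed

lemma smult_mat_vec:
  fixes A :: "real mat"
  assumes "A \<in> carrier_mat r n" "v \<in> carrier_vec n"
  shows "(c \<cdot>\<^sub>m A) *\<^sub>v v = c \<cdot>\<^sub>v (A *\<^sub>v v)"
  using assms by (intro eq_vecI) (auto simp: scalar_prod_def sum_distrib_left mult.assoc)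

lemma posdef_perturb:
  assumes Y: "sym_mat p Y" and f: "frob Y < 1" and c: "c > 0"
  shows "posdef p (c \<cdot>\<^sub>m (1\<^sub>m p + Y))"
  unfolding posdef_def
proof (intro conjI ballI impI)
  have Yc: "Y \<in> carrier_mat p p" using Y by (simp add: sym_mat_def)
  have ye: "Y $$ (j,i) = Y $$ (i,j)" if "i < p" "j < p" for i j
    using Y that unfolding sym_mat_def by (metis carrier_matD index_transpose_mat(1))
  show "sym_mat p (c \<cdot>\<^sub>m (1\<^sub>m p + Y))"
    unfolding sym_mat_def using Yc by (auto intro!: eq_matI simp: ye)
  fix v :: "real vec" assume v: "v \<in> carrier_vec p" "v \<noteq> 0\<^sub>v p"
  have "(c \<cdot>\<^sub>m (1\<^sub>m p + Y)) *\<^sub>v v = c \<cdot>\<^sub>v (v + Y *\<^sub>v v)"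
    using Yc v by (simp add: smult_mat_vec[of _ p p] add_mult_distrib_mat_vec[of _ p p])
  then have "v \<bullet> ((c \<cdot>\<^sub>m (1\<^sub>m p + Y)) *\<^sub>v v) = c * (v \<bullet> v + v \<bullet> (Y *\<^sub>v v))"
    using Yc v by (simp add: scalar_prod_add_distrib[of _ p])
  moreover have "v \<bullet> v + v \<bullet> (Y *\<^sub>v v) > 0"
  proof -
    have "frob Y * (v \<bullet> v) < 1 * (v \<bullet> v)" using f scalar_prod_self_pos[OF v] by (intro mult_strict_right_mono)
    then show ?thesis using quad_bound[OF Yc v(1)] by linarith
  qed
  ultimately show "v \<bullet> ((c \<cdot>\<^sub>m (1\<^sub>m p + Y)) *\<^sub>v v) > 0" using c by simp
qed

section \<open>Positive definite square roots\<close>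

definition mtrace :: "real mat \<Rightarrow> real" where
  "mtrace A = (\<Sum>i<dim_row A. A $$ (i,i))"

lemma mtrace_comm:
  assumes "A \<in> carrier_mat n m" "B \<in> carrier_mat m n"
  shows "mtrace (A * B) = mtrace (B * A)"
proof -
  have "mtrace (A * B) = (\<Sum>i<n. \<Sum>k<m. A $$ (i,k) * B $$ (k,i))"
    using assms by (simp add: mtrace_def mult_entry[OF assms] del: index_mult_mat(1))
  also have "\<dots> = (\<Sum>k<m. \<Sum>i<n. B $$ (k,i) * A $$ (i,k))"
    by (subst sum.swap) (simp add: mult.commute)
  also have "\<dots> = mtrace (B * A)"
    using assms by (simp add: mtrace_def mult_entry[OF assms(2,1)] del: index_mult_mat(1))
  finally show ?thesis .
qed

lemma mtrace_diff: "A \<in> carrier_mat n n \<Longrightarrow> B \<in> carrier_mat n n \<Longrightarrow> mtrace (A - B) = mtrace A - mtrace B"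
  by (simp add: mtrace_def sum_subtractf)

lemma congr_entry_diag:
  assumes B: "B \<in> carrier_mat n n" and X: "X \<in> carrier_mat n m" and i: "i < m"
  shows "(transpose_mat X * (B * X)) $$ (i,i) = col X i \<bullet> (B *\<^sub>v col X i)"
proof -
  have "col (B * X) i = B *\<^sub>v col X i" by (rule col_mult2[OF assms])
  then show ?thesis using assms by simp
qed

text \<open>The trace of X^T B X is the sum of the quadratic form of B over the columns of X, so
  each of these nonnegative terms has to vanish.\<close>

lemma posdef_trace_zero:
  assumes B: "posdef p B" and X: "X \<in> carrier_mat p p" and t: "mtrace (transpose_mat X * (B * X)) \<le> 0"
  shows "X = 0\<^sub>m p p"
proof -
  have Bc: "B \<in> carrier_mat p p" using B by (simp add: posdef_def sym_mat_def)
  have nn: "0 \<le> col X i \<bullet> (B *\<^sub>v col X i)" if "i < p" for i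
  proof (cases "col X i = 0\<^sub>v p")
    case True
    have "B *\<^sub>v col X i \<in> carrier_vec p" using Bc X that by auto
    then show ?thesis using True by simp
  next
    case False
    then show ?thesis using B X that unfolding posdef_def by (auto intro!: less_imp_le)
  qed
  have "mtrace (transpose_mat X * (B * X)) = (\<Sum>i<p. col X i \<bullet> (B *\<^sub>v col X i))"
    unfolding mtrace_def using Bc X by (simp add: congr_entry_diag[OF Bc X] del: index_mult_mat(1))
  then have "(\<Sum>i<p. col X i \<bullet> (B *\<^sub>v col X i)) = 0"
    using t nn by (intro antisym sum_nonneg) auto
  then have z: "col X i \<bullet> (B *\<^sub>v col X i) = 0" if "i < p" for i
    using nn that by (subst (asm) sum_nonneg_eq_0_iff) auto
  have "col X i = 0\<^sub>v p" if "i < p" for i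
    using z[OF that] B X that unfolding posdef_def by (metis carrier_matD(1) col_dim less_irrefl)
  then show ?thesis using X
    by (intro eq_matI) (auto, metis carrier_matD index_col index_zero_vec(1))
qed

text \<open>With X = B - C, the identity B B = C C gives tr (X B X) + tr (X C X) = 0.\<close>

lemma posdef_sqrt_unique:
  assumes B: "posdef p B" and C: "posdef p C" and eq: "B * B = C * C"
  shows "B = C"
proof -
  have [simp]: "B \<in> carrier_mat p p" "C \<in> carrier_mat p p" "transpose_mat B = B" "transpose_mat C = C"
    using B C by (auto simp: posdef_def sym_mat_def)
  note [simp] = mult_carrier_mat[of _ p p _ p] minus_carrier_mat[of _ p p]
  define X where "X = B - C"
  have X [simp]: "X \<in> carrier_mat p p" "transpose_mat X = X"
    by (simp_all add: X_def transpose_minus[of _ p p] minus_carrier_mat[of _ p p])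
  have BX: "mtrace (X * (B * X)) = mtrace (X * (B * B)) - mtrace (X * (B * C))"
    unfolding X_def[symmetric]
    by (subst (2) X_def) (simp add: mult_minus_distrib_mat[of _ p p _ p] mtrace_diff[of _ p])
  have CX: "mtrace (X * (C * X)) = mtrace (X * (C * B)) - mtrace (X * (C * C))"
    by (subst (2) X_def) (simp add: mult_minus_distrib_mat[of _ p p _ p] mtrace_diff[of _ p])
  \<comment> \<open>Cyclicity and \<open>eq\<close> turn both mixed traces into tr C^3 - tr B^3, so
    they cancel in the sum \<open>s\<close>.\<close>
  have "mtrace (X * (B * C)) = mtrace (B * (B * C)) - mtrace (C * (B * C))"
    by (simp add: X_def minus_mult_distrib_mat[of _ p p _ _ p] mtrace_diff[of _ p])
  also have "mtrace (B * (B * C)) = mtrace (C * C * C)"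
    by (simp add: eq flip: assoc_mult_mat[of B p p B p C p])
  also have "mtrace (C * (B * C)) = mtrace (B * C * C)"
    by (rule mtrace_comm[of _ p p]) auto
  also have "mtrace (B * C * C) = mtrace (B * (B * B))"
    by (simp add: eq assoc_mult_mat[of B p p C p C p])
  finally have 1: "mtrace (X * (B * C)) = mtrace (C * (C * C)) - mtrace (B * (B * B))"
    by (simp add: assoc_mult_mat[of _ p p _ p _ p])
  have "mtrace (X * (C * B)) = mtrace (B * (C * B)) - mtrace (C * (C * B))"
    by (simp add: X_def minus_mult_distrib_mat[of _ p p _ _ p] mtrace_diff[of _ p])
  also have "mtrace (C * (C * B)) = mtrace (B * B * B)"
    by (simp add: eq[symmetric] flip: assoc_mult_mat[of C p p C p B p])
  also have "mtrace (B * (C * B)) = mtrace (C * B * B)"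
    by (rule mtrace_comm[of _ p p]) auto
  also have "mtrace (C * B * B) = mtrace (C * (C * C))"
    by (simp add: eq[symmetric] assoc_mult_mat[of C p p B p B p])
  finally have 2: "mtrace (X * (C * B)) = mtrace (C * (C * C)) - mtrace (B * (B * B))"
    by (simp add: assoc_mult_mat[of _ p p _ p _ p])
  have 3: "mtrace (X * (B * B)) = mtrace (X * (C * C))" by (simp add: eq)
  have s: "mtrace (X * (B * X)) + mtrace (X * (C * X)) = 0"
    using BX CX 1 2 3 by simp
  have "mtrace (X * (B * X)) \<le> 0 \<or> mtrace (X * (C * X)) \<le> 0" using s by linarith
  then have "X = 0\<^sub>m p p"
    using posdef_trace_zero[OF B X(1)] posdef_trace_zero[OF C X(1)] by auto
  then have "X $$ (i,j) = 0" if "i < p" "j < p" for i j using that by simp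
  then show ?thesis by (intro eq_matI) (auto simp: X_def carrier_matD[of _ p p])
qed

lemma msqrt_eq: "posdef p R \<Longrightarrow> R * R = D \<Longrightarrow> msqrt p D = R"
  unfolding msqrt_def by (rule the_equality) (auto intro: posdef_sqrt_unique)

lemma posdef_inv:
  assumes "posdef p R"
  shows "\<exists>B. is_inv p R B"
proof (rule inv_existsI)
  show "R \<in> carrier_mat p p" using assms by (simp add: posdef_def sym_mat_def)
  fix v assume "v \<in> carrier_vec p" "R *\<^sub>v v = 0\<^sub>v p"
  then show "v = 0\<^sub>v p" using assms unfolding posdef_def
    by (metis less_irrefl scalar_prod_right_zero)
qed

lemma posdef_congr:
  assumes U: "posdef p U" and R: "posdef p R"
  shows "posdef p (R * U * R)"
  unfolding posdef_def
proof (intro conjI ballI impI)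
  have [simp]: "U \<in> carrier_mat p p" "R \<in> carrier_mat p p" "transpose_mat U = U" "transpose_mat R = R"
    using U R by (auto simp: posdef_def sym_mat_def)
  show "sym_mat p (R * U * R)"
    by (simp add: sym_mat_def transpose_mult[of _ p p _ p] assoc_mult_mat[of _ p p _ p _ p] mult_carrier_mat[of _ p p])
  fix v :: "real vec" assume v: "v \<in> carrier_vec p" "v \<noteq> 0\<^sub>v p"
  obtain B where B: "is_inv p R B" using posdef_inv[OF R] by blast
  have "R *\<^sub>v v \<noteq> 0\<^sub>v p"
  proof
    assume "R *\<^sub>v v = 0\<^sub>v p"
    then have "B *\<^sub>v (R *\<^sub>v v) = 0\<^sub>v p" using B by (auto simp: is_inv_def)
    then have "(B * R) *\<^sub>v v = 0\<^sub>v p" using B v by (subst assoc_mult_mat_vec[of _ p p _ p]) (auto simp: is_inv_def)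
    then show False using B v by (simp add: is_inv_def)
  qed
  then have "0 < (R *\<^sub>v v) \<bullet> (U *\<^sub>v (R *\<^sub>v v))"
    using U v by (simp add: posdef_def mult_mat_vec_carrier[of R p p])
  also have "(R *\<^sub>v v) \<bullet> (U *\<^sub>v (R *\<^sub>v v)) = v \<bullet> (R *\<^sub>v (U *\<^sub>v (R *\<^sub>v v)))"
    using transpose_vec_mult_scalar[of R p p v "U *\<^sub>v (R *\<^sub>v v)"] v
    by (simp add: mult_mat_vec_carrier[of _ p p] comm_scalar_prod[of _ p])
  also have "R *\<^sub>v (U *\<^sub>v (R *\<^sub>v v)) = (R * U * R) *\<^sub>v v"
    using v by (simp add: assoc_mult_mat_vec[of _ p p _ p] mult_mat_vec_carrier[of _ p p] mult_carrier_mat[of _ p p _ p])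
  finally show "0 < v \<bullet> ((R * U * R) *\<^sub>v v)" .
qed

lemma transpose_smult_mat: "transpose_mat (c \<cdot>\<^sub>m A) = c \<cdot>\<^sub>m transpose_mat A"
  by (intro eq_matI) auto

text \<open>A square root of 1 + E is 1 + Y with Y the fixed point of the contraction Y = (E - Y Y) / 2.\<close>

lemma sqrt_perturb:
  assumes E: "sym_mat p E" and r: "frob E \<le> 1/4"
  shows "\<exists>Y. sym_mat p Y \<and> frob Y \<le> frob E \<and> (1\<^sub>m p + Y) * (1\<^sub>m p + Y) = 1\<^sub>m p + E"
proof -
  have Ec: "E \<in> carrier_mat p p" and Et: "transpose_mat E = E" using E by (auto simp: sym_mat_def)
  define g where "g Y = (1/2) \<cdot>\<^sub>m (E - Y * Y)" for Y :: "real mat"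
  define y where "y n = (g ^^ n) (0\<^sub>m p p)" for n
  have y0: "y 0 = 0\<^sub>m p p" and yS: "y (Suc n) = g (y n)" for n by (auto simp: y_def)
  \<comment> \<open>The bound 1/4 on \<open>frob E\<close> keeps the iterates symmetric in the ball
    of radius \<open>frob E\<close>, on which g contracts.\<close>
  have inv: "y n \<in> carrier_mat p p \<and> transpose_mat (y n) = y n \<and> frob (y n) \<le> frob E" for n
  proof (induction n)
    case (Suc n)
    then have c: "y n \<in> carrier_mat p p" and t: "transpose_mat (y n) = y n" and f: "frob (y n) \<le> frob E" by auto
    have "frob (y (Suc n)) \<le> 1/2 * (frob E + frob (y n * y n))"
      unfolding yS g_def frob_smult using frob_diff[OF Ec mult_carrier_mat[OF c c]] by simp
    also have "frob (y n * y n) \<le> frob (y n) * frob (y n)" by (rule frob_mult[OF c c])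
    also have "\<dots> \<le> frob E * 1" using f r by (intro mult_mono) auto
    finally have "frob (y (Suc n)) \<le> frob E" by simp
    moreover have "transpose_mat (y (Suc n)) = y (Suc n)"
      unfolding yS g_def using c t Ec Et
      by (simp add: transpose_smult_mat transpose_minus[of _ p p] transpose_mult[of _ p p _ p])
    ultimately show ?case using c Ec by (simp add: yS g_def minus_carrier_mat[of _ p p] mult_carrier_mat[of _ p p _ p])
  qed (simp add: y0)
  then have c: "y n \<in> carrier_mat p p" and t: "transpose_mat (y n) = y n" and f: "frob (y n) \<le> frob E" for n by auto
  \<comment> \<open>The contraction factor obtained is 1/2 * (1/4 + 1/4) = 1/4. The weaker ratio 1/2
    already makes the increments summable, so that each entry converges by telescoping.\<close>
  have step: "frob (y (Suc n) - y n) \<le> frob E * (1/2) ^ n" for n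
  proof (induction n)
    case 0
    then show ?case using frob_diff[OF c[of 1] c[of 0]] f[of 1] by (simp add: y0)
  next
    case (Suc n)
    define a b where "a = y (Suc n)" and "b = y n"
    have ab: "a \<in> carrier_mat p p" "b \<in> carrier_mat p p" by (auto simp: a_def b_def c)
    \<comment> \<open>a a - b b = a (a - b) + (a - b) b is the factorisation that survives without
      commutativity.\<close>
    have "y (Suc (Suc n)) - y (Suc n) = (-1/2) \<cdot>\<^sub>m (a * (a - b) + (a - b) * b)"
    proof -
      have "a * (a - b) + (a - b) * b = a * a - b * b"
        using ab by (subst mult_minus_distrib_mat[of _ p p _ p], simp_all, subst minus_mult_distrib_mat[of _ p p _ _ p], simp_all)
          (intro eq_matI, auto)
      moreover have "y (Suc (Suc n)) = (1/2) \<cdot>\<^sub>m (E - a * a)" "y (Suc n) = (1/2) \<cdot>\<^sub>m (E - b * b)"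
        by (simp_all add: yS g_def a_def b_def)
      then have "y (Suc (Suc n)) - y (Suc n) = (-1/2) \<cdot>\<^sub>m (a * a - b * b)"
        using ab Ec by (simp only:) (intro eq_matI, auto simp: field_simps)
      ultimately show ?thesis by simp
    qed
    then have "frob (y (Suc (Suc n)) - y (Suc n)) = 1/2 * frob (a * (a - b) + (a - b) * b)"
      by (simp add: frob_smult)
    also have "frob (a * (a - b) + (a - b) * b) \<le> frob (a * (a - b)) + frob ((a - b) * b)"
      by (rule frob_add[of _ p p]) (use ab in auto)
    also have "frob (a * (a - b)) \<le> frob a * frob (a - b)" by (rule frob_mult[of _ p p]) (use ab in auto)
    also have "\<dots> \<le> 1/4 * frob (a - b)" using f[of "Suc n"] r by (intro mult_right_mono) (auto simp: a_def)
    also have "frob ((a - b) * b) \<le> frob (a - b) * frob b" by (rule frob_mult[of _ p p]) (use ab in auto)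
    also have "\<dots> \<le> frob (a - b) * (1/4)" using f[of n] r by (intro mult_left_mono) (auto simp: b_def)
    finally have "frob (y (Suc (Suc n)) - y (Suc n)) \<le> 1/4 * frob (y (Suc n) - y n)"
      by (simp add: a_def b_def)
    then show ?case using Suc.IH frob_nonneg[of "y (Suc (Suc n)) - y (Suc n)"] unfolding power_Suc by linarith
  qed
  have "convergent (\<lambda>n. y n $$ (i,j))" if ij: "i < p" "j < p" for i j
  proof -
    have b: "\<bar>y (Suc n) $$ (i,j) - y n $$ (i,j)\<bar> \<le> frob E * (1/2) ^ n" for n
    proof -
      have "\<bar>(y (Suc n) - y n) $$ (i,j)\<bar> \<le> frob (y (Suc n) - y n)"
        by (rule frob_entry) (use ij carrier_matD[OF c[of n]] in simp_all)
      then show ?thesis using step[of n] ij carrier_matD[OF c[of n]] by simp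
    qed
    have g: "summable (\<lambda>n. frob E * (1/2) ^ n)"
      by (intro summable_mult summable_geometric) simp
    have "summable (\<lambda>n. y (Suc n) $$ (i,j) - y n $$ (i,j))"
      by (rule summable_comparison_test'[OF g, of 0]) (simp only: real_norm_def b)
    then have "convergent (\<lambda>n. \<Sum>k<n. y (Suc k) $$ (i,j) - y k $$ (i,j))"
      by (simp add: summable_iff_convergent)
    then have "convergent (\<lambda>n. y n $$ (i,j) - y 0 $$ (i,j))"
      by (simp only: sum_lessThan_telescope[of "\<lambda>n. y n $$ (i,j)"])
    then show ?thesis using ij by (simp add: y0)
  qed
  define Y where "Y = mat p p (\<lambda>(i,j). lim (\<lambda>n. y n $$ (i,j)))"
  have lim: "(\<lambda>n. y n $$ (i,j)) \<longlonglongrightarrow> Y $$ (i,j)" if "i < p" "j < p" for i j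
    using \<open>\<And>i j. i < p \<Longrightarrow> j < p \<Longrightarrow> convergent _\<close>[OF that] that by (simp add: Y_def convergent_LIMSEQ_iff)
  have Yc: "Y \<in> carrier_mat p p" by (simp add: Y_def)
  have "Y $$ (i,j) = Y $$ (j,i)" if "i < p" "j < p" for i j
  proof -
    have "y n $$ (i,j) = y n $$ (j,i)" for n
      using t[of n] c[of n] that by (metis carrier_matD index_transpose_mat(1))
    then show ?thesis using that by (simp add: Y_def)
  qed
  then have Ys: "sym_mat p Y" unfolding sym_mat_def using Yc by (auto intro!: eq_matI)
  have "(\<lambda>n. frob (y n)) \<longlonglongrightarrow> frob Y"
    unfolding frob_def using c Yc lim
    by (simp add: carrier_matD[OF c] carrier_matD[OF Yc]) (intro tendsto_intros, auto)
  then have fY: "frob Y \<le> frob E" by (rule LIMSEQ_le_const2) (use f in auto)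
  have fixpt: "2 * Y $$ (i,j) + (Y * Y) $$ (i,j) = E $$ (i,j)" if ij: "i < p" "j < p" for i j
  proof -
    have "(\<lambda>n. (y n * y n) $$ (i,j)) \<longlonglongrightarrow> (Y * Y) $$ (i,j)"
      unfolding mult_entry[OF c c ij] mult_entry[OF Yc Yc ij] using lim ij by (intro tendsto_intros) auto
    then have "(\<lambda>n. 2 * y (Suc n) $$ (i,j) + (y n * y n) $$ (i,j)) \<longlonglongrightarrow> 2 * Y $$ (i,j) + (Y * Y) $$ (i,j)"
      using lim[OF ij] by (intro tendsto_intros LIMSEQ_Suc)
    moreover have "2 * y (Suc n) $$ (i,j) + (y n * y n) $$ (i,j) = E $$ (i,j)" for n
      using ij Ec c[of n] by (simp add: yS g_def field_simps del: index_mult_mat(1))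
    ultimately show ?thesis by (simp add: LIMSEQ_const_iff)
  qed
  have "(1\<^sub>m p + Y) * (1\<^sub>m p + Y) = 1\<^sub>m p + (Y + (Y + Y * Y))"
    using Yc by (simp add: add_mult_distrib_mat[of _ p p _ _ p] mult_add_distrib_mat[of _ p p _ p] assoc_add_mat[of _ p p])
  also have "\<dots> = 1\<^sub>m p + E"
  proof (rule eq_matI)
    fix i j assume "i < dim_row (1\<^sub>m p + E)" "j < dim_col (1\<^sub>m p + E)"
    then have ij: "i < p" "j < p" using Ec by auto
    then show "(1\<^sub>m p + (Y + (Y + Y * Y))) $$ (i,j) = (1\<^sub>m p + E) $$ (i,j)"
      using fixpt[OF ij] Ec Yc by (simp del: index_mult_mat(1))
  qed (use Yc Ec in auto)
  finally show ?thesis using Ys fY by blast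
qed

section \<open>Schur complements of block Hankel matrices\<close>

lemma blockmat_carrier [simp]: "blockmat p r c F \<in> carrier_mat (r * p) (c * p)"
  by (simp add: blockmat_def)

lemma blockmat_dims [simp]: "dim_row (blockmat p r c F) = r * p" "dim_col (blockmat p r c F) = c * p"
  by (simp_all add: blockmat_def)

lemma block_index_less: "(i::nat) < m \<Longrightarrow> a < p \<Longrightarrow> i * p + a < m * p"
  using mult_le_mono1[of "Suc i" m p] by simp

lemma blockmat_entry:
  assumes "i < r" "j < c" "a < p" "b < p"
  shows "blockmat p r c F $$ (i * p + a, j * p + b) = F i j $$ (a, b)"
  using assms by (simp add: blockmat_def block_index_less)

lemma blockmat_col_entry:
  assumes "i < r" "a < p" "b < p"
  shows "blockmat p r 1 F $$ (i * p + a, b) = F i 0 $$ (a, b)"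
  using blockmat_entry[of i r 0 1 a p b F] assms by simp

lemma sum_blocks:
  fixes f :: "nat \<Rightarrow> 'a :: comm_monoid_add"
  shows "(\<Sum>k<m*p. f k) = (\<Sum>i<m. \<Sum>a<p. f (i * p + a))"
proof -
  have "(\<Sum>k<m*p. f k) = (\<Sum>i<m. sum f {i * p..<i * p + p})"
    by (rule sum.nat_group[symmetric])
  also have "\<dots> = (\<Sum>i<m. \<Sum>a<p. f (i * p + a))"
  proof (rule sum.cong)
    fix i
    show "sum f {i * p..<i * p + p} = (\<Sum>a<p. f (i * p + a))"
      using sum.shift_bounds_nat_ivl[of f 0 "i * p" p] by (simp add: lessThan_atLeast0 add.commute)
  qed simp
  finally show ?thesis .
qed

lemma block_index_cases:
  fixes k m p :: nat
  assumes "k < m * p"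
  obtains i a where "i < m" "a < p" "k = i * p + a"
proof
  have "p > 0" using assms by (cases p) auto
  then show "k div p < m" "k mod p < p" "k = k div p * p + k mod p"
    using assms by (auto simp: less_mult_imp_div_less)
qed

text \<open>Both bounds are built from this one shape, applied to shifted moments for S_j^- and to
  shifted differences of moments for S_j^+.\<close>

definition hankel :: "nat \<Rightarrow> nat \<Rightarrow> (nat \<Rightarrow> real mat) \<Rightarrow> real mat" where
  "hankel p m S = blockmat p m m (\<lambda>i j. S (i + j))"

definition hankel_col :: "nat \<Rightarrow> nat \<Rightarrow> (nat \<Rightarrow> real mat) \<Rightarrow> real mat" where
  "hankel_col p m S = blockmat p m 1 (\<lambda>i _. S (m + i))"

definition schur :: "nat \<Rightarrow> nat \<Rightarrow> (nat \<Rightarrow> real mat) \<Rightarrow> real mat" where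
  "schur p m S = transpose_mat (hankel_col p m S) * minv (m * p) (hankel p m S) * hankel_col p m S"

text \<open>The defect of P in the normal equations: it vanishes when P is orthogonal to all lower
  powers at every matrix position.\<close>

definition residual :: "nat \<Rightarrow> nat \<Rightarrow> (nat \<Rightarrow> real mat) \<Rightarrow> real poly \<Rightarrow> real mat" where
  "residual p m S P = blockmat p m 1 (\<lambda>i _. mat p p (\<lambda>(a, b). lin (\<lambda>l. S l $$ (a, b)) (P * monom 1 i)))"

lemma lin_mult_monom: "lin s (P * monom 1 i) = (\<Sum>k\<le>degree P. coeff P k * s (k + i))"
proof -
  have "lin s (P * monom 1 i) = lin (\<lambda>k. lin s (monom 1 i * monom 1 k)) P"
    using lin_seq_mult[of s "monom 1 i" P] by (simp add: mult.commute)
  then show ?thesis by (simp add: lin_def[of _ P] mult_monom lin_monom add.commute)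
qed

lemma lin_mult: "lin s (P * Q) = (\<Sum>i\<le>degree Q. coeff Q i * lin s (P * monom 1 i))"
  using lin_seq_mult[of s P Q] by (simp add: lin_def[of _ Q])

lemma monic_split_sum:
  assumes "degree P = m" "lead_coeff P = (1::real)"
  shows "(\<Sum>k\<le>degree P. coeff P k * f k) = f m + (\<Sum>k<m. coeff P k * f k)"
proof -
  have "{..degree P} = insert m {..<m}" using assms(1) by auto
  then show ?thesis using assms by simp
qed

lemma hankel_sym:
  assumes "\<And>i. i < 2 * m \<Longrightarrow> sym_mat p (S i)"
  shows "transpose_mat (hankel p m S) = hankel p m S"
proof (rule eq_matI)
  fix x y assume "x < dim_row (hankel p m S)" "y < dim_col (hankel p m S)"
  then have xy: "x < m * p" "y < m * p" by (auto simp: hankel_def)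
  obtain i a where i: "i < m" "a < p" "x = i * p + a" using block_index_cases[OF xy(1)] .
  obtain j b where j: "j < m" "b < p" "y = j * p + b" using block_index_cases[OF xy(2)] .
  have s: "sym_mat p (S (i + j))" using assms[of "i + j"] i j by simp
  have "transpose_mat (hankel p m S) $$ (x,y) = hankel p m S $$ (y,x)"
    using xy by (simp add: hankel_def)
  also have "\<dots> = S (j + i) $$ (b, a)"
    unfolding i(3) j(3) hankel_def by (rule blockmat_entry) (fact i j)+
  also have "\<dots> = S (i + j) $$ (b, a)" by (simp only: add.commute[of j i])
  also have "\<dots> = S (i + j) $$ (a, b)"
    using s i j unfolding sym_mat_def by (metis carrier_matD index_transpose_mat(1))
  also have "\<dots> = hankel p m S $$ (x,y)"
    unfolding i(3) j(3) hankel_def by (rule blockmat_entry[symmetric]) (fact i j)+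
  finally show "transpose_mat (hankel p m S) $$ (x,y) = hankel p m S $$ (x,y)" .
qed (auto simp: hankel_def)

text \<open>Substitute h = e + H Q: each factor H cancels the inverse W next to it, so W survives
  only between two copies of e. With e the residual, the part that contains the inverse is quadratic
  in it.\<close>

lemma congr_shift:
  assumes H: "H \<in> carrier_mat N N" "transpose_mat H = H" and W: "is_inv N H W"
    and e: "e \<in> carrier_mat N p" and Q: "Q \<in> carrier_mat N p" and h: "h = e + H * Q"
  shows "transpose_mat h * W * h =
    transpose_mat e * W * e + (transpose_mat e * Q + (transpose_mat Q * e + transpose_mat Q * (H * Q)))"
proof -
  have Wc: "W \<in> carrier_mat N N" "W * H = 1\<^sub>m N" "H * W = 1\<^sub>m N" using W by (auto simp: is_inv_def)
  note c [simp] = H(1) Wc(1) e Q mult_carrier_mat[of H N N Q p]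
  have [simp]: "transpose_mat e \<in> carrier_mat p N" "transpose_mat Q \<in> carrier_mat p N" by auto
  have Wh: "W * h = W * e + Q"
    unfolding h by (simp add: mult_add_distrib_mat[of W N N _ p] Wc(2) left_mult_one_mat[of Q N p] flip: assoc_mult_mat[of W N N H N Q p])
  have [simp]: "W * e \<in> carrier_mat N p" by (rule mult_carrier_mat[of _ _ N]) auto
  have ht: "transpose_mat h = transpose_mat e + transpose_mat Q * H"
    unfolding h by (simp add: transpose_add[of _ N p] transpose_mult[of _ N N _ p] H(2))
  have "transpose_mat h * W * h = transpose_mat h * (W * h)"
    by (rule assoc_mult_mat[of _ p N _ N _ p]) (auto simp: h)
  also have "\<dots> = transpose_mat h * (W * e) + transpose_mat h * Q"
    unfolding Wh by (rule mult_add_distrib_mat[of _ p N _ p]) (auto simp: h)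
  also have "transpose_mat h * (W * e) = transpose_mat e * (W * e) + transpose_mat Q * H * (W * e)"
    unfolding ht by (rule add_mult_distrib_mat[of _ p N _ _ p]) (auto intro!: mult_carrier_mat[of _ p N])
  also have "transpose_mat Q * H * (W * e) = transpose_mat Q * e"
    by (simp add: assoc_mult_mat[of _ p N H N "W * e" p] Wc(3) left_mult_one_mat[of e N p] flip: assoc_mult_mat[of H N N W N e p])
  also have "transpose_mat h * Q = transpose_mat e * Q + transpose_mat Q * H * Q"
    unfolding ht by (rule add_mult_distrib_mat[of _ p N _ _ p]) (auto intro!: mult_carrier_mat[of _ p N])
  also have "transpose_mat Q * H * Q = transpose_mat Q * (H * Q)"
    by (rule assoc_mult_mat[of _ p N _ N _ p]) auto
  also have "transpose_mat e * (W * e) = transpose_mat e * W * e"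
    by (rule assoc_mult_mat[of _ p N _ N _ p, symmetric]) auto
  finally show ?thesis
    using carrier_matD[OF e] carrier_matD[OF Q] by (intro eq_matI) (auto simp del: index_mult_mat(1))
qed

text \<open>Completing the square around the scalar block column of coefficients of a monic polynomial P.\<close>

lemma schur_identity:
  assumes S: "\<And>i. i < 2 * m \<Longrightarrow> sym_mat p (S i)" and W: "is_inv (m * p) (hankel p m S) W"
    and P: "degree P = m" "lead_coeff P = 1" and ab: "a < p" "b < p"
  shows "schur p m S $$ (a, b) = S (2 * m) $$ (a, b) - lin (\<lambda>l. S l $$ (a, b)) (P * P)
    + (transpose_mat (residual p m S P) * W * residual p m S P) $$ (a, b)"
proof -
  define N where "N = m * p"
  define e where "e = residual p m S P"
  \<comment> \<open>Every block of Q is a multiple of the identity, so multiplying by Q or its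
    transpose does not mix matrix positions. Apart from the remainder, entry (a,b) of the Schur
    complement therefore involves, up to transposition, only entries (a,b) of the moments.\<close>
  define Q where "Q = blockmat p m 1 (\<lambda>i _. (- coeff P i) \<cdot>\<^sub>m 1\<^sub>m p)"
  define H where "H = hankel p m S"
  define h where "h = hankel_col p m S"
  have car: "H \<in> carrier_mat N N" "e \<in> carrier_mat N p" "Q \<in> carrier_mat N p" "h \<in> carrier_mat N p"
    unfolding H_def e_def Q_def h_def N_def hankel_def residual_def hankel_col_def
    using blockmat_carrier[of p m 1] by auto
  have Hs: "transpose_mat H = H" unfolding H_def by (rule hankel_sym) (rule S)
  have e_entry: "e $$ (i * p + x, y) = lin (\<lambda>l. S l $$ (x, y)) (P * monom 1 i)"
    if "i < m" "x < p" "y < p" for i x y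
    using that unfolding e_def residual_def by (subst blockmat_col_entry) auto
  have Q_entry: "Q $$ (i * p + x, y) = (if x = y then - coeff P i else 0)"
    if "i < m" "x < p" "y < p" for i x y
    using that unfolding Q_def by (subst blockmat_col_entry) auto
  have QT: "(transpose_mat Q * M) $$ (x, y) = (\<Sum>i<m. - coeff P i * M $$ (i * p + x, y))"
    if "M \<in> carrier_mat N p" "x < p" "y < p" for M x y
  proof -
    have "(transpose_mat Q * M) $$ (x, y) = (\<Sum>k<N. transpose_mat Q $$ (x, k) * M $$ (k, y))"
      by (rule mult_entry) (use that car in auto)
    also have "\<dots> = (\<Sum>k<m*p. Q $$ (k, x) * M $$ (k, y))"
      using car that by (intro sum.cong) (auto simp: N_def)
    also have "\<dots> = (\<Sum>i<m. \<Sum>c<p. if c = x then - coeff P i * M $$ (i * p + c, y) else 0)"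
      unfolding sum_blocks by (intro sum.cong) (auto simp: Q_entry that)
    finally show ?thesis using that by simp
  qed
  have HQ: "(H * Q) $$ (i * p + x, y) = - (\<Sum>k<m. coeff P k * S (k + i) $$ (x, y))"
    if "i < m" "x < p" "y < p" for i x y
  proof -
    have "(H * Q) $$ (i * p + x, y) = (\<Sum>k<N. H $$ (i * p + x, k) * Q $$ (k, y))"
      by (rule mult_entry) (use that car in \<open>auto simp: N_def block_index_less\<close>)
    also have "\<dots> = (\<Sum>k<m. \<Sum>c<p. if c = y then - coeff P k * S (k + i) $$ (x, c) else 0)"
      unfolding N_def sum_blocks
    proof (intro sum.cong refl)
      fix k c assume kc: "k \<in> {..<m}" "c \<in> {..<p}"
      then have "H $$ (i * p + x, k * p + c) = S (k + i) $$ (x, c)"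
        unfolding H_def hankel_def using that by (simp add: blockmat_entry add.commute[of k i])
      then show "H $$ (i * p + x, k * p + c) * Q $$ (k * p + c, y) = (if c = y then - coeff P k * S (k + i) $$ (x, c) else 0)"
        using kc that by (simp add: Q_entry)
    qed
    finally show ?thesis using that by (simp add: sum_negf)
  qed
  have h_eq: "h = e + H * Q"
  proof (rule eq_matI)
    fix x y assume "x < dim_row (e + H * Q)" "y < dim_col (e + H * Q)"
    then have xy: "x < m * p" "y < p" using car by (auto simp: N_def)
    obtain i c where i: "i < m" "c < p" "x = i * p + c" using block_index_cases[OF xy(1)] .
    have "h $$ (x, y) = S (m + i) $$ (c, y)"
      unfolding i h_def hankel_col_def by (rule blockmat_col_entry) (use i xy in auto)
    also have "\<dots> = e $$ (x, y) + (H * Q) $$ (x, y)"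
      using i xy e_entry[of i c y] HQ[of i c y]
      by (simp add: lin_mult_monom monic_split_sum[OF P] del: index_mult_mat(1))
    finally show "h $$ (x, y) = (e + H * Q) $$ (x, y)"
      using xy car by (simp add: N_def del: index_mult_mat(1))
  qed (use car in auto)
  \<comment> \<open>The product e^T Q yields the transposed entry (b,a). For i < m the polynomial P
    x^i has degree below 2m, so the symmetry hypothesis covers every moment that occurs.\<close>
  have Sym: "S l $$ (b, a) = S l $$ (a, b)" if "l < 2 * m" for l
    using S[OF that] ab unfolding sym_mat_def by (metis carrier_matD index_transpose_mat(1))
  have lin_sym: "lin (\<lambda>l. S l $$ (b, a)) (P * monom 1 i) = lin (\<lambda>l. S l $$ (a, b)) (P * monom 1 i)" if "i < m" for i
    unfolding lin_mult_monom by (rule sum.cong) (use that in \<open>simp_all add: Sym P(1)\<close>)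
  have q1: "(transpose_mat Q * e) $$ (a, b) = - (\<Sum>i<m. coeff P i * lin (\<lambda>l. S l $$ (a, b)) (P * monom 1 i))"
    using QT[OF car(2) ab] by (simp add: e_entry ab sum_negf)
  have "(transpose_mat e * Q) $$ (a, b) = (transpose_mat Q * e) $$ (b, a)"
    using ab car by (simp add: comm_scalar_prod[of "col e a" N "col Q b"])
  also have "\<dots> = - (\<Sum>i<m. coeff P i * lin (\<lambda>l. S l $$ (b, a)) (P * monom 1 i))"
    using QT[OF car(2) ab(2,1)] by (simp add: e_entry ab sum_negf)
  also have "\<dots> = - (\<Sum>i<m. coeff P i * lin (\<lambda>l. S l $$ (a, b)) (P * monom 1 i))"
    using lin_sym by simp
  finally have q2: "(transpose_mat e * Q) $$ (a, b) = - (\<Sum>i<m. coeff P i * lin (\<lambda>l. S l $$ (a, b)) (P * monom 1 i))" .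
  have q3: "(transpose_mat Q * (H * Q)) $$ (a, b) = (\<Sum>i<m. coeff P i * (\<Sum>k<m. coeff P k * S (k + i) $$ (a, b)))"
    using QT[of "H * Q" a b] car ab by (simp add: HQ del: index_mult_mat(1))
  have "schur p m S = transpose_mat h * W * h"
    unfolding schur_def h_def[symmetric] H_def[symmetric] using minv_eq[of H "m * p" W] W car
    by (simp add: H_def[symmetric] N_def)
  also have "\<dots> = transpose_mat e * W * e + (transpose_mat e * Q + (transpose_mat Q * e + transpose_mat Q * (H * Q)))"
    by (rule congr_shift[OF car(1) Hs _ car(2,3) h_eq]) (use W in \<open>simp add: H_def N_def\<close>)
  finally have "schur p m S $$ (a, b) = (transpose_mat e * W * e) $$ (a, b) + ((transpose_mat e * Q) $$ (a, b)
      + ((transpose_mat Q * e) $$ (a, b) + (transpose_mat Q * (H * Q)) $$ (a, b)))"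
    using ab car by (simp del: index_mult_mat(1))
  moreover have "lin (\<lambda>l. S l $$ (a, b)) (P * P) = S (2 * m) $$ (a, b)
      + (\<Sum>k<m. coeff P k * S (k + m) $$ (a, b))
      + (\<Sum>i<m. coeff P i * lin (\<lambda>l. S l $$ (a, b)) (P * monom 1 i))"
    unfolding lin_mult[of _ P P] monic_split_sum[OF P]
    unfolding lin_mult_monom[of _ P m] monic_split_sum[OF P] by (simp add: mult_2)
  moreover have "(\<Sum>i<m. coeff P i * lin (\<lambda>l. S l $$ (a, b)) (P * monom 1 i)) =
      (\<Sum>i<m. coeff P i * S (i + m) $$ (a, b)) + (\<Sum>i<m. coeff P i * (\<Sum>k<m. coeff P k * S (k + i) $$ (a, b)))"
    unfolding lin_mult_monom monic_split_sum[OF P]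
    by (simp add: distrib_left sum.distrib add.commute)
  ultimately show ?thesis
    unfolding e_def[symmetric] using q1 q2 q3 by linarith
qed

text \<open>A kernel vector is the coefficient list of a polynomial f of degree d < m that is
  orthogonal to all powers below m, hence to P_d. Orthogonality of P_d reduces its pairing with any
  g of degree d to the leading coefficient of g. For g = f this forces P_d to be orthogonal to x^d,
  and then g = P_d contradicts its nonzero norm.\<close>

lemma scalar_hankel_inv:
  assumes P: "\<And>d. d < m \<Longrightarrow> degree (P d) = d \<and> lead_coeff (P d) = 1"
    and orth: "\<And>d i. d < m \<Longrightarrow> i < d \<Longrightarrow> lin t (P d * monom 1 i) = 0"
    and nz: "\<And>d. d < m \<Longrightarrow> lin t (P d * P d) \<noteq> 0"
  shows "\<exists>B. is_inv m (mat m m (\<lambda>(i, j). t (i + j))) B"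
proof (rule inv_existsI)
  fix v :: "real vec" assume v: "v \<in> carrier_vec m" "mat m m (\<lambda>(i, j). t (i + j)) *\<^sub>v v = 0\<^sub>v m"
  define f where "f = (\<Sum>k<m. monom (v $ k) k)"
  have cf: "coeff f k = (if k < m then v $ k else 0)" for k
    by (simp add: f_def coeff_sum)
  have f0: "lin t (f * monom 1 i) = 0" if "i < m" for i
  proof -
    have "lin t (f * monom 1 i) = (\<Sum>k<m. v $ k * t (k + i))"
      unfolding f_def by (simp add: sum_distrib_right lin_sum mult_monom lin_monom)
    also have "\<dots> = (mat m m (\<lambda>(i, j). t (i + j)) *\<^sub>v v) $ i"
      using that v(1) by (simp add: scalar_prod_def lessThan_atLeast0 mult.commute add.commute)
    finally show ?thesis using v(2) that by simp
  qed
  have "f = 0"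
  proof (rule ccontr)
    assume "f \<noteq> 0"
    define d where "d = degree f"
    have d: "d < m" using \<open>f \<noteq> 0\<close> cf[of d] by (auto simp: d_def split: if_splits)
    have lead: "lin t (P d * g) = lead_coeff g * lin t (P d * monom 1 d)" if "degree g = d" for g
    proof -
      have "lin t (P d * g) = (\<Sum>i\<in>{d}. coeff g i * lin t (P d * monom 1 i))"
        unfolding lin_mult[of t "P d" g] that
        by (rule sum.mono_neutral_right) (use orth[OF d] in auto)
      then show ?thesis using that by simp
    qed
    have "lin t (P d * f) = lin t (f * P d)" by (simp add: mult.commute)
    also have "\<dots> = 0"
      unfolding lin_mult[of t f "P d"] by (rule sum.neutral) (use conjunct1[OF P[OF d]] d f0 in simp)
    finally have "lin t (P d * monom 1 d) = 0" using lead[of f] \<open>f \<noteq> 0\<close> by (simp add: d_def)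
    then show False using lead[of "P d"] P[OF d] nz[OF d] by simp
  qed
  then have "v $ k = 0" if "k < m" for k using cf[of k] that by simp
  then show "v = 0\<^sub>v m" using v(1) by (intro eq_vecI) auto
qed simp

section \<open>Asymptotic estimates along a filter\<close>

lemma frob_bigo:
  assumes A: "\<And>h. A h \<in> carrier_mat r c"
    and e: "\<And>i j. i < r \<Longrightarrow> j < c \<Longrightarrow> (\<lambda>h. A h $$ (i, j)) \<in> O[F](g)"
  shows "(\<lambda>h. frob (A h)) \<in> O[F](g)"
proof -
  have b: "(\<lambda>h. \<Sum>i<r. \<Sum>j<c. \<bar>A h $$ (i, j)\<bar>) \<in> O[F](g)"
    by (intro big_sum_in_bigo) (use e in auto)
  have "(\<lambda>h. frob (A h)) \<in> O[F](\<lambda>h. \<Sum>i<r. \<Sum>j<c. \<bar>A h $$ (i, j)\<bar>)"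
  proof (rule bigoI[of _ 1], rule always_eventually, rule allI)
    fix h
    show "norm (frob (A h)) \<le> 1 * norm (\<Sum>i<r. \<Sum>j<c. \<bar>A h $$ (i, j)\<bar>)"
      using frob_le_sum[of "A h"] A[of h] by (simp add: sum_nonneg)
  qed
  from landau_o.big_trans[OF this b] show ?thesis .
qed

lemma sym_mat_entry: "sym_mat p X \<Longrightarrow> a < p \<Longrightarrow> b < p \<Longrightarrow> X $$ (b, a) = X $$ (a, b)"
  unfolding sym_mat_def by (metis carrier_matD index_transpose_mat(1))

lemma sym_matI: "X \<in> carrier_mat p p \<Longrightarrow> (\<And>a b. a < p \<Longrightarrow> b < p \<Longrightarrow> X $$ (b, a) = X $$ (a, b)) \<Longrightarrow> sym_mat p X"
  unfolding sym_mat_def by (auto intro!: eq_matI)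

lemma sym_mat_carrier: "sym_mat p X \<Longrightarrow> X \<in> carrier_mat p p"
  by (simp add: sym_mat_def)

lemma sym_mat_diff: "sym_mat p X \<Longrightarrow> sym_mat p Y \<Longrightarrow> sym_mat p (X - Y)"
  by (rule sym_matI) (auto simp: sym_mat_carrier sym_mat_entry carrier_matD[OF sym_mat_carrier] minus_carrier_mat)

lemma sym_mat_add: "sym_mat p X \<Longrightarrow> sym_mat p Y \<Longrightarrow> sym_mat p (X + Y)"
  by (rule sym_matI) (auto simp: sym_mat_carrier sym_mat_entry carrier_matD[OF sym_mat_carrier])

lemma sym_mat_smult: "sym_mat p X \<Longrightarrow> sym_mat p (c \<cdot>\<^sub>m X)"
  by (rule sym_matI) (auto simp: sym_mat_carrier sym_mat_entry carrier_matD[OF sym_mat_carrier])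

lemma sym_mat_one: "sym_mat p (1\<^sub>m p)"
  by (simp add: sym_mat_def)

lemma bigo_tendsto_0:
  assumes "f \<in> O[F](g)" "(g \<longlongrightarrow> (0::real)) F"
  shows "((f :: 'h \<Rightarrow> real) \<longlongrightarrow> 0) F"
proof -
  have "g \<in> o[F](\<lambda>_. 1)" by (rule smalloI_tendsto) (use assms(2) in simp_all)
  then have "f \<in> o[F](\<lambda>_. 1)" using assms(1) landau_o.big_small_trans by blast
  then show ?thesis using smalloD_tendsto[of f F "\<lambda>_. 1"] by simp
qed

lemma cmult_bigo: "(f :: 'h \<Rightarrow> real) \<in> O[F](g) \<Longrightarrow> (\<lambda>h. c * f h) \<in> O[F](g)"
  by (cases "c = 0") simp_all

lemma lin_bigo:
  assumes "\<And>i. i \<le> degree f \<Longrightarrow> (\<lambda>h. S h i - t i) \<in> O[F](g)"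
  shows "(\<lambda>h. lin (S h) f - lin t f) \<in> O[F](g)"
proof -
  have "(\<lambda>h. \<Sum>i\<le>degree f. coeff f i * (S h i - t i)) \<in> O[F](g)"
    by (intro big_sum_in_bigo cmult_bigo assms) simp
  then show ?thesis by (simp add: lin_def sum_subtractf right_diff_distrib)
qed

lemma lin_scale: "lin (\<lambda>i. c * t i) f = c * lin t f"
  by (simp add: lin_def sum_distrib_left mult_ac)

text \<open>The scalar relation between g and the Hankel matrix, tensored with the identity. It
  supplies the approximate left inverse for all nearby block Hankel matrices.\<close>

lemma block_hankel_inv:
  assumes g: "is_inv m (mat m m (\<lambda>(i, j). t (i + j))) g"
  shows "blockmat p m m (\<lambda>i j. g $$ (i, j) \<cdot>\<^sub>m 1\<^sub>m p) * blockmat p m m (\<lambda>i j. t (i + j) \<cdot>\<^sub>m 1\<^sub>m p) = 1\<^sub>m (m * p)"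
    (is "?G * ?H = _")
proof (rule eq_matI)
  fix x y assume "x < dim_row (1\<^sub>m (m * p) :: real mat)" "y < dim_col (1\<^sub>m (m * p) :: real mat)"
  then have xy: "x < m * p" "y < m * p" by auto
  obtain i a where i: "i < m" "a < p" "x = i * p + a" using block_index_cases[OF xy(1)] .
  obtain j b where j: "j < m" "b < p" "y = j * p + b" using block_index_cases[OF xy(2)] .
  have gc: "g \<in> carrier_mat m m" using g by (simp add: is_inv_def)
  have "(?G * ?H) $$ (x, y) = (\<Sum>k<m*p. ?G $$ (x, k) * ?H $$ (k, y))"
    by (rule mult_entry[OF blockmat_carrier blockmat_carrier xy])
  also have "\<dots> = (\<Sum>k<m. \<Sum>c<p. if c = a then g $$ (i, k) * (if a = b then t (k + j) else 0) else 0)"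
    unfolding sum_blocks
  proof (intro sum.cong refl)
    fix k c assume "k \<in> {..<m}" "c \<in> {..<p}"
    then show "?G $$ (x, k * p + c) * ?H $$ (k * p + c, y) =
        (if c = a then g $$ (i, k) * (if a = b then t (k + j) else 0) else 0)"
      unfolding i(3) j(3) using i j by (simp add: blockmat_entry)
  qed
  also have "\<dots> = (if a = b then (\<Sum>k<m. g $$ (i, k) * t (k + j)) else 0)"
    using i by simp
  also have "(\<Sum>k<m. g $$ (i, k) * t (k + j)) = (g * mat m m (\<lambda>(i, j). t (i + j))) $$ (i, j)"
    using i j gc by (subst mult_entry[OF gc]) auto
  also have "\<dots> = (if i = j then 1 else 0)"
    using g i j by (simp add: is_inv_def)
  also have "(if a = b then if i = j then 1 else 0 else 0) = (if x = y then 1 else (0::real))"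
  proof (cases "x = y")
    case True
    then have "i * p + a = j * p + b" using i j by simp
    then have "(i * p + a) div p = (j * p + b) div p" "(i * p + a) mod p = (j * p + b) mod p" by simp_all
    then show ?thesis using i j True by simp
  next
    case False
    then show ?thesis using i j by auto
  qed
  finally show "(?G * ?H) $$ (x, y) = 1\<^sub>m (m * p) $$ (x, y)" using xy by simp
qed auto

lemma schur_carrier [simp]: "schur p m S \<in> carrier_mat p p"
  unfolding schur_def hankel_col_def by (intro carrier_matI) auto

lemma schur_sym:
  assumes S: "\<And>i. i < 2 * m \<Longrightarrow> sym_mat p (S i)" and W: "is_inv (m * p) (hankel p m S) W"
  shows "sym_mat p (schur p m S)"
proof -
  have H: "hankel p m S \<in> carrier_mat (m * p) (m * p)" by (simp add: hankel_def)
  have h: "hankel_col p m S \<in> carrier_mat (m * p) p"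
    unfolding hankel_col_def using blockmat_carrier[of p m 1] by simp
  have Wc: "W \<in> carrier_mat (m * p) (m * p)" using W by (simp add: is_inv_def)
  have Wt: "transpose_mat W = W"
    by (rule is_inv_sym[OF H _ W]) (rule hankel_sym, rule S)
  show ?thesis
    unfolding sym_mat_def
  proof
    show "transpose_mat (schur p m S) = schur p m S"
      unfolding schur_def minv_eq[OF H W] using h Wc
      by (simp add: transpose_mult[of _ p "m * p" _ p] transpose_mult[of _ p "m * p" _ "m * p"]
          transpose_mult[of _ "m * p" "m * p" _ p] Wt
          assoc_mult_mat[of _ p "m * p" _ "m * p" _ p] mult_carrier_mat[of _ p "m * p" _ "m * p"])
  qed simp
qed

text \<open>Near a scalar Hankel matrix the inverses are uniformly bounded by
  \<open>inv_perturb\<close>, and orthogonality of P for t makes the residual O(\<eta>); the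
  remainder in \<open>schur_identity\<close> is then O(\<eta>^2). Closeness is asked for below 2m
  only, because the block S_(2m) cancels against the leading term of P^2.\<close>

lemma schur_expansion:
  fixes S :: "'h \<Rightarrow> nat \<Rightarrow> real mat" and \<eta> :: "'h \<Rightarrow> real"
  assumes \<eta>: "(\<eta> \<longlongrightarrow> 0) F"
    and sym: "\<forall>\<^sub>F h in F. \<forall>i<2*m. sym_mat p (S h i)"
    and close: "\<And>i a b. i < 2 * m \<Longrightarrow> a < p \<Longrightarrow> b < p \<Longrightarrow>
      (\<lambda>h. S h i $$ (a, b) - (if a = b then t i else 0)) \<in> O[F](\<eta>)"
    and P: "degree P = m" "lead_coeff P = 1"
    and orth: "\<And>i. i < m \<Longrightarrow> lin t (P * monom 1 i) = 0"
    and g: "is_inv m (mat m m (\<lambda>(i, j). t (i + j))) g"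
  shows "\<forall>\<^sub>F h in F. sym_mat p (schur p m (S h))"
    and "a < p \<Longrightarrow> b < p \<Longrightarrow> (\<lambda>h. schur p m (S h) $$ (a, b) -
      (S h (2 * m) $$ (a, b) - lin (\<lambda>l. S h l $$ (a, b)) (P * P))) \<in> O[F](\<lambda>h. (\<eta> h)\<^sup>2)"
proof -
  define N where "N = m * p"
  define G where "G = blockmat p m m (\<lambda>i j. g $$ (i, j) \<cdot>\<^sub>m 1\<^sub>m p)"
  define H\<^sub>0 where "H\<^sub>0 = blockmat p m m (\<lambda>i j. t (i + j) \<cdot>\<^sub>m 1\<^sub>m p)"
  have G: "G \<in> carrier_mat N N" and H\<^sub>0: "H\<^sub>0 \<in> carrier_mat N N" by (simp_all add: G_def H\<^sub>0_def N_def)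
  have H: "hankel p m (S h) \<in> carrier_mat N N" for h by (simp add: hankel_def N_def)
  have GH: "G * H\<^sub>0 = 1\<^sub>m N" unfolding G_def H\<^sub>0_def N_def by (rule block_hankel_inv[OF g])
  have "(\<lambda>h. frob (H\<^sub>0 - hankel p m (S h))) \<in> O[F](\<eta>)"
  proof (rule frob_bigo)
    fix x y assume "x < N" "y < N"
    then have xy: "x < m * p" "y < m * p" by (simp_all add: N_def)
    obtain i a where i: "i < m" "a < p" "x = i * p + a" using block_index_cases[OF xy(1)] .
    obtain j b where j: "j < m" "b < p" "y = j * p + b" using block_index_cases[OF xy(2)] .
    have "(H\<^sub>0 - hankel p m (S h)) $$ (x, y) = - (S h (i + j) $$ (a, b) - (if a = b then t (i + j) else 0))" for h
      unfolding i(3) j(3) H\<^sub>0_def hankel_def using i j xy by (simp add: blockmat_entry)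
    then show "(\<lambda>h. (H\<^sub>0 - hankel p m (S h)) $$ (x, y)) \<in> O[F](\<eta>)"
      using close[of "i + j" a b] i j by (simp only: landau_o.big.uminus_in_iff)
  qed (rule minus_carrier_mat[OF H])
  then have "(\<lambda>h. frob G * frob (H\<^sub>0 - hankel p m (S h))) \<in> O[F](\<eta>)" by (rule cmult_bigo)
  from bigo_tendsto_0[OF this \<eta>]
  have "\<forall>\<^sub>F h in F. frob G * frob (H\<^sub>0 - hankel p m (S h)) < 1/2"
    by (rule order_tendstoD) simp
  then have inv: "\<forall>\<^sub>F h in F. \<exists>W. is_inv N (hankel p m (S h)) W \<and> frob W \<le> 2 * frob G"
  proof eventually_elim
    case (elim h)
    have "1\<^sub>m N - G * hankel p m (S h) = G * (H\<^sub>0 - hankel p m (S h))"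
      using GH by (simp add: mult_minus_distrib_mat[OF G H\<^sub>0 H])
    then have "frob (1\<^sub>m N - G * hankel p m (S h)) \<le> frob G * frob (H\<^sub>0 - hankel p m (S h))"
      using frob_mult[OF G minus_carrier_mat[OF H]] by simp
    then show ?case using elim by (intro inv_perturb[OF H G]) simp
  qed
  from inv sym show "\<forall>\<^sub>F h in F. sym_mat p (schur p m (S h))"
  proof eventually_elim
    case (elim h)
    then show ?case unfolding N_def by (metis schur_sym)
  qed
  have res: "(\<lambda>h. frob (residual p m (S h) P)) \<in> O[F](\<eta>)"
  proof (rule frob_bigo)
    show "residual p m (S h) P \<in> carrier_mat N p" for h
      unfolding residual_def N_def using blockmat_carrier[of p m 1] by simp
    fix x b assume "x < N" and b: "b < p"
    then have x: "x < m * p" by (simp add: N_def)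
    obtain i a where i: "i < m" "a < p" "x = i * p + a" using block_index_cases[OF x] .
    \<comment> \<open>The limiting moments are scalar matrices, so d t is the limit of the entries
      at (a,b); off the diagonal it is the zero functional.\<close>
    define d :: real where "d = (if a = b then 1 else 0)"
    have deg: "degree (P * monom 1 i) \<le> m + i"
      using degree_mult_le[of P "monom 1 i"] degree_monom_le[of "1::real" i] P(1) by simp
    have "(\<lambda>h. lin (\<lambda>l. S h l $$ (a, b)) (P * monom 1 i) - lin (\<lambda>l. d * t l) (P * monom 1 i)) \<in> O[F](\<eta>)"
    proof (rule lin_bigo)
      fix l assume "l \<le> degree (P * monom 1 i)"
      then have "l < 2 * m" using deg i by simp
      moreover have "d * t l = (if a = b then t l else 0)" by (simp add: d_def)
      ultimately show "(\<lambda>h. S h l $$ (a, b) - d * t l) \<in> O[F](\<eta>)" using close i b by simp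
    qed
    moreover have "lin (\<lambda>l. d * t l) (P * monom 1 i) = 0"
      unfolding lin_scale using orth[OF i(1)] by simp
    moreover have "residual p m (S h) P $$ (x, b) = lin (\<lambda>l. S h l $$ (a, b)) (P * monom 1 i)" for h
      unfolding residual_def i(3) using i b by (subst blockmat_col_entry) auto
    ultimately show "(\<lambda>h. residual p m (S h) P $$ (x, b)) \<in> O[F](\<eta>)" by simp
  qed
  show "(\<lambda>h. schur p m (S h) $$ (a, b) -
      (S h (2 * m) $$ (a, b) - lin (\<lambda>l. S h l $$ (a, b)) (P * P))) \<in> O[F](\<lambda>h. (\<eta> h)\<^sup>2)"
    if ab: "a < p" "b < p"
  proof -
    have "(\<lambda>h. schur p m (S h) $$ (a, b) - (S h (2 * m) $$ (a, b) - lin (\<lambda>l. S h l $$ (a, b)) (P * P)))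
      \<in> O[F](\<lambda>h. (frob (residual p m (S h) P))\<^sup>2)"
    proof (rule bigoI[of _ "2 * frob G"])
      from inv sym show "\<forall>\<^sub>F h in F. norm (schur p m (S h) $$ (a, b) -
          (S h (2 * m) $$ (a, b) - lin (\<lambda>l. S h l $$ (a, b)) (P * P)))
        \<le> 2 * frob G * norm ((frob (residual p m (S h) P))\<^sup>2)"
      proof eventually_elim
        case (elim h)
        then obtain W where W: "is_inv N (hankel p m (S h)) W" "frob W \<le> 2 * frob G" by blast
        define e where "e = residual p m (S h) P"
        have e: "e \<in> carrier_mat N p"
          unfolding e_def residual_def N_def using blockmat_carrier[of p m 1] by simp
        have Wc: "W \<in> carrier_mat N N" using W by (simp add: is_inv_def)
        have "schur p m (S h) $$ (a, b) - (S h (2 * m) $$ (a, b) - lin (\<lambda>l. S h l $$ (a, b)) (P * P)) =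
            (transpose_mat e * W * e) $$ (a, b)"
          using schur_identity[of m p "S h" W P a b] elim(2) W(1) P ab by (simp add: e_def N_def)
        also have "\<bar>\<dots>\<bar> \<le> frob (transpose_mat e * W * e)"
          by (rule frob_entry) (use e Wc ab in auto)
        also have "\<dots> \<le> frob (transpose_mat e * W) * frob e"
          by (rule frob_mult[of _ p N]) (use e Wc in \<open>auto intro: mult_carrier_mat[of _ p N]\<close>)
        also have "\<dots> \<le> (frob (transpose_mat e) * frob W) * frob e"
          by (intro mult_right_mono frob_mult[of _ p N]) (use e Wc in auto)
        also have "\<dots> \<le> (frob e * (2 * frob G)) * frob e"
          unfolding frob_transpose using W(2) by (intro mult_right_mono mult_left_mono) auto
        finally show ?case by (simp add: e_def power2_eq_square mult_ac)
      qed
    qed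
    moreover have "(\<lambda>h. (frob (residual p m (S h) P))\<^sup>2) \<in> O[F](\<lambda>h. (\<eta> h)\<^sup>2)"
      unfolding power2_eq_square by (rule landau_o.big.mult[OF res res])
    ultimately show ?thesis by (rule landau_o.big_trans)
  qed
qed

section \<open>The moment bounds as Schur complements\<close>

lemma schur_0: "schur p 0 S = 0\<^sub>m p p"
  unfolding schur_def hankel_col_def by (intro eq_matI) (auto simp: scalar_prod_def)

lemma schur_cong:
  assumes "\<And>i. i < 2 * m \<Longrightarrow> S i = S' i"
  shows "schur p m S = schur p m S'"
proof -
  have "hankel p m S = hankel p m S'"
    unfolding hankel_def blockmat_def
  proof (rule cong_mat)
    fix i j assume "i < m * p" "j < m * p"
    then have "i div p < m" "j div p < m" by (auto simp: less_mult_imp_div_less)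
    then have "S (i div p + j div p) = S' (i div p + j div p)" by (intro assms) linarith
    then show "(case (i, j) of (i, j) \<Rightarrow> S (i div p + j div p) $$ (i mod p, j mod p)) =
        (case (i, j) of (i, j) \<Rightarrow> S' (i div p + j div p) $$ (i mod p, j mod p))" by simp
  qed simp_all
  moreover have "hankel_col p m S = hankel_col p m S'"
    unfolding hankel_col_def blockmat_def
  proof (rule cong_mat)
    fix i j assume "i < m * p" "j < 1 * p"
    then have "i div p < m" by (auto simp: less_mult_imp_div_less)
    then have "S (m + i div p) = S' (m + i div p)" by (intro assms) linarith
    then show "(case (i, j) of (i, j) \<Rightarrow> S (m + i div p) $$ (i mod p, j mod p)) =
        (case (i, j) of (i, j) \<Rightarrow> S' (m + i div p) $$ (i mod p, j mod p))" by simp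
  qed simp_all
  ultimately show ?thesis by (simp add: schur_def)
qed

text \<open>The parity of j becomes a shift of the moments, that is, the weight 1 or x. The empty
  Schur complement accounts for S_1^- = 0.\<close>

lemma Smin_schur:
  assumes "j \<ge> 1"
  shows "Smin p S j = schur p (j div 2) (\<lambda>i. S (i + j mod 2))"
proof (cases "j = 1")
  case True
  then show ?thesis by (simp add: Smin_def schur_0)
next
  case False
  show ?thesis
  proof (cases "even j")
    case True
    then obtain m' where "j = 2 * m'" by blast
    with assms obtain m where m: "j = 2 * Suc m" by (cases m') auto
    show ?thesis
      by (simp add: m Smin_def schur_def hlow_def Hlow_def hankel_def hankel_col_def Let_def)
  next
    case odd: False
    then obtain m' where "j = 2 * m' + 1" using oddE by blast
    with False obtain m where m: "j = 2 * Suc m + 1" by (cases m') auto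
    show ?thesis
      by (simp add: m Smin_def schur_def hlow_def Hlow_def hankel_def hankel_col_def Let_def)
  qed
qed

text \<open>For odd j the sequence is S_i - S_(i+1), with weight 1 - x; for even j it is S_(i+1) -
  S_(i+2), with weight x (1 - x). The exceptional values S_1^+ = I and S_2^+ = S_1 are S_(j-1) minus
  an empty Schur complement.\<close>

lemma Splus_schur:
  assumes "j \<ge> 1" "S 0 = 1\<^sub>m p" "S 1 \<in> carrier_mat p p"
  shows "Splus p S j = S (j - 1) -
    schur p ((j - 1) div 2) (\<lambda>i. S (i + (1 - j mod 2)) - S (i + (2 - j mod 2)))"
proof -
  consider "j = 1" | "j = 2" | m where "j = 2 * Suc m + 1" | m where "j = 2 * Suc (Suc m)"
  proof -
    show thesis
    proof (cases "even j")
      case True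
      then obtain m where m: "j = 2 * m" by blast
      show thesis using that(2,4) m assms(1) by (cases m; cases "m - 1") auto
    next
      case False
      then obtain m where m: "j = 2 * m + 1" using oddE by blast
      show thesis using that(1,3) m by (cases m) auto
    qed
  qed
  then show ?thesis
  proof cases
    case 1
    then show ?thesis by (simp add: Splus_def schur_0 assms(2)) (intro eq_matI, auto)
  next
    case 2
    then show ?thesis using assms(3) by (simp add: Splus_def schur_0) (intro eq_matI, auto)
  next
    case 3
    then show ?thesis
      by (simp add: Splus_def schur_def hup_def Hup_def hankel_def hankel_col_def Let_def)
  next
    case 4
    then show ?thesis
      by (simp add: Splus_def schur_def hup_def Hup_def hankel_def hankel_col_def Let_def)
  qed
qed

text \<open>The bounds at j see only the moments below j. This triangular structure carries the
  recursion for the inverse and the uniqueness of the preimage.\<close>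

lemma Smin_cong:
  assumes "\<And>i. i < j \<Longrightarrow> S i = S' i"
  shows "Smin p S j = Smin p S' j"
proof (cases "j = 0")
  case False
  then have j: "j \<ge> 1" by simp
  show ?thesis unfolding Smin_schur[OF j]
    by (rule schur_cong, rule assms) presburger
qed (simp add: Smin_def)

lemma Splus_cong:
  assumes "j \<ge> 1" "\<And>i. i < j \<Longrightarrow> S i = S' i" "S 0 = 1\<^sub>m p" "S' 0 = 1\<^sub>m p"
    "S 1 \<in> carrier_mat p p" "S' 1 \<in> carrier_mat p p"
  shows "Splus p S j = Splus p S' j"
proof -
  have "schur p ((j - 1) div 2) (\<lambda>i. S (i + (1 - j mod 2)) - S (i + (2 - j mod 2))) =
    schur p ((j - 1) div 2) (\<lambda>i. S' (i + (1 - j mod 2)) - S' (i + (2 - j mod 2)))"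
  proof (rule schur_cong)
    fix i assume "i < 2 * ((j - 1) div 2)"
    then have "i + (1 - j mod 2) < j" "i + (2 - j mod 2) < j" by presburger+
    then show "S (i + (1 - j mod 2)) - S (i + (2 - j mod 2)) = S' (i + (1 - j mod 2)) - S' (i + (2 - j mod 2))"
      by (simp add: assms(2))
  qed
  then show ?thesis using assms by (simp add: Splus_schur)
qed

section \<open>Expansion of the canonical moments\<close>

text \<open>Write E = D / c^2 - 1, R = c (1 + Y) and U = X + 1/2. The half contributes R R / 2 = D /
  2 exactly, and R X R differs from c^2 X only by c^2 times Y X + X Y + Y X Y. Since Y is no larger
  than E, each of the three terms is at most \<open>frob E\<close> times \<open>frob X\<close>,
  which gives the constant 3.\<close>

lemma sqrt_conj:
  assumes D: "sym_mat p D" and U: "U \<in> carrier_mat p p" and c: "c > 0"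
    and E: "frob ((1 / c\<^sup>2) \<cdot>\<^sub>m D - 1\<^sub>m p) \<le> 1/4"
  shows "\<exists>R. posdef p R \<and> R * R = D \<and> (\<forall>a<p. \<forall>b<p.
    \<bar>(R * U * R) $$ (a, b) - (1/2 * D $$ (a, b) + c\<^sup>2 * (U - (1/2) \<cdot>\<^sub>m 1\<^sub>m p) $$ (a, b))\<bar>
      \<le> 3 * c\<^sup>2 * (frob ((1 / c\<^sup>2) \<cdot>\<^sub>m D - 1\<^sub>m p) * frob (U - (1/2) \<cdot>\<^sub>m 1\<^sub>m p)))"
proof -
  define E where "E = (1 / c\<^sup>2) \<cdot>\<^sub>m D - 1\<^sub>m p"
  have Dc: "D \<in> carrier_mat p p" using D by (rule sym_mat_carrier)
  have Es: "sym_mat p E" unfolding E_def by (intro sym_mat_diff sym_mat_smult D sym_mat_one)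
  obtain Y where Y: "sym_mat p Y" "frob Y \<le> frob E" "(1\<^sub>m p + Y) * (1\<^sub>m p + Y) = 1\<^sub>m p + E"
    using sqrt_perturb[OF Es] E unfolding E_def by blast
  have Yc [simp]: "Y \<in> carrier_mat p p" using Y(1) by (rule sym_mat_carrier)
  define Q where "Q = 1\<^sub>m p + Y"
  define R where "R = c \<cdot>\<^sub>m Q"
  define X where "X = U - (1/2) \<cdot>\<^sub>m 1\<^sub>m p"
  have Qc [simp]: "Q \<in> carrier_mat p p" by (simp add: Q_def)
  have Rc [simp]: "R \<in> carrier_mat p p" by (simp add: R_def)
  have Xc [simp]: "X \<in> carrier_mat p p" unfolding X_def by (intro minus_carrier_mat) simp
  note [simp] = mult_carrier_mat[of _ p p _ p]
  have fE: "frob E \<le> 1/4" using E by (simp add: E_def)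
  have pos: "posdef p R" unfolding R_def Q_def by (rule posdef_perturb[OF Y(1) _ c]) (use Y(2) fE in linarith)
  have RR: "R * R = D"
  proof -
    have "R * R = c\<^sup>2 \<cdot>\<^sub>m (Q * Q)"
      unfolding R_def by (simp add: mult_smult_assoc_mat[of _ p p _ p] mult_smult_distrib[of _ p p _ p])
        (intro eq_matI, auto simp: power2_eq_square)
    also have "Q * Q = 1\<^sub>m p + E" unfolding Q_def by (rule Y(3))
    also have "c\<^sup>2 \<cdot>\<^sub>m (1\<^sub>m p + E) = D"
      using Dc c by (intro eq_matI) (auto simp: E_def)
    finally show ?thesis .
  qed
  have U_eq: "U = X + (1/2) \<cdot>\<^sub>m 1\<^sub>m p" using U by (intro eq_matI) (auto simp: X_def)
  have "R * U * R = R * X * R + (1/2) \<cdot>\<^sub>m (R * R)"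
  proof -
    have "R * U = R * X + (1/2) \<cdot>\<^sub>m R"
      unfolding U_eq by (subst mult_add_distrib_mat[of _ p p _ p]) (auto simp: mult_smult_distrib[of _ p p _ p] right_mult_one_mat[of R p p])
    then show ?thesis
      by (simp add: add_mult_distrib_mat[of _ p p _ _ p] mult_smult_assoc_mat[of _ p p _ p])
  qed
  moreover have "R * X * R = c\<^sup>2 \<cdot>\<^sub>m (Q * X * Q)"
    unfolding R_def by (simp add: mult_smult_assoc_mat[of _ p p _ p] mult_smult_distrib[of _ p p _ p])
      (intro eq_matI, auto simp: power2_eq_square)
  moreover have QX: "Q * X = X + Y * X"
    by (subst Q_def) (simp add: add_mult_distrib_mat[of _ p p _ _ p] left_mult_one_mat[of X p p])
  have "Q * X * Q = X + (Y * X + (Q * X) * Y)"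
  proof -
    have "Q * X * Q = Q * X + Q * X * Y"
      by (subst (2) Q_def) (simp add: mult_add_distrib_mat[of _ p p _ p] right_mult_one_mat[of "Q * X" p p])
    then show ?thesis
      using assoc_add_mat[of X p p "Y * X" "Q * X * Y"] by (simp add: QX[symmetric])
  qed
  ultimately have RUR: "R * U * R = c\<^sup>2 \<cdot>\<^sub>m (X + (Y * X + (Q * X) * Y)) + (1/2) \<cdot>\<^sub>m D"
    by (simp add: RR)
  have "frob (Y * X + (Q * X) * Y) \<le> frob (Y * X) + frob (Q * X * Y)"
    by (rule frob_add[of _ p p]) auto
  also have "frob (Q * X * Y) \<le> frob (Q * X) * frob Y" by (rule frob_mult[of _ p p _ p]) auto
  also have "frob (Q * X) \<le> frob X + frob (Y * X)"
    unfolding QX by (rule frob_add[of _ p p]) auto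
  finally have "frob (Y * X + (Q * X) * Y) \<le> frob (Y * X) + (frob X + frob (Y * X)) * frob Y"
    by (simp add: mult_right_mono)
  also have "\<dots> \<le> frob E * frob X + (frob X + 1 * frob X) * frob E"
  proof -
    have "frob (Y * X) \<le> frob Y * frob X" by (rule frob_mult[of _ p p _ p]) auto
    also have "\<dots> \<le> frob E * frob X" using Y(2) by (intro mult_right_mono) auto
    finally have 1: "frob (Y * X) \<le> frob E * frob X" .
    also have "\<dots> \<le> 1 * frob X" using fE by (intro mult_right_mono) auto
    finally have 2: "frob (Y * X) \<le> 1 * frob X" .
    show ?thesis using 1 2 Y(2) by (intro add_mono mult_mono) auto
  qed
  finally have fr: "frob (Y * X + (Q * X) * Y) \<le> 3 * (frob E * frob X)" by simp
  have "\<bar>(R * U * R) $$ (a, b) - (1/2 * D $$ (a, b) + c\<^sup>2 * X $$ (a, b))\<bar> \<le> 3 * c\<^sup>2 * (frob E * frob X)"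
    if ab: "a < p" "b < p" for a b
  proof -
    have "(R * U * R) $$ (a, b) - (1/2 * D $$ (a, b) + c\<^sup>2 * X $$ (a, b)) =
        c\<^sup>2 * (Y * X + (Q * X) * Y) $$ (a, b)"
      unfolding RUR using ab Dc carrier_matD[OF Xc] carrier_matD[OF Yc] carrier_matD[OF Qc]
      by (simp add: algebra_simps del: index_mult_mat(1))
    also have "\<bar>\<dots>\<bar> = c\<^sup>2 * \<bar>(Y * X + (Q * X) * Y) $$ (a, b)\<bar>" by (simp add: abs_mult)
    also have "\<dots> \<le> c\<^sup>2 * (3 * (frob E * frob X))"
    proof (rule mult_left_mono)
      have "\<bar>(Y * X + (Q * X) * Y) $$ (a, b)\<bar> \<le> frob (Y * X + (Q * X) * Y)"
        by (rule frob_entry) (use ab carrier_matD[OF Yc] carrier_matD[OF Qc] in simp_all)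
      then show "\<bar>(Y * X + (Q * X) * Y) $$ (a, b)\<bar> \<le> 3 * (frob E * frob X)" using fr by linarith
    qed simp
    finally show ?thesis by (simp add: mult_ac)
  qed
  then show ?thesis unfolding E_def[symmetric] X_def[symmetric]
    by (intro exI[of _ R] conjI allI impI pos RR) simp_all
qed

lemma bigo_square_imp:
  assumes "(\<eta> \<longlongrightarrow> (0::real)) F" "f \<in> O[F](\<lambda>h. (\<eta> h)\<^sup>2)"
  shows "f \<in> O[F](\<eta> :: 'h \<Rightarrow> real)"
proof -
  have "\<eta> \<in> o[F](\<lambda>_. 1)" by (rule smalloI_tendsto) (use assms(1) in simp_all)
  then have "\<eta> \<in> O[F](\<lambda>_. 1)" by (rule landau_o.small_imp_big)
  from landau_o.big.mult[OF landau_o.big_refl this]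
  have "(\<lambda>h. (\<eta> h)\<^sup>2) \<in> O[F](\<eta>)" by (simp add: power2_eq_square)
  with assms(2) show ?thesis by (rule landau_o.big_trans)
qed

text \<open>For the weight that belongs to j, the orthogonal polynomial of degree d is found at the
  index 2d + j mod 2 for the lower bound, and at 2d + (2 - j mod 2) for the upper bound; both
  indices have the parity of j.\<close>

lemma lower_mod: "(2 * d + j mod 2) div 2 = d" "even (2 * d + j mod 2) = even (j :: nat)"
  by auto

lemma upper_mod: "(2 * d + (2 - j mod 2) - 1) div 2 = d" "even (2 * d + (2 - j mod 2)) = even (j :: nat)"
proof -
  have "j mod 2 = 0 \<or> j mod 2 = 1" by presburger
  then show "(2 * d + (2 - j mod 2) - 1) div 2 = d" by auto
  show "even (2 * d + (2 - j mod 2)) = even j" by presburger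
qed

lemma lin_low_wt: "lin s (low_wt j * monom 1 i) = s (i + j mod 2)"
proof (cases "even j")
  case True
  then have "j mod 2 = 0" by presburger
  then show ?thesis using True by (simp add: low_wt_def lin_monom)
next
  case False
  then have "j mod 2 = 1" by presburger
  then show ?thesis using False by (simp add: low_wt_def lin_monom flip: monom_Suc)
qed

lemma lin_up_wt: "lin s (up_wt j * monom 1 i) = s (i + (1 - j mod 2)) - s (i + (2 - j mod 2))"
proof (cases "even j")
  case True
  have "up_wt j * monom 1 i = monom 1 (i + 1) - monom 1 (i + 2)"
    using True by (simp add: up_wt_def monom_Suc)
  moreover have "j mod 2 = 0" using True by presburger
  ultimately show ?thesis by (simp add: lin_diff lin_monom)
next
  case False
  have "up_wt j * monom 1 i = monom 1 i - monom 1 (i + 1)"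
    using False by (simp add: up_wt_def monom_Suc)
  moreover have "j mod 2 = 1" using False by presburger
  ultimately show ?thesis by (simp add: lin_diff lin_monom)
qed

section \<open>One step of the recursion, at a fixed index j\<close>

context
  fixes p :: nat and F :: "'h filter" and \<eta> :: "'h \<Rightarrow> real" and S :: "'h \<Rightarrow> nat \<Rightarrow> real mat" and j :: nat
  assumes \<eta>: "(\<eta> \<longlongrightarrow> 0) F" and j: "j \<ge> 1"
    and S0: "\<And>h. S h 0 = 1\<^sub>m p" and car: "\<And>h i. S h i \<in> carrier_mat p p"
    and sym: "\<And>i. i < j \<Longrightarrow> \<forall>\<^sub>F h in F. sym_mat p (S h i)"
    and close: "\<And>i a b. i < j \<Longrightarrow> a < p \<Longrightarrow> b < p \<Longrightarrow>
      (\<lambda>h. S h i $$ (a, b) - (if a = b then arcsine_moment i else 0)) \<in> O[F](\<eta>)"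
begin

lemma sym_all: "\<forall>\<^sub>F h in F. \<forall>i<j. sym_mat p (S h i)"
proof -
  have "\<forall>\<^sub>F h in F. \<forall>i\<in>{..<j}. sym_mat p (S h i)"
    by (rule eventually_ball_finite) (use sym in auto)
  then show ?thesis by (rule eventually_mono) auto
qed

text \<open>Since 2 / 4^j (1 + T_j) is monic of degree j, S_j drops out of the approximation, in
  accordance with hypotheses that control only the moments below j.\<close>

lemma Smin_expansion:
  shows "\<forall>\<^sub>F h in F. sym_mat p (Smin p (S h) j)"
    and "a < p \<Longrightarrow> b < p \<Longrightarrow> (\<lambda>h. Smin p (S h) j $$ (a, b) - (S h j $$ (a, b) -
      lin (\<lambda>l. S h l $$ (a, b)) (smult (2 / 4 ^ j) (1 + cheb_T j)))) \<in> O[F](\<lambda>h. (\<eta> h)\<^sup>2)"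
proof -
  define m r where "m = j div 2" and "r = j mod 2"
  define t where "t i = arcsine_moment (i + r)" for i
  have jr: "2 * m + r = j" by (simp add: m_def r_def)
  have t: "t = (\<lambda>i. lin arcsine_moment (low_wt j * monom 1 i))" by (rule ext) (simp only: t_def lin_low_wt r_def)
  have t': "lin t f = lin arcsine_moment (low_wt j * f)" for f unfolding t by (rule lin_seq_mult)
  have dv: "(2 * d + r) div 2 = d" for d unfolding r_def by (rule lower_mod)
  have wt: "low_wt (2 * d + r) = low_wt j" for d by (simp add: low_wt_def r_def)
  have "\<exists>g. is_inv m (mat m m (\<lambda>(i, k). t (i + k))) g"
  proof (rule scalar_hankel_inv[where P = "\<lambda>d. low_poly (2 * d + r)"])
    fix d
    show "degree (low_poly (2 * d + r)) = d \<and> lead_coeff (low_poly (2 * d + r)) = 1"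
      using low_poly_monic[of "2 * d + r"] unfolding r_def lower_mod .
    show "lin t (low_poly (2 * d + r) * low_poly (2 * d + r)) \<noteq> 0"
      using low_poly_norm[of "2 * d + r"] by (simp add: t' wt)
    fix i assume "i < d"
    then show "lin t (low_poly (2 * d + r) * monom 1 i) = 0"
      using low_poly_orth[of i "2 * d + r"] unfolding t' wt dv by (simp add: mult.assoc)
  qed
  then obtain g where g: "is_inv m (mat m m (\<lambda>(i, k). t (i + k))) g" by blast
  have e: "Smin p (S h) j = schur p m (\<lambda>i. S h (i + r))" for h
    using Smin_schur[OF j] by (simp add: m_def r_def)
  have sym': "\<forall>\<^sub>F h in F. \<forall>i<2 * m. sym_mat p (S h (i + r))"
    using sym_all by eventually_elim (simp flip: jr)
  have close': "(\<lambda>h. S h (i + r) $$ (a, b) - (if a = b then t i else 0)) \<in> O[F](\<eta>)"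
    if "i < 2 * m" "a < p" "b < p" for i a b
    unfolding t_def by (rule close) (use that in \<open>simp_all flip: jr\<close>)
  have P: "degree (low_poly j) = m" "lead_coeff (low_poly j) = 1"
    using low_poly_monic[of j] unfolding m_def by metis+
  have orth: "lin t (low_poly j * monom 1 i) = 0" if "i < m" for i
    using low_poly_orth[of i j] that by (simp add: t' m_def mult.assoc)
  have ex1: "\<forall>\<^sub>F h in F. sym_mat p (schur p m (\<lambda>i. S h (i + r)))"
    by (rule schur_expansion(1)[OF \<eta> sym' close' P orth g])
  have ex2: "(\<lambda>h. schur p m (\<lambda>i. S h (i + r)) $$ (a, b) - (S h (2 * m + r) $$ (a, b) -
      lin (\<lambda>l. S h (l + r) $$ (a, b)) (low_poly j * low_poly j))) \<in> O[F](\<lambda>h. (\<eta> h)\<^sup>2)"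
    if "a < p" "b < p" for a b
    by (rule schur_expansion(2)[OF \<eta> sym' close' P orth g that])
  show "\<forall>\<^sub>F h in F. sym_mat p (Smin p (S h) j)" unfolding e by (rule ex1)
  have l: "lin (\<lambda>l. S h (l + r) $$ (a, b)) (low_poly j * low_poly j) =
      lin (\<lambda>l. S h l $$ (a, b)) (smult (2 / 4 ^ j) (1 + cheb_T j))" for h a b
    using lin_seq_mult[of "\<lambda>l. S h l $$ (a, b)" "low_wt j" "low_poly j * low_poly j"]
    unfolding lin_low_wt low_poly_square[OF j] r_def .
  show "(\<lambda>h. Smin p (S h) j $$ (a, b) - (S h j $$ (a, b) -
      lin (\<lambda>l. S h l $$ (a, b)) (smult (2 / 4 ^ j) (1 + cheb_T j)))) \<in> O[F](\<lambda>h. (\<eta> h)\<^sup>2)"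
    if "a < p" "b < p"
    using ex2[OF that] unfolding e l jr .
qed

text \<open>The top block \<open>Dif h (2 * m)\<close> is S_(j-1) - S_j; subtracting the Schur
  complement from S_(j-1) leaves S_j plus the functional. As 2 / 4^j (1 - T_j) has leading
  coefficient -1, S_j drops out again.\<close>

lemma Splus_expansion:
  shows "\<forall>\<^sub>F h in F. sym_mat p (Splus p (S h) j)"
    and "a < p \<Longrightarrow> b < p \<Longrightarrow> (\<lambda>h. Splus p (S h) j $$ (a, b) - (S h j $$ (a, b) +
      lin (\<lambda>l. S h l $$ (a, b)) (smult (2 / 4 ^ j) (1 - cheb_T j)))) \<in> O[F](\<lambda>h. (\<eta> h)\<^sup>2)"
proof -
  define m r where "m = (j - 1) div 2" and "r = j mod 2"
  define t where "t i = arcsine_moment (i + (1 - r)) - arcsine_moment (i + (2 - r))" for i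
  have r: "r < 2" by (simp add: r_def)
  have jr: "2 * m + (2 - r) = j" using j unfolding m_def r_def by presburger
  then have jr1: "2 * m + (1 - r) = j - 1" using r by linarith
  have t: "t = (\<lambda>i. lin arcsine_moment (up_wt j * monom 1 i))" by (rule ext) (simp only: t_def lin_up_wt r_def)
  have t': "lin t f = lin arcsine_moment (up_wt j * f)" for f unfolding t by (rule lin_seq_mult)
  have ev: "even (2 * d + (2 - r)) = even j" for d unfolding r_def by (rule upper_mod)
  have dv: "(2 * d + (2 - r) - 1) div 2 = d" for d unfolding r_def by (rule upper_mod)
  have wt: "up_wt (2 * d + (2 - r)) = up_wt j" for d by (simp only: up_wt_def ev)
  define Dif where "Dif h i = S h (i + (1 - r)) - S h (i + (2 - r))" for h i
  have "\<exists>g. is_inv m (mat m m (\<lambda>(i, k). t (i + k))) g"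
  proof (rule scalar_hankel_inv[where P = "\<lambda>d. up_poly (2 * d + (2 - r))"])
    fix d
    show "degree (up_poly (2 * d + (2 - r))) = d \<and> lead_coeff (up_poly (2 * d + (2 - r))) = 1"
      using up_poly_monic[of "2 * d + (2 - r)"] unfolding dv .
    show "lin t (up_poly (2 * d + (2 - r)) * up_poly (2 * d + (2 - r))) \<noteq> 0"
      using up_poly_norm[of "2 * d + (2 - r)"] r unfolding t' wt by simp
    fix i assume "i < d"
    then show "lin t (up_poly (2 * d + (2 - r)) * monom 1 i) = 0"
      using up_poly_orth[of i "2 * d + (2 - r)"] unfolding t' wt dv by (simp add: mult.assoc)
  qed
  then obtain g where g: "is_inv m (mat m m (\<lambda>(i, k). t (i + k))) g" by blast
  have e: "Splus p (S h) j = S h (j - 1) - schur p m (Dif h)" for h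
    using Splus_schur[OF j, of "S h" p] S0 car unfolding m_def r_def Dif_def by simp
  have idx: "i + (1 - r) < j" "i + (2 - r) < j" if "i < 2 * m" for i
    using that jr by linarith+
  have sym': "\<forall>\<^sub>F h in F. \<forall>i<2 * m. sym_mat p (Dif h i)"
    using sym_all unfolding Dif_def by eventually_elim (use idx sym_mat_diff in blast)
  have Te: "Dif h i $$ (a, b) = S h (i + (1 - r)) $$ (a, b) - S h (i + (2 - r)) $$ (a, b)"
    if "a < p" "b < p" for h i a b
    using that carrier_matD[OF car] by (simp add: Dif_def)
  have close': "(\<lambda>h. Dif h i $$ (a, b) - (if a = b then t i else 0)) \<in> O[F](\<eta>)"
    if "i < 2 * m" "a < p" "b < p" for i a b
  proof -
    have "(\<lambda>h. (S h (i + (1 - r)) $$ (a, b) - (if a = b then arcsine_moment (i + (1 - r)) else 0)) -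
      (S h (i + (2 - r)) $$ (a, b) - (if a = b then arcsine_moment (i + (2 - r)) else 0))) \<in> O[F](\<eta>)"
      by (intro sum_in_bigo close idx that)
    moreover have "Dif h i $$ (a, b) - (if a = b then t i else 0) =
      (S h (i + (1 - r)) $$ (a, b) - (if a = b then arcsine_moment (i + (1 - r)) else 0)) -
      (S h (i + (2 - r)) $$ (a, b) - (if a = b then arcsine_moment (i + (2 - r)) else 0))" for h
      unfolding Te[OF that(2,3)] t_def by simp
    ultimately show ?thesis by simp
  qed
  have P: "degree (up_poly j) = m" "lead_coeff (up_poly j) = 1"
    using up_poly_monic[of j] unfolding m_def by metis+
  have orth: "lin t (up_poly j * monom 1 i) = 0" if "i < m" for i
    using up_poly_orth[of i j] that by (simp add: t' m_def mult.assoc)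
  have ex1: "\<forall>\<^sub>F h in F. sym_mat p (schur p m (Dif h))"
    by (rule schur_expansion(1)[OF \<eta> sym' close' P orth g])
  have ex2: "(\<lambda>h. schur p m (Dif h) $$ (a, b) - (Dif h (2 * m) $$ (a, b) -
      lin (\<lambda>l. Dif h l $$ (a, b)) (up_poly j * up_poly j))) \<in> O[F](\<lambda>h. (\<eta> h)\<^sup>2)"
    if "a < p" "b < p" for a b
    by (rule schur_expansion(2)[OF \<eta> sym' close' P orth g that])
  have "\<forall>\<^sub>F h in F. sym_mat p (S h (j - 1))" using sym[of "j - 1"] j by simp
  with ex1 show "\<forall>\<^sub>F h in F. sym_mat p (Splus p (S h) j)"
    unfolding e by eventually_elim (rule sym_mat_diff)
  show "(\<lambda>h. Splus p (S h) j $$ (a, b) - (S h j $$ (a, b) +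
      lin (\<lambda>l. S h l $$ (a, b)) (smult (2 / 4 ^ j) (1 - cheb_T j)))) \<in> O[F](\<lambda>h. (\<eta> h)\<^sup>2)"
    if ab: "a < p" "b < p"
  proof -
    have gen: "Splus p (S h) j $$ (a, b) - (S h j $$ (a, b) + x) =
        - (schur p m (Dif h) $$ (a, b) - (Dif h (2 * m) $$ (a, b) - x))" for h x
      unfolding e Te[OF ab] jr jr1 using ab carrier_matD[OF schur_carrier] by simp
    have l: "lin (\<lambda>l. Dif h l $$ (a, b)) (up_poly j * up_poly j) =
        lin (\<lambda>l. S h l $$ (a, b)) (smult (2 / 4 ^ j) (1 - cheb_T j))" for h
      using lin_seq_mult[of "\<lambda>l. S h l $$ (a, b)" "up_wt j" "up_poly j * up_poly j"]
      unfolding lin_up_wt up_poly_square[OF j] r_def[symmetric] Te[OF ab] .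
    have "Splus p (S h) j $$ (a, b) - (S h j $$ (a, b) + lin (\<lambda>l. S h l $$ (a, b)) (smult (2 / 4 ^ j) (1 - cheb_T j))) =
      - (schur p m (Dif h) $$ (a, b) - (Dif h (2 * m) $$ (a, b) - lin (\<lambda>l. Dif h l $$ (a, b)) (up_poly j * up_poly j)))" for h
      unfolding l by (rule gen)
    then show ?thesis
      using ex2[OF ab] by (simp only: landau_o.big.uminus_in_iff)
  qed
qed

lemma Smin_carrier: "Smin p (S h) j \<in> carrier_mat p p"
  using Smin_schur[OF j] by simp

text \<open>The hypothesis \<open>rec\<close> solves the definition of the canonical moment for the
  moment, S_j = S_j^- + R U_j R. Combined with the two expansions of the bounds it determines the
  functional of T_j.\<close>

lemma canonical_step:
  fixes U :: "'h \<Rightarrow> real mat"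
  assumes Uc: "\<And>h. U h \<in> carrier_mat p p"
    and U: "\<And>a b. a < p \<Longrightarrow> b < p \<Longrightarrow> (\<lambda>h. U h $$ (a, b) - (if a = b then 1/2 else 0)) \<in> O[F](\<eta>)"
    and rec: "\<And>h. S h j = (let R = msqrt p (Splus p (S h) j - Smin p (S h) j) in
      mat p p (\<lambda>x. (Smin p (S h) j + R * U h * R) $$ x))"
  shows "\<forall>\<^sub>F h in F. \<exists>R. posdef p R \<and> R * R = Splus p (S h) j - Smin p (S h) j \<and>
      S h j = Smin p (S h) j + R * U h * R"
    and "a < p \<Longrightarrow> b < p \<Longrightarrow> (\<lambda>h. 1/2 * lin (\<lambda>l. S h l $$ (a, b)) (cheb_T j) -
      (U h $$ (a, b) - (if a = b then 1/2 else 0))) \<in> O[F](\<lambda>h. (\<eta> h)\<^sup>2)"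
proof -
  \<comment> \<open>Chosen so that c^2 = 4 / 4^j is the limit of the range S_j^+ - S_j^-.\<close>
  define c :: real where "c = 2 / 2 ^ j"
  have c: "c > 0" and c2: "c\<^sup>2 = 4 / 4 ^ j"
    by (simp_all add: c_def power_divide) (simp add: power2_eq_square flip: power_mult_distrib)
  define D where "D h = Splus p (S h) j - Smin p (S h) j" for h
  define E where "E h = (1 / c\<^sup>2) \<cdot>\<^sub>m D h - 1\<^sub>m p" for h
  define X where "X h = U h - (1/2) \<cdot>\<^sub>m 1\<^sub>m p" for h
  define lo where "lo h a b = Smin p (S h) j $$ (a, b) - (S h j $$ (a, b) -
      lin (\<lambda>l. S h l $$ (a, b)) (smult (2 / 4 ^ j) (1 + cheb_T j)))" for h a b
  define up where "up h a b = Splus p (S h) j $$ (a, b) - (S h j $$ (a, b) +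
      lin (\<lambda>l. S h l $$ (a, b)) (smult (2 / 4 ^ j) (1 - cheb_T j)))" for h a b
  have lo: "(\<lambda>h. lo h a b) \<in> O[F](\<lambda>h. (\<eta> h)\<^sup>2)" and up: "(\<lambda>h. up h a b) \<in> O[F](\<lambda>h. (\<eta> h)\<^sup>2)"
    if "a < p" "b < p" for a b
    unfolding lo_def up_def by (rule Smin_expansion Splus_expansion; fact)+
  have Dc: "D h \<in> carrier_mat p p" for h unfolding D_def by (rule minus_carrier_mat[OF Smin_carrier])
  have De: "D h $$ (a, b) = Splus p (S h) j $$ (a, b) - Smin p (S h) j $$ (a, b)" if "a < p" "b < p" for h a b
    using that carrier_matD[OF Smin_carrier] by (simp add: D_def)
  have one: "lin (\<lambda>l. S h l $$ (a, b)) 1 = (if a = b then 1 else 0)" if "a < p" "b < p" for h a b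
    using lin_const[of "\<lambda>l. S h l $$ (a, b)" 1] that by (simp add: S0 one_pCons)
  \<comment> \<open>In the difference of the two expansions T_j cancels, and the functional of the
    remaining constant is fixed by S_0 = I. Hence E is O(\<eta>^2).\<close>
  have "E h $$ (a, b) = 4 ^ j / 4 * (up h a b - lo h a b)" if "a < p" "b < p" for h a b
  proof -
    have "D h $$ (a, b) = up h a b - lo h a b + 4 / 4 ^ j * (if a = b then 1 else 0)"
      unfolding De[OF that] lo_def up_def using one[OF that, of h]
      by (simp add: lin_smult lin_add lin_diff field_simps)
    then show ?thesis using that carrier_matD[OF Dc] by (simp add: E_def c2 field_simps)
  qed
  then have Ee: "(\<lambda>h. E h $$ (a, b)) \<in> O[F](\<lambda>h. (\<eta> h)\<^sup>2)" if "a < p" "b < p" for a b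
    using that by (simp only:) (intro cmult_bigo sum_in_bigo lo up that)
  have fE: "(\<lambda>h. frob (E h)) \<in> O[F](\<lambda>h. (\<eta> h)\<^sup>2)"
    by (rule frob_bigo[of _ p p]) (use Ee in \<open>simp_all add: E_def minus_carrier_mat\<close>)
  have fE1: "(\<lambda>h. frob (E h)) \<in> O[F](\<eta>)" by (rule bigo_square_imp[OF \<eta> fE])
  have fX: "(\<lambda>h. frob (X h)) \<in> O[F](\<eta>)"
  proof (rule frob_bigo[of _ p p])
    fix a b assume ab: "a < p" "b < p"
    have "X h $$ (a, b) = U h $$ (a, b) - (if a = b then 1/2 else 0)" for h
      using ab Uc[of h] by (simp add: X_def)
    then show "(\<lambda>h. X h $$ (a, b)) \<in> O[F](\<eta>)" using U[OF ab] by simp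
  qed (simp add: X_def minus_carrier_mat)
  have "\<forall>\<^sub>F h in F. frob (E h) < 1/4"
    by (rule order_tendstoD(2)[OF bigo_tendsto_0[OF fE1 \<eta>]]) simp
  moreover have "\<forall>\<^sub>F h in F. sym_mat p (D h)"
    using Smin_expansion(1) Splus_expansion(1) unfolding D_def by eventually_elim (rule sym_mat_diff)
  ultimately have main: "\<forall>\<^sub>F h in F. \<exists>R. posdef p R \<and> R * R = D h \<and> S h j = Smin p (S h) j + R * U h * R \<and>
      (\<forall>a<p. \<forall>b<p. \<bar>(R * U h * R) $$ (a, b) - (1/2 * D h $$ (a, b) + c\<^sup>2 * X h $$ (a, b))\<bar>
        \<le> 3 * c\<^sup>2 * (frob (E h) * frob (X h)))"
  proof eventually_elim
    case (elim h)
    then obtain R where R: "posdef p R" "R * R = D h"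
      "\<forall>a<p. \<forall>b<p. \<bar>(R * U h * R) $$ (a, b) - (1/2 * D h $$ (a, b) + c\<^sup>2 * X h $$ (a, b))\<bar>
        \<le> 3 * c\<^sup>2 * (frob (E h) * frob (X h))"
      using sqrt_conj[OF elim(2) Uc[of h] c] unfolding E_def X_def by auto
    have Rc: "R \<in> carrier_mat p p" using R(1) by (simp add: posdef_def sym_mat_def)
    have "S h j = mat p p (\<lambda>x. (Smin p (S h) j + R * U h * R) $$ x)"
      using rec[of h] msqrt_eq[OF R(1,2)] by (simp add: D_def Let_def)
    also have "\<dots> = Smin p (S h) j + R * U h * R"
      using Rc by (intro eq_matI) auto
    finally show ?case using R by blast
  qed
  then show "\<forall>\<^sub>F h in F. \<exists>R. posdef p R \<and> R * R = Splus p (S h) j - Smin p (S h) j \<and>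
      S h j = Smin p (S h) j + R * U h * R"
    unfolding D_def by eventually_elim blast
  show "(\<lambda>h. 1/2 * lin (\<lambda>l. S h l $$ (a, b)) (cheb_T j) -
      (U h $$ (a, b) - (if a = b then 1/2 else 0))) \<in> O[F](\<lambda>h. (\<eta> h)\<^sup>2)"
    if ab: "a < p" "b < p"
  proof -
    define r where "r h = S h j $$ (a, b) - Smin p (S h) j $$ (a, b) - (1/2 * D h $$ (a, b) + c\<^sup>2 * X h $$ (a, b))" for h
    have "r \<in> O[F](\<lambda>h. frob (E h) * frob (X h))"
    proof (rule bigoI[of _ "3 * c\<^sup>2"])
      from main show "\<forall>\<^sub>F h in F. norm (r h) \<le> 3 * c\<^sup>2 * norm (frob (E h) * frob (X h))"
      proof eventually_elim
        case (elim h)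
        then obtain R where R: "posdef p R" "S h j = Smin p (S h) j + R * U h * R"
          and b: "\<bar>(R * U h * R) $$ (a, b) - (1/2 * D h $$ (a, b) + c\<^sup>2 * X h $$ (a, b))\<bar>
            \<le> 3 * c\<^sup>2 * (frob (E h) * frob (X h))" using ab by blast
        have Rc: "R \<in> carrier_mat p p" using R(1) by (simp add: posdef_def sym_mat_def)
        have "S h j $$ (a, b) = Smin p (S h) j $$ (a, b) + (R * U h * R) $$ (a, b)"
          by (subst R(2), rule index_add_mat(1)) (use ab Rc in auto)
        then show ?case using b by (simp add: r_def)
      qed
    qed
    moreover have "(\<lambda>h. frob (E h) * frob (X h)) \<in> O[F](\<lambda>h. (\<eta> h)\<^sup>2)"
      unfolding power2_eq_square by (rule landau_o.big.mult[OF fE1 fX])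
    ultimately have r: "r \<in> O[F](\<lambda>h. (\<eta> h)\<^sup>2)" by (rule landau_o.big_trans)
    \<comment> \<open>Here S_j is measured from the midpoint S_j^- + D / 2 of its range: in the half
      sum of the two expansions the constant 1 cancels, and 2 / 4^j times the functional of T_j
      remains. The factor 4^j / 4 undoes c^2.\<close>
    have "1/2 * lin (\<lambda>l. S h l $$ (a, b)) (cheb_T j) - (U h $$ (a, b) - (if a = b then 1/2 else 0)) =
        4 ^ j / 4 * (r h + 1/2 * (lo h a b + up h a b))" for h
    proof -
      have X: "X h $$ (a, b) = U h $$ (a, b) - (if a = b then 1/2 else 0)"
        using ab Uc[of h] by (simp add: X_def)
      have "r h + 1/2 * (lo h a b + up h a b) =
          1/2 * (2 / 4 ^ j * (2 * lin (\<lambda>l. S h l $$ (a, b)) (cheb_T j))) - 4 / 4 ^ j * X h $$ (a, b)"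
        unfolding r_def De[OF ab] c2 lo_def up_def lin_smult lin_add lin_diff
        by (simp only: distrib_left right_diff_distrib)
      then show ?thesis unfolding X[symmetric] by (simp add: right_diff_distrib)
    qed
    then show ?thesis by (simp only:) (intro cmult_bigo sum_in_bigo r lo up ab)
  qed
qed

end

section \<open>Inversion of the canonical moment map\<close>

text \<open>The entry of A at row j and column l, counted from 1. Its 4 is a product of two factors
  2: one from \<open>monom_chebyshev\<close>, one from expanding in half the functional of
  T_l.\<close>

definition cheb_coef :: "nat \<Rightarrow> nat \<Rightarrow> real" where
  "cheb_coef j l = 4 * real ((2 * j) choose (j - l)) / 4 ^ j"

lemma moment_from_cheb:
  "s j = s 0 * arcsine_moment j + (\<Sum>l=1..j. cheb_coef j l * (1/2 * lin s (cheb_T l)))"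
proof -
  have "4 ^ j * s j = lin s (smult (4 ^ j) (monom 1 j))" by (simp add: lin_smult lin_monom)
  also have "\<dots> = real ((2 * j) choose j) * s 0 + 2 * (\<Sum>l=1..j. real ((2 * j) choose (j - l)) * lin s (cheb_T l))"
    unfolding monom_chebyshev by (simp add: lin_add lin_smult lin_sum lin_const)
  also have "\<dots> = 4 ^ j * (s 0 * arcsine_moment j + (\<Sum>l=1..j. cheb_coef j l * (1/2 * lin s (cheb_T l))))"
    unfolding distrib_left sum_distrib_left
    by (simp add: arcsine_moment_def cheb_coef_def field_simps sum_distrib_left)
  finally show ?thesis by simp
qed

section \<open>Induction over the indices\<close>

context
  fixes p k :: nat and F :: "'h filter" and \<eta> :: "'h \<Rightarrow> real" and S U :: "'h \<Rightarrow> nat \<Rightarrow> real mat"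
  assumes \<eta>: "(\<eta> \<longlongrightarrow> 0) F"
    and S0: "\<And>h. S h 0 = 1\<^sub>m p" and car: "\<And>h i. S h i \<in> carrier_mat p p"
    and Uc: "\<And>h l. U h l \<in> carrier_mat p p"
    and U: "\<And>l a b. 1 \<le> l \<Longrightarrow> l \<le> k \<Longrightarrow> a < p \<Longrightarrow> b < p \<Longrightarrow>
      (\<lambda>h. U h l $$ (a, b) - (if a = b then 1/2 else 0)) \<in> O[F](\<eta>)"
    and Upos: "\<And>l. 1 \<le> l \<Longrightarrow> l \<le> k \<Longrightarrow> \<forall>\<^sub>F h in F. posdef p (U h l)"
    and rec: "\<And>h j. 1 \<le> j \<Longrightarrow> j \<le> k \<Longrightarrow> S h j = (let R = msqrt p (Splus p (S h) j - Smin p (S h) j) in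
      mat p p (\<lambda>x. (Smin p (S h) j + R * U h j * R) $$ x))"
begin

text \<open>The three claims feed each other: symmetry and O(\<eta>) closeness below j give the
  expansions of the bounds, these give the second-order expansion at j, and that in turn gives
  closeness at j.\<close>

lemma moment_asymptotics:
  "j \<le> k \<Longrightarrow> (\<forall>\<^sub>F h in F. sym_mat p (S h j)) \<and>
    (\<forall>a<p. \<forall>b<p. (\<lambda>h. S h j $$ (a, b) - (if a = b then arcsine_moment j else 0)) \<in> O[F](\<eta>)) \<and>
    (\<forall>a<p. \<forall>b<p. (\<lambda>h. S h j $$ (a, b) - (if a = b then arcsine_moment j else 0) -
      (\<Sum>l=1..j. cheb_coef j l * (U h l $$ (a, b) - (if a = b then 1/2 else 0)))) \<in> O[F](\<lambda>h. (\<eta> h)\<^sup>2))"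
proof (induction j rule: less_induct)
  case (less j)
  have sym: "\<forall>\<^sub>F h in F. sym_mat p (S h i)" if "i < j" for i
    using less.IH[OF that] that less.prems by simp
  have close: "(\<lambda>h. S h i $$ (a, b) - (if a = b then arcsine_moment i else 0)) \<in> O[F](\<eta>)"
    if "i < j" "a < p" "b < p" for i a b
    using less.IH[OF that(1)] that less.prems by simp
  \<comment> \<open>At index l the step uses only moments below l, so l = j is covered although
    nothing is yet known about S_j.\<close>
  have cheb: "(\<lambda>h. 1/2 * lin (\<lambda>l. S h l $$ (a, b)) (cheb_T l) -
      (U h l $$ (a, b) - (if a = b then 1/2 else 0))) \<in> O[F](\<lambda>h. (\<eta> h)\<^sup>2)"
    if l: "l \<in> {1..j}" and ab: "a < p" "b < p" for l a b
  proof (rule canonical_step(2)[where S = S and U = "\<lambda>h. U h l"])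
    show "1 \<le> l" using l by simp
    show "S h l = (let R = msqrt p (Splus p (S h) l - Smin p (S h) l) in
      mat p p (\<lambda>x. (Smin p (S h) l + R * U h l * R) $$ x))" for h
      by (rule rec) (use l less.prems in auto)
  qed (use l less.prems ab \<eta> S0 car sym close Uc U in auto)
  have exp: "(\<lambda>h. S h j $$ (a, b) - (if a = b then arcsine_moment j else 0) -
      (\<Sum>l=1..j. cheb_coef j l * (U h l $$ (a, b) - (if a = b then 1/2 else 0)))) \<in> O[F](\<lambda>h. (\<eta> h)\<^sup>2)"
    if ab: "a < p" "b < p" for a b
  proof -
    have "S h j $$ (a, b) - (if a = b then arcsine_moment j else 0) -
        (\<Sum>l=1..j. cheb_coef j l * (U h l $$ (a, b) - (if a = b then 1/2 else 0))) =
      (\<Sum>l=1..j. cheb_coef j l * (1/2 * lin (\<lambda>l. S h l $$ (a, b)) (cheb_T l) -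
        (U h l $$ (a, b) - (if a = b then 1/2 else 0))))" for h
      using moment_from_cheb[of "\<lambda>l. S h l $$ (a, b)" j] ab
      by (simp add: S0 right_diff_distrib sum_subtractf)
    then show ?thesis by (simp only:) (intro big_sum_in_bigo cmult_bigo cheb ab)
  qed
  moreover have "(\<lambda>h. S h j $$ (a, b) - (if a = b then arcsine_moment j else 0)) \<in> O[F](\<eta>)"
    if ab: "a < p" "b < p" for a b
  proof -
    have "(\<lambda>h. (S h j $$ (a, b) - (if a = b then arcsine_moment j else 0) -
        (\<Sum>l=1..j. cheb_coef j l * (U h l $$ (a, b) - (if a = b then 1/2 else 0)))) +
        (\<Sum>l=1..j. cheb_coef j l * (U h l $$ (a, b) - (if a = b then 1/2 else 0)))) \<in> O[F](\<eta>)"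
      by (intro sum_in_bigo(1) bigo_square_imp[OF \<eta> exp[OF ab]] big_sum_in_bigo cmult_bigo U ab)
        (use less.prems in auto)
    then show ?thesis by simp
  qed
  moreover have "\<forall>\<^sub>F h in F. sym_mat p (S h j)"
  proof (cases "j = 0")
    case True
    then show ?thesis by (simp add: S0 sym_mat_one)
  next
    case False
    then have j: "1 \<le> j" by simp
    have "\<forall>\<^sub>F h in F. sym_mat p (Smin p (S h) j)"
      by (rule Smin_expansion(1)[OF \<eta> j S0 car sym close])
    moreover have "\<forall>\<^sub>F h in F. \<exists>R. posdef p R \<and> R * R = Splus p (S h) j - Smin p (S h) j \<and>
        S h j = Smin p (S h) j + R * U h j * R"
      by (rule canonical_step(1)[OF \<eta> j S0 car sym close Uc U[OF j less.prems] rec[OF j less.prems]])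
    ultimately show ?thesis using Upos[OF j less.prems]
    proof eventually_elim
      case (elim h)
      then obtain R where "posdef p R" "S h j = Smin p (S h) j + R * U h j * R" by blast
      then show ?case using elim posdef_congr[of p "U h j" R] sym_mat_add[of p "Smin p (S h) j"]
        by (metis posdef_def)
    qed
  qed
  ultimately show ?case by blast
qed

lemma canonical_structure:
  "\<forall>\<^sub>F h in F. \<forall>j\<in>{1..k}. sym_mat p (Smin p (S h) j) \<and> sym_mat p (Splus p (S h) j) \<and>
    (\<exists>R. posdef p R \<and> R * R = Splus p (S h) j - Smin p (S h) j \<and> S h j = Smin p (S h) j + R * U h j * R)"
proof (rule eventually_ball_finite, simp, rule ballI)
  fix j assume "j \<in> {1..k}"
  then have j: "1 \<le> j" "j \<le> k" by auto
  have sym: "\<forall>\<^sub>F h in F. sym_mat p (S h i)" if "i < j" for i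
    using moment_asymptotics[of i] that j by simp
  have close: "(\<lambda>h. S h i $$ (a, b) - (if a = b then arcsine_moment i else 0)) \<in> O[F](\<eta>)"
    if "i < j" "a < p" "b < p" for i a b
    using moment_asymptotics[of i] that j by simp
  have 1: "\<forall>\<^sub>F h in F. sym_mat p (Smin p (S h) j)"
    by (rule Smin_expansion(1)[OF \<eta> j(1) S0 car sym close])
  have 2: "\<forall>\<^sub>F h in F. sym_mat p (Splus p (S h) j)"
    by (rule Splus_expansion(1)[OF \<eta> j(1) S0 car sym close])
  have 3: "\<forall>\<^sub>F h in F. \<exists>R. posdef p R \<and> R * R = Splus p (S h) j - Smin p (S h) j \<and>
      S h j = Smin p (S h) j + R * U h j * R"
    by (rule canonical_step(1)[OF \<eta> j(1) S0 car sym close Uc U[OF j] rec[OF j]])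
  from 1 2 3 show "\<forall>\<^sub>F h in F. sym_mat p (Smin p (S h) j) \<and> sym_mat p (Splus p (S h) j) \<and>
    (\<exists>R. posdef p R \<and> R * R = Splus p (S h) j - Smin p (S h) j \<and> S h j = Smin p (S h) j + R * U h j * R)"
    by eventually_elim blast
qed

end

text \<open>Each new moment needs the whole prefix, so the recursion carries a table. The wrapper
  \<open>mat p p\<close> fixes the size even where the range has no positive definite square root
  and \<open>msqrt\<close> is an arbitrary matrix.\<close>

primrec moment_table :: "nat \<Rightarrow> (nat \<Rightarrow> real mat) \<Rightarrow> nat \<Rightarrow> nat \<Rightarrow> real mat" where
  "moment_table p U 0 = (\<lambda>i. 1\<^sub>m p)"
| "moment_table p U (Suc n) = (moment_table p U n) (Suc n :=
    (let S = moment_table p U n; R = msqrt p (Splus p S (Suc n) - Smin p S (Suc n))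
     in mat p p (\<lambda>x. (Smin p S (Suc n) + R * U (Suc n) * R) $$ x)))"

definition moments :: "nat \<Rightarrow> (nat \<Rightarrow> real mat) \<Rightarrow> nat \<Rightarrow> real mat" where
  "moments p U j = moment_table p U j j"

lemma moment_table_eq: "i \<le> n \<Longrightarrow> moment_table p U n i = moments p U i"
  by (induction n) (auto simp: moments_def le_Suc_eq)

lemma moments_0: "moments p U 0 = 1\<^sub>m p"
  by (simp add: moments_def)

lemma moment_table_carrier: "moment_table p U n i \<in> carrier_mat p p"
  by (induction n) (auto simp: Let_def)

lemma moments_carrier: "moments p U i \<in> carrier_mat p p"
  unfolding moments_def by (rule moment_table_carrier)

lemma moments_rec:
  assumes "1 \<le> j"
  shows "moments p U j = (let R = msqrt p (Splus p (moments p U) j - Smin p (moments p U) j) in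
      mat p p (\<lambda>x. (Smin p (moments p U) j + R * U j * R) $$ x))"
proof -
  obtain n where j: "j = Suc n" using assms by (cases j) auto
  have "Smin p (moment_table p U n) j = Smin p (moments p U) j"
    by (rule Smin_cong) (simp add: j moment_table_eq)
  moreover have "Splus p (moment_table p U n) j = Splus p (moments p U) j"
    by (rule Splus_cong[OF assms])
      (simp_all add: j moment_table_eq moment_table_carrier moments_carrier moments_0)
  ultimately show ?thesis
    unfolding moments_def[of p U j] by (simp add: j Let_def)
qed

section \<open>The inverse map at a point of the unit box\<close>

lemma blk_carrier [simp]: "blk p V j \<in> carrier_mat p p"
  by (simp add: blk_def)

lemma blk_entry: "a < p \<Longrightarrow> b < p \<Longrightarrow> blk p V j $$ (a, b) = V $$ ((j - 1) * p + a, b)"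
  by (simp add: blk_def)

lemma blk_blockmat:
  assumes "1 \<le> j" "j \<le> k" "\<And>i. G i \<in> carrier_mat p p"
  shows "blk p (blockmat p k 1 (\<lambda>i _. G (i + 1))) j = G j"
proof (rule eq_matI)
  fix a b assume "a < dim_row (G j)" "b < dim_col (G j)"
  then have ab: "a < p" "b < p" using assms(3)[of j] by auto
  have "blk p (blockmat p k 1 (\<lambda>i _. G (i + 1))) j $$ (a, b) = G (j - 1 + 1) $$ (a, b)"
    unfolding blk_entry[OF ab] by (rule blockmat_col_entry) (use ab assms in auto)
  then show "blk p (blockmat p k 1 (\<lambda>i _. G (i + 1))) j $$ (a, b) = G j $$ (a, b)"
    using assms(1) by simp
qed (use assms(3)[of j] in \<open>auto simp: blk_def\<close>)

lemma block_col_eqI: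
  assumes "V \<in> carrier_mat (k * p) p" "W \<in> carrier_mat (k * p) p"
    and "\<And>j. 1 \<le> j \<Longrightarrow> j \<le> k \<Longrightarrow> blk p V j = blk p W j"
  shows "V = W"
proof (rule eq_matI)
  fix x b assume "x < dim_row W" "b < dim_col W"
  then have x: "x < k * p" and b: "b < p" using assms by auto
  obtain i a where i: "i < k" "a < p" "x = i * p + a" using block_index_cases[OF x] .
  have "blk p V (i + 1) $$ (a, b) = blk p W (i + 1) $$ (a, b)" using assms(3)[of "i + 1"] i by simp
  then show "V $$ (x, b) = W $$ (x, b)" using i b by (simp add: blk_entry)
qed (use assms in auto)

lemma posdef_diff_zero: "X \<in> carrier_mat p p \<Longrightarrow> X - 0\<^sub>m p p = (X :: real mat)"
  by (intro eq_matI) auto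

lemma unitboxD:
  assumes "U \<in> unitbox p k" "1 \<le> j" "j \<le> k"
  shows "posdef p (blk p U j)" "posdef p (1\<^sub>m p - blk p U j)"
proof -
  have "loew_less p (0\<^sub>m p p) (blk p U j) \<and> loew_less p (blk p U j) (1\<^sub>m p)"
    using assms by (simp add: unitbox_def)
  then show "posdef p (blk p U j)" "posdef p (1\<^sub>m p - blk p U j)"
    using posdef_diff_zero[of "blk p U j" p] by (auto simp: loew_less_def)
qed

lemma mat_add_diff_cancel:
  "X \<in> carrier_mat r c \<Longrightarrow> Y \<in> carrier_mat r c \<Longrightarrow> X + Y - X = (Y :: real mat)"
  by (intro eq_matI) auto

text \<open>The definite description asks for existence and uniqueness of the preimage of this one
  point. Any preimage in the moment space agrees with S index by index: equal moments below j give
  equal bounds, hence the same root R, and then the j-th canonical moment determines S_j.\<close>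

lemma phi_inv_eq:
  assumes Ub: "Um \<in> unitbox p k" and S0: "S 0 = 1\<^sub>m p" and car: "\<And>i. S i \<in> carrier_mat p p"
    and str: "\<And>j. 1 \<le> j \<Longrightarrow> j \<le> k \<Longrightarrow> sym_mat p (Smin p S j) \<and> sym_mat p (Splus p S j) \<and>
      (\<exists>R. posdef p R \<and> R * R = Splus p S j - Smin p S j \<and> S j = Smin p S j + R * blk p Um j * R)"
  shows "phi_inv p k Um = blockmat p k 1 (\<lambda>i _. S (i + 1))"
proof -
  define V where "V = blockmat p k 1 (\<lambda>i _. S (i + 1))"
  have Vc: "V \<in> carrier_mat (k * p) p" unfolding V_def using blockmat_carrier[of p k 1] by simp
  have Umc: "Um \<in> carrier_mat (k * p) p" using Ub by (simp add: unitbox_def symcols_def)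
  have mV: "mseq p V j = S j" if "j \<le> k" for j
    using that S0 blk_blockmat[of j k S p, OF _ that car] by (cases "j = 0") (simp_all add: mseq_def V_def)
  have mc: "mseq p W j \<in> carrier_mat p p" for W j by (simp add: mseq_def)
  \<comment> \<open>Once the moments below j agree, conjugation by R and by its inverse undo each
    other. One direction shows that V is mapped to \<open>Um\<close>, the other that every preimage
    coincides with V.\<close>
  have inverse: "canmom p W j = blk p Um j \<longleftrightarrow> mseq p W j = S j"
    if j: "1 \<le> j" "j \<le> k" and agree: "\<And>i. i < j \<Longrightarrow> mseq p W i = S i" for W j
  proof -
    obtain R where R: "posdef p R" "R * R = Splus p S j - Smin p S j" "S j = Smin p S j + R * blk p Um j * R"
      using str[OF j] by blast
    obtain B where B: "is_inv p R B" using posdef_inv[OF R(1)] by blast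
    have [simp]: "R \<in> carrier_mat p p" "B \<in> carrier_mat p p" "B * R = 1\<^sub>m p" "R * B = 1\<^sub>m p"
      using R(1) B by (auto simp: posdef_def sym_mat_def is_inv_def)
    note [simp] = mult_carrier_mat[of _ p p _ p]
    have Smc [simp]: "Smin p S j \<in> carrier_mat p p" using str[OF j] sym_mat_carrier by blast
    have lo: "Smin p (mseq p W) j = Smin p S j" by (rule Smin_cong) (rule agree)
    have up: "Splus p (mseq p W) j = Splus p S j"
      by (rule Splus_cong[OF j(1) agree]) (simp_all add: S0 car mc, simp add: mseq_def)
    define X where "X = mseq p W j - Smin p S j"
    have Xc [simp]: "X \<in> carrier_mat p p" unfolding X_def by (rule minus_carrier_mat) simp
    have mX: "mseq p W j = Smin p S j + X"
      using mc[of W j] by (intro eq_matI) (auto simp: X_def carrier_matD[OF Smc])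
    have can: "canmom p W j = B * X * B"
      unfolding canmom_def Let_def lo up R(2)[symmetric] msqrt_eq[OF R(1) refl] X_def[symmetric]
      by (simp add: minv_eq[OF _ B])
    have cancel: "P * (Q * Y * Q) * P = Y"
      if "P \<in> carrier_mat p p" "Q \<in> carrier_mat p p" "Y \<in> carrier_mat p p" "P * Q = 1\<^sub>m p" "Q * P = 1\<^sub>m p" for P Q Y :: "real mat"
    proof -
      have "P * (Q * Y * Q) * P = (P * Q) * Y * (Q * P)"
        using that(1-3) by (simp add: assoc_mult_mat[of _ p p _ p _ p])
      then show ?thesis using that left_mult_one_mat[of Y p p] right_mult_one_mat[of Y p p] by simp
    qed
    have "canmom p W j = blk p Um j \<longleftrightarrow> X = R * blk p Um j * R"
      unfolding can using cancel[of R B X] cancel[of B R "blk p Um j"] by auto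
    also have "\<dots> \<longleftrightarrow> mseq p W j = S j"
    proof
      assume "mseq p W j = S j"
      then have "X = (Smin p S j + R * blk p Um j * R) - Smin p S j" unfolding X_def R(3)[symmetric] by simp
      then show "X = R * blk p Um j * R"
        using mat_add_diff_cancel[of "Smin p S j" p p "R * blk p Um j * R"] by simp
    next
      assume "X = R * blk p Um j * R"
      then show "mseq p W j = S j" unfolding mX R(3) by simp
    qed
    finally show ?thesis .
  qed
  \<comment> \<open>The blocks of \<open>phi p k W\<close> record only the p x p entries of a
    canonical moment. Its size has to be known before an equality of blocks becomes an equality of
    matrices.\<close>
  have cc: "canmom p W j \<in> carrier_mat p p" if j: "1 \<le> j" "j \<le> k"
    and agree: "\<And>i. i < j \<Longrightarrow> mseq p W i = S i" for W j
  proof -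
    obtain R where R: "posdef p R" "R * R = Splus p S j - Smin p S j"
      using str[OF j] by blast
    obtain B where B: "is_inv p R B" using posdef_inv[OF R(1)] by blast
    have Rc: "R \<in> carrier_mat p p" using R(1) by (simp add: posdef_def sym_mat_def)
    have lo: "Smin p (mseq p W) j = Smin p S j" by (rule Smin_cong) (rule agree)
    have up: "Splus p (mseq p W) j = Splus p S j"
      by (rule Splus_cong[OF j(1) agree]) (simp_all add: S0 car mc, simp add: mseq_def)
    show ?thesis
      unfolding canmom_def Let_def lo up R(2)[symmetric] msqrt_eq[OF R(1) refl] minv_eq[OF Rc B]
      using B by (auto simp: is_inv_def)
  qed
  have phic: "phi p k W \<in> carrier_mat (k * p) p" for W
    unfolding phi_def using blockmat_carrier[of p k 1] by simp
  have blk_phi: "blk p (phi p k W) j $$ (a, b) = canmom p W j $$ (a, b)"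
    if "1 \<le> j" "j \<le> k" "a < p" "b < p" for W j a b
  proof -
    have "blk p (phi p k W) j $$ (a, b) = canmom p W (j - 1 + 1) $$ (a, b)"
      unfolding blk_entry[OF that(3,4)] phi_def by (rule blockmat_col_entry) (use that in auto)
    then show ?thesis using that by simp
  qed
  have phiV: "phi p k V = Um"
  proof (rule block_col_eqI[OF phic Umc])
    fix j assume j: "1 \<le> j" "j \<le> k"
    have "canmom p V j = blk p Um j"
      by (subst inverse[OF j]) (use j mV in auto)
    then show "blk p (phi p k V) j = blk p Um j"
      using blk_phi[OF j] by (intro eq_matI) (auto simp: blk_def)
  qed
  have uniq: "W = V" if W: "W \<in> IntM p k" "phi p k W = Um" for W
  proof (rule block_col_eqI)
    show "W \<in> carrier_mat (k * p) p" using W by (simp add: IntM_def symcols_def)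
    show "V \<in> carrier_mat (k * p) p" by (rule Vc)
    have "j \<le> k \<Longrightarrow> mseq p W j = S j" for j
    proof (induction j rule: less_induct)
      case (less j)
      show ?case
      proof (cases "j = 0")
        case False
        then have j: "1 \<le> j" "j \<le> k" using less.prems by auto
        have agree: "mseq p W i = S i" if "i < j" for i using less.IH[OF that] that j by simp
        have "canmom p W j \<in> carrier_mat p p"
          by (rule cc[OF j agree])
        then have "canmom p W j = blk p Um j"
          using blk_phi[OF j, of _ _ W] unfolding W(2) by (intro eq_matI) (auto simp: blk_def)
        then show ?thesis using inverse[OF j agree] by simp
      qed (simp add: mseq_def S0)
    qed
    then show "blk p W j = blk p V j" if "1 \<le> j" "j \<le> k" for j
      using that mV[of j] by (metis mseq_def not_one_le_zero)
  qed
  have VI: "V \<in> IntM p k"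
    unfolding IntM_def symcols_def
  proof (intro CollectI conjI ballI)
    show "V \<in> carrier_mat (k * p) p" by (rule Vc)
    fix j assume "j \<in> {1..k}"
    then have j: "1 \<le> j" "j \<le> k" by auto
    obtain R where R: "posdef p R" "R * R = Splus p S j - Smin p S j" "S j = Smin p S j + R * blk p Um j * R"
      using str[OF j] by blast
    have sm: "sym_mat p (Smin p S j)" and sp: "sym_mat p (Splus p S j)" using str[OF j] by auto
    have [simp]: "R \<in> carrier_mat p p" "Smin p S j \<in> carrier_mat p p" "Splus p S j \<in> carrier_mat p p"
      using R(1) sym_mat_carrier[OF sm] sym_mat_carrier[OF sp] by (auto simp: posdef_def sym_mat_def)
    note [simp] = mult_carrier_mat[of _ p p _ p]
    define X where "X = R * blk p Um j * R"
    have X: "posdef p X" unfolding X_def by (rule posdef_congr[OF unitboxD(1)[OF Ub j] R(1)])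
    have Xc: "X \<in> carrier_mat p p" by (simp add: X_def)
    have S: "S j = Smin p S j + X" by (simp add: R(3)[symmetric] X_def)
    have sS: "sym_mat p (S j)" unfolding S using X sm by (intro sym_mat_add) (auto simp: posdef_def)
    have "mseq p V j = blk p V j" using j by (simp add: mseq_def)
    then show "sym_mat p (blk p V j)" using sS mV[OF j(2)] by simp
    have lo: "Smin p (mseq p V) j = Smin p S j" by (rule Smin_cong) (use mV j in auto)
    have up: "Splus p (mseq p V) j = Splus p S j"
      by (rule Splus_cong[OF j(1)]) (use mV j S0 car mc in auto)
    have "S j - Smin p S j = X"
      using Xc by (subst S) (intro eq_matI, auto simp: carrier_matD[of "Smin p S j" p p])
    then show "loew_less p (Smin p (mseq p V) j) (mseq p V j)"
      unfolding lo mV[OF j(2)] loew_less_def using sm sS X by simp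
    \<comment> \<open>The range is R R, so the distance to the upper bound is R (1 - U_j) R, and U_j
      < I yields the upper Loewner inequality.\<close>
    have "Splus p S j - S j = R * R - X"
      unfolding R(2) using Xc by (subst S) (intro eq_matI, auto simp: carrier_matD[of "Smin p S j" p p])
    also have "\<dots> = R * (1\<^sub>m p - blk p Um j) * R"
    proof -
      have "R * (1\<^sub>m p - blk p Um j) = R - R * blk p Um j"
        by (simp add: mult_minus_distrib_mat[of _ p p _ p] right_mult_one_mat[of R p p])
      then show ?thesis by (simp add: X_def minus_mult_distrib_mat[of _ p p _ _ p])
    qed
    finally have "posdef p (Splus p S j - S j)"
      using posdef_congr[OF unitboxD(2)[OF Ub j] R(1)] by simp
    then show "loew_less p (mseq p V j) (Splus p (mseq p V) j)"
      unfolding up mV[OF j(2)] loew_less_def using sp sS by simp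
  qed
  show ?thesis
    unfolding phi_inv_def the_inv_into_def V_def[symmetric]
    by (rule the_equality) (use VI phiV uniq in blast)+
qed

section \<open>The centre, the matrix A and the derivative\<close>

lemma posdef_smult_one: "c > 0 \<Longrightarrow> posdef p (c \<cdot>\<^sub>m 1\<^sub>m p)"
  using posdef_perturb[of p "0\<^sub>m p p" c] by (simp add: sym_mat_def)

lemma posdef_sym: "posdef p X \<Longrightarrow> sym_mat p X"
  by (simp add: posdef_def)

lemma centre_unitbox: "blockmat p k 1 (\<lambda>_ _. (1/2) \<cdot>\<^sub>m 1\<^sub>m p) \<in> unitbox p k"
proof -
  define M :: "real mat" where "M = blockmat p k 1 (\<lambda>_ _. (1/2) \<cdot>\<^sub>m 1\<^sub>m p)"
  have b: "blk p M j = (1/2) \<cdot>\<^sub>m 1\<^sub>m p" if "1 \<le> j" "j \<le> k" for j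
    using blk_blockmat[of j k "\<lambda>_. (1/2) \<cdot>\<^sub>m 1\<^sub>m p" p] that by (simp add: M_def)
  have h: "posdef p ((1/2) \<cdot>\<^sub>m 1\<^sub>m p)" by (rule posdef_smult_one) simp
  have "1\<^sub>m p - (1/2) \<cdot>\<^sub>m 1\<^sub>m p = ((1/2) \<cdot>\<^sub>m 1\<^sub>m p :: real mat)" by (intro eq_matI) auto
  moreover have "(1/2) \<cdot>\<^sub>m 1\<^sub>m p - 0\<^sub>m p p = ((1/2) \<cdot>\<^sub>m 1\<^sub>m p :: real mat)" by (intro eq_matI) auto
  moreover have "sym_mat p (0\<^sub>m p p)" by (simp add: sym_mat_def)
  moreover have "M \<in> carrier_mat (k * p) p" unfolding M_def using blockmat_carrier[of p k 1] by simp
  ultimately show ?thesis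
    unfolding M_def[symmetric]
    using h posdef_sym[OF h] sym_mat_one[of p] by (simp add: unitbox_def symcols_def loew_less_def b)
qed

lemma Amat_entry:
  assumes "i < k" "j < k"
  shows "Amat k $$ (i, j) = (if j \<le> i then cheb_coef (i + 1) (j + 1) else 0)"
proof -
  have "- 2 * real (i + 1) + 2 = 2 - real (2 * (i + 1))" by simp
  then have "2 powr (- 2 * real (i + 1) + 2) = 2 powr 2 / (2::real) powr (real (2 * (i + 1)))"
    by (simp only: powr_diff)
  also have "\<dots> = 4 / 4 ^ (i + 1)"
    by (subst powr_realpow) (simp_all add: power_mult)
  finally show ?thesis using assms by (simp add: Amat_def cheb_coef_def)
qed

lemma kron_one_mult:
  assumes A: "A \<in> carrier_mat m n" and H: "H \<in> carrier_mat (n * p) c"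
    and i: "i < m" "a < p" and b: "b < c"
  shows "(kron A (1\<^sub>m p) * H) $$ (i * p + a, b) = (\<Sum>j<n. A $$ (i, j) * H $$ (j * p + a, b))"
proof -
  have K: "kron A (1\<^sub>m p) \<in> carrier_mat (m * p) (n * p)" using A by (simp add: kron_def)
  have "(kron A (1\<^sub>m p) * H) $$ (i * p + a, b) = (\<Sum>x<n*p. kron A (1\<^sub>m p) $$ (i * p + a, x) * H $$ (x, b))"
    by (rule mult_entry[OF K H block_index_less[OF i] b])
  also have "\<dots> = (\<Sum>j<n. \<Sum>d<p. if d = a then A $$ (i, j) * H $$ (j * p + d, b) else 0)"
    unfolding sum_blocks
  proof (intro sum.cong refl)
    fix j d assume "j \<in> {..<n}" "d \<in> {..<p}"
    then show "kron A (1\<^sub>m p) $$ (i * p + a, j * p + d) * H $$ (j * p + d, b) =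
        (if d = a then A $$ (i, j) * H $$ (j * p + d, b) else 0)"
      using A i by (simp add: kron_def block_index_less)
  qed
  finally show ?thesis using i by simp
qed

lemma Amat_kron_mult:
  assumes H: "H \<in> carrier_mat (k * p) p" and j: "1 \<le> j" "j \<le> k" and ab: "a < p" "b < p"
  shows "blk p (kron (Amat k) (1\<^sub>m p) * H) j $$ (a, b) = (\<Sum>l=1..j. cheb_coef j l * blk p H l $$ (a, b))"
proof -
  obtain i where i: "j = i + 1" "i < k" using j by (cases j) auto
  have "blk p (kron (Amat k) (1\<^sub>m p) * H) j $$ (a, b) = (\<Sum>l<k. Amat k $$ (i, l) * H $$ (l * p + a, b))"
    unfolding blk_entry[OF ab] using kron_one_mult[of "Amat k" k k H p p i a b] H i ab
    by (simp add: Amat_def)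
  also have "\<dots> = (\<Sum>l<k. if l \<le> i then cheb_coef j (l + 1) * H $$ (l * p + a, b) else 0)"
    by (rule sum.cong) (auto simp: Amat_entry i)
  also have "\<dots> = (\<Sum>l<j. cheb_coef j (l + 1) * H $$ (l * p + a, b))"
    by (rule sum.mono_neutral_cong_right) (use i in auto)
  also have "\<dots> = (\<Sum>l=1..j. cheb_coef j l * blk p H l $$ (a, b))"
    by (rule sum.reindex_bij_witness[of _ "\<lambda>l. l - 1" "\<lambda>l. l + 1"]) (auto simp: blk_entry ab)
  finally show ?thesis .
qed

theorem theorem4p5:
  fixes p k :: nat
  assumes "p \<ge> 1" and "k \<ge> 1"
  shows "matrix_diff_at p k k (unitbox p k) (phi_inv p k)
           (blockmat p k 1 (\<lambda>_ _. (1/2) \<cdot>\<^sub>m 1\<^sub>m p))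
           (kron (Amat k) (1\<^sub>m p))"
proof -
  define M where "M = blockmat p k 1 (\<lambda>_ _. (1/2) \<cdot>\<^sub>m (1\<^sub>m p :: real mat))"
  define L where "L = kron (Amat k) (1\<^sub>m p)"
  have Mc: "M \<in> carrier_mat (k * p) p" unfolding M_def using blockmat_carrier[of p k 1] by simp
  have Lc: "L \<in> carrier_mat (k * p) (k * p)" by (simp add: L_def kron_def Amat_def)
  define A where "A = {H \<in> symcols p k. M + H \<in> unitbox p k}"
  \<comment> \<open>The limit H -> 0 is taken through the norm: neighbourhoods of 0 are pulled back
    along \<open>frob\<close> and restricted to symmetric increments that stay in the unit box. H =
    0 itself is not removed.\<close>
  define F where "F = inf (filtercomap frob (nhds 0)) (principal A)"
  have FI: "\<exists>\<delta>>0. \<forall>H\<in>A. frob H < \<delta> \<longrightarrow> P H" if ev: "eventually P F" for P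
  proof -
    obtain Q where Q: "eventually Q (nhds 0)" "\<And>H. Q (frob H) \<Longrightarrow> H \<in> A \<longrightarrow> P H"
      using ev[unfolded F_def eventually_inf_principal eventually_filtercomap] by blast
    then obtain \<delta> where "\<delta> > 0" "\<And>x. dist x 0 < \<delta> \<Longrightarrow> Q x" unfolding eventually_nhds_metric by blast
    then show ?thesis using Q(2) by (intro exI[of _ \<delta>]) auto
  qed
  have inA: "\<forall>\<^sub>F H in F. H \<in> A" unfolding F_def eventually_inf_principal by simp
  have \<eta>: "(frob \<longlongrightarrow> 0) F"
    unfolding F_def by (rule tendsto_mono[OF inf_le1 filterlim_filtercomap])
  have Ac: "H \<in> carrier_mat (k * p) p" if "H \<in> A" for H using that by (simp add: A_def symcols_def)
  \<comment> \<open>Because 0 is admissible, the eventual statements hold at H = 0 as well, so the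
    value of \<open>phi_inv\<close> at the centre comes from the same argument as its values
    nearby.\<close>
  have zero: "0\<^sub>m (k * p) p \<in> A"
  proof -
    have "blk p (0\<^sub>m (k * p) p) j = 0\<^sub>m p p" if "1 \<le> j" "j \<le> k" for j
      using block_index_less[of "j - 1" k _ p] that by (intro eq_matI) (auto simp: blk_def)
    moreover have "M + 0\<^sub>m (k * p) p = M" using Mc by simp
    ultimately show ?thesis
      using centre_unitbox[of p k] by (simp add: A_def symcols_def sym_mat_def M_def)
  qed
  define U where "U H l = blk p (M + H) l" for H l
  define S where "S H = moments p (U H)" for H
  define \<Delta> where "\<Delta> H j a b = S H j $$ (a, b) - (if a = b then arcsine_moment j else 0) -
      (\<Sum>l=1..j. cheb_coef j l * (U H l $$ (a, b) - (if a = b then 1/2 else 0)))" for H j a b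
  define E where "E H = blockmat p k 1 (\<lambda>i _. mat p p (\<lambda>(a, b). \<Delta> H (i + 1) a b))" for H
  define V where "V H = blockmat p k 1 (\<lambda>i _. S H (i + 1))" for H
  have Vc: "V H \<in> carrier_mat (k * p) p" and Ec: "E H \<in> carrier_mat (k * p) p" for H
    unfolding V_def E_def using blockmat_carrier[of p k 1] by simp_all
  have Ue: "U H l $$ (a, b) - (if a = b then 1/2 else 0) = blk p H l $$ (a, b)"
    if "H \<in> A" "1 \<le> l" "l \<le> k" "a < p" "b < p" for H l a b
  proof -
    have "blk p M l = (1/2) \<cdot>\<^sub>m 1\<^sub>m p"
      using blk_blockmat[of l k "\<lambda>_. (1/2) \<cdot>\<^sub>m 1\<^sub>m p" p] that by (simp add: M_def)
    then have "blk p M l $$ (a, b) = (if a = b then 1/2 else 0)" using that by simp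
    then show ?thesis
      using that Ac[OF that(1)] Mc block_index_less[of "l - 1" k a p] by (simp add: U_def blk_entry)
  qed
  have Uo: "(\<lambda>H. U H l $$ (a, b) - (if a = b then 1/2 else 0)) \<in> O[F](frob)"
    if "1 \<le> l" "l \<le> k" "a < p" "b < p" for l a b
  proof (rule bigoI[of _ 1])
    from inA show "\<forall>\<^sub>F H in F. norm (U H l $$ (a, b) - (if a = b then 1/2 else 0)) \<le> 1 * norm (frob H)"
    proof eventually_elim
      case (elim H)
      have "\<bar>H $$ ((l - 1) * p + a, b)\<bar> \<le> frob H"
        by (rule frob_entry) (use Ac[OF elim] that block_index_less[of "l - 1" k a p] in auto)
      then show ?case unfolding Ue[OF elim that] by (simp add: blk_entry that)
    qed
  qed
  have Upos: "\<forall>\<^sub>F H in F. posdef p (U H l)" if "1 \<le> l" "l \<le> k" for l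
    using inA unfolding U_def by eventually_elim (rule unitboxD(1)[OF _ that], simp add: A_def)
  have S0: "S H 0 = 1\<^sub>m p" and Sc: "S H i \<in> carrier_mat p p" for H i
    unfolding S_def by (rule moments_0 moments_carrier)+
  have Uc: "U H l \<in> carrier_mat p p" for H l by (simp add: U_def)
  have rec: "S H j = (let R = msqrt p (Splus p (S H) j - Smin p (S H) j) in
      mat p p (\<lambda>x. (Smin p (S H) j + R * U H j * R) $$ x))" if "1 \<le> j" "j \<le> k" for H j
    unfolding S_def by (rule moments_rec[OF that(1)])
  have "\<forall>\<^sub>F H in F. \<forall>j\<in>{1..k}. sym_mat p (Smin p (S H) j) \<and> sym_mat p (Splus p (S H) j) \<and>
    (\<exists>R. posdef p R \<and> R * R = Splus p (S H) j - Smin p (S H) j \<and> S H j = Smin p (S H) j + R * U H j * R)"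
    by (rule canonical_structure[OF \<eta> S0 Sc Uc Uo Upos rec])
  with inA have phi: "\<forall>\<^sub>F H in F. phi_inv p k (M + H) = V H"
  proof eventually_elim
    case (elim H)
    show ?case unfolding V_def
      by (rule phi_inv_eq[where S = "S H", OF _ S0 Sc]) (use elim in \<open>auto simp: A_def U_def\<close>)
  qed
  have "(\<lambda>H. frob (E H)) \<in> O[F](\<lambda>H. (frob H)\<^sup>2)"
  proof (rule frob_bigo[OF Ec])
    fix x b assume "x < k * p" and b: "b < p"
    obtain i a where i: "i < k" "a < p" "x = i * p + a" using block_index_cases[OF \<open>x < k * p\<close>] .
    have "E H $$ (x, b) = \<Delta> H (i + 1) a b" for H
      unfolding E_def i(3) using i b by (subst blockmat_col_entry) auto
    moreover have "(\<lambda>H. \<Delta> H (i + 1) a b) \<in> O[F](\<lambda>H. (frob H)\<^sup>2)"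
    proof -
      have "i + 1 \<le> k" using i by simp
      then have "\<forall>a<p. \<forall>b<p. (\<lambda>H. \<Delta> H (i + 1) a b) \<in> O[F](\<lambda>H. (frob H)\<^sup>2)"
        unfolding \<Delta>_def
        using moment_asymptotics[where F = F and \<eta> = frob and S = S and U = U and p = p and k = k,
          OF \<eta> S0 Sc Uc Uo Upos rec] by blast
      then show ?thesis using i b by blast
    qed
    ultimately show "(\<lambda>H. E H $$ (x, b)) \<in> O[F](\<lambda>H. (frob H)\<^sup>2)" by simp
  qed
  then obtain C where C: "C > 0" "\<forall>\<^sub>F H in F. norm (frob (E H)) \<le> C * norm ((frob H)\<^sup>2)"
    by (rule landau_o.bigE)
  from phi C(2) have "\<forall>\<^sub>F H in F. phi_inv p k (M + H) = V H \<and> frob (E H) \<le> C * (frob H)\<^sup>2"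
    by eventually_elim simp
  from FI[OF this] obtain \<delta> where \<delta>: "\<delta> > 0"
    "\<And>H. H \<in> A \<Longrightarrow> frob H < \<delta> \<Longrightarrow> phi_inv p k (M + H) = V H \<and> frob (E H) \<le> C * (frob H)\<^sup>2" by blast
  \<comment> \<open>At H = 0 the quadratic bound is zero, so the error term vanishes there.\<close>
  have z: "phi_inv p k M = V (0\<^sub>m (k * p) p)" "frob (E (0\<^sub>m (k * p) p)) = 0"
    using \<delta>(2)[OF zero] \<delta>(1) Mc frob_nonneg[of "E (0\<^sub>m (k * p) p)"] by auto
  \<comment> \<open>The arcsine constants cancel in the difference with H = 0, and the linear part
    is exactly L H, so only error terms remain.\<close>
  have VE: "V H - V (0\<^sub>m (k * p) p) - L * H = E H - E (0\<^sub>m (k * p) p)" if H: "H \<in> A" for H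
  proof (rule block_col_eqI)
    have LH: "L * H \<in> carrier_mat (k * p) p" by (rule mult_carrier_mat[OF Lc Ac[OF H]])
    show "V H - V (0\<^sub>m (k * p) p) - L * H \<in> carrier_mat (k * p) p" by (rule minus_carrier_mat[OF LH])
    show "E H - E (0\<^sub>m (k * p) p) \<in> carrier_mat (k * p) p" by (rule minus_carrier_mat[OF Ec])
    fix j assume j: "1 \<le> j" "j \<le> k"
    show "blk p (V H - V (0\<^sub>m (k * p) p) - L * H) j = blk p (E H - E (0\<^sub>m (k * p) p)) j"
    proof (rule eq_matI)
      fix a b assume "a < dim_row (blk p (E H - E (0\<^sub>m (k * p) p)) j)" "b < dim_col (blk p (E H - E (0\<^sub>m (k * p) p)) j)"
      then have ab: "a < p" "b < p" by (simp_all add: blk_def)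
      define x where "x = (j - 1) * p + a"
      have x: "x < k * p" unfolding x_def by (rule block_index_less) (use j ab in auto)
      have Vx: "V K $$ (x, b) = S K j $$ (a, b)" for K
        unfolding V_def x_def using j ab by (subst blockmat_col_entry) auto
      have Ex: "E K $$ (x, b) = \<Delta> K j a b" for K
        unfolding E_def x_def using j ab by (subst blockmat_col_entry) auto
      have D: "\<Delta> K j a b = S K j $$ (a, b) - (if a = b then arcsine_moment j else 0) -
          (\<Sum>l=1..j. cheb_coef j l * blk p K l $$ (a, b))" if "K \<in> A" for K
        unfolding \<Delta>_def using Ue[OF that] ab j by simp
      have "(\<Sum>l=1..j. cheb_coef j l * blk p (0\<^sub>m (k * p) p) l $$ (a, b)) = 0"
        using ab j block_index_less[of _ k a p] by (intro sum.neutral) (auto simp: blk_entry)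
      moreover have "(L * H) $$ (x, b) = (\<Sum>l=1..j. cheb_coef j l * blk p H l $$ (a, b))"
        using Amat_kron_mult[OF Ac[OF H] j ab] by (simp add: blk_entry[OF ab] L_def x_def)
      ultimately have "V H $$ (x, b) - V (0\<^sub>m (k * p) p) $$ (x, b) - (L * H) $$ (x, b) =
          E H $$ (x, b) - E (0\<^sub>m (k * p) p) $$ (x, b)"
        unfolding Vx Ex D[OF H] D[OF zero] by simp
      then show "blk p (V H - V (0\<^sub>m (k * p) p) - L * H) j $$ (a, b) = blk p (E H - E (0\<^sub>m (k * p) p)) j $$ (a, b)"
        unfolding blk_entry[OF ab] x_def[symmetric]
        using x ab carrier_matD[OF Vc] carrier_matD[OF Ec] carrier_matD[OF LH]
        by (simp del: index_mult_mat)
    qed (simp_all add: blk_def)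
  qed
  have "\<exists>d>0. \<forall>H\<in>symcols p k. frob H < d \<longrightarrow> M + H \<in> unitbox p k \<longrightarrow>
      frob (phi_inv p k (M + H) - phi_inv p k M - L * H) \<le> \<epsilon> * frob H" if \<epsilon>: "\<epsilon> > 0" for \<epsilon>
  \<comment> \<open>Below \<delta> the error is at most C times the square of \<open>frob H\<close>,
    and the radius \<epsilon> / C turns this into at most \<epsilon> times
    \<open>frob H\<close>.\<close>
  proof (intro exI[of _ "min \<delta> (\<epsilon> / C)"] conjI ballI impI)
    show "min \<delta> (\<epsilon> / C) > 0" using \<delta>(1) C(1) \<epsilon> by simp
    fix H assume H: "H \<in> symcols p k" "frob H < min \<delta> (\<epsilon> / C)" "M + H \<in> unitbox p k"
    then have HA: "H \<in> A" by (simp add: A_def)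
    have "frob (phi_inv p k (M + H) - phi_inv p k M - L * H) = frob (E H - E (0\<^sub>m (k * p) p))"
      using \<delta>(2)[OF HA] H(2) VE[OF HA] by (simp add: z(1))
    also have "\<dots> \<le> frob (E H)" using frob_diff[OF Ec Ec, of H "0\<^sub>m (k * p) p"] z(2) by simp
    also have "\<dots> \<le> (C * frob H) * frob H" using \<delta>(2)[OF HA] H(2) by (simp add: power2_eq_square mult.assoc)
    also have "\<dots> \<le> \<epsilon> * frob H"
      using H(2) C(1) by (intro mult_right_mono) (auto simp: field_simps)
    finally show "frob (phi_inv p k (M + H) - phi_inv p k M - L * H) \<le> \<epsilon> * frob H" .
  qed
  then show ?thesis
    using centre_unitbox[of p k] Lc unfolding matrix_diff_at_def M_def[symmetric] L_def[symmetric] by blast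
qed

end
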